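(* Let $\Omega \subset \mathbb{R}^d$ be open and non-empty and let $\mu \colon \Omega \to \mathbb{C}^{d \times d}$ be a bounded measurable function. Suppose that there exists an $m > 0$ such that $\operatorname{Re} \big(\mu(x) \xi \cdot \overline{\xi}\big) \geq m \, |\xi|^2$ for all $x \in \Omega$ and all $\xi \in \mathbb{C}^d$. Define $\mathfrak{a} \colon W^{1,2}(\Omega) \times W^{1,2}(\Omega) \to \mathbb{C}$ by $\mathfrak{a}[u,v] = \int_\Omega \mu \nabla u \cdot \overline{\nabla v}$, and let $M = \operatorname{ess\,sup}_{x \in \Omega} \|\mu(x)\|$ and $\kappa = \arctan \sqrt{\left(\frac{M}{m}\right)^2 - 1}$. Let $V \subset W^{1,2}(\Omega)$ be a closed subspace such that $C_c^\infty(\Omega) \subset V$, let $\mathfrak{a}_V = \mathfrak{a}|_{V \times V}$, and let $A_V$ be the m-sectorial operator in $L_2(\Omega)$ associated with the form $\mathfrak{a}_V$. Then $$\sigma(A_V) \subset \overline{\Lambda(A_V)} \subset \Sigma(\kappa).$$ Moreover, let $\theta \in (\kappa, \frac{\pi}{2})$. Then $$\|(A_V + \lambda I)^{-1}\|_{L_2(\Omega) \to L_2(\Omega)} \leq \frac{M}{m \sin\theta - \sqrt{M^2 - m^2}\,\cos\theta} \, \frac{1}{|\lambda|}$$ for all $\lambda \in \Sigma(\pi - \theta) \setminus \{0\}$.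
   Context: For $\theta \in [0,\pi)$, $\Sigma(\theta) = \{ r e^{i\varphi} : r \in [0,\infty),\ \varphi \in [-\theta,\theta] \}$. For an operator $T$ in a Hilbert space $H \neq \{0\}$ with domain $\operatorname{dom}(T)$, the numerical range is $\Lambda(T) = \{ (Tu,u)_H : u \in \operatorname{dom}(T),\ \|u\|_H = 1 \}$; $\sigma(T)$ is the spectrum. $\|\mu(x)\|$ is the operator norm on $\mathbb{C}^d$, and $\eta \cdot \zeta = \sum_k \eta_k\zeta_k$. The operator $A_V$ associated with $\mathfrak{a}_V$ is defined by: $u \in \operatorname{dom}(A_V)$ and $A_V u = g$ if and only if $u \in V$, $g \in L_2(\Omega)$ and $\mathfrak{a}[u,v] = (g,v)_{L_2(\Omega)}$ for all $v \in V$. Function spaces are complex. *)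

theory Defs
  imports "HOL-Analysis.Analysis" "HOL-Probability.Essential_Supremum"
begin

section \<open>Operators in a complex Hilbert space\<close>

text \<open>
  The distribution has no complex inner product spaces, and the spaces needed here depend on
  the term \<open>\<Omega>\<close>, so a Hilbert space is given by its carrier and its operations. The inner product
  is linear in the first argument.
\<close>

record 'a hilbert =
  elems :: "'a set"
  add :: "'a \<Rightarrow> 'a \<Rightarrow> 'a"
  scale :: "complex \<Rightarrow> 'a \<Rightarrow> 'a"
  ip :: "'a \<Rightarrow> 'a \<Rightarrow> complex"

definition hnorm :: "'a hilbert \<Rightarrow> 'a \<Rightarrow> real" where
  "hnorm H u = sqrt (Re (ip H u u))"

definition hdist :: "'a hilbert \<Rightarrow> 'a \<Rightarrow> 'a \<Rightarrow> real" where
  "hdist H u v = hnorm H (add H u (scale H (-1) v))"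

definition closed_subspace :: "'a hilbert \<Rightarrow> 'a set \<Rightarrow> bool" where
  "closed_subspace H V \<longleftrightarrow>
     V \<subseteq> elems H \<and> V \<noteq> {} \<and>
     (\<forall>u\<in>V. \<forall>v\<in>V. add H u v \<in> V) \<and>
     (\<forall>c. \<forall>u\<in>V. scale H c u \<in> V) \<and>
     (\<forall>u v. (\<forall>n. u n \<in> V) \<and> v \<in> elems H \<and> (\<lambda>n. hdist H (u n) v) \<longlonglongrightarrow> 0 \<longrightarrow> v \<in> V)"

text \<open>
  An (unbounded) operator is identified with its graph: \<open>(u, g) \<in> T\<close> means that
  \<open>u\<close> belongs to the domain of \<open>T\<close> and \<open>T u = g\<close>.
\<close>

type_synonym 'a operator = "('a \<times> 'a) set"

definition numerical_range :: "'a hilbert \<Rightarrow> 'a operator \<Rightarrow> complex set" where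
  "numerical_range H T = {ip H g u | u g. (u, g) \<in> T \<and> hnorm H u = 1}"

text \<open>The operator \<open>T + z I\<close>, with the domain of \<open>T\<close>.\<close>

definition op_shift :: "'a hilbert \<Rightarrow> 'a operator \<Rightarrow> complex \<Rightarrow> 'a operator" where
  "op_shift H T z = {(u, add H g (scale H z u)) | u g. (u, g) \<in> T}"

definition boundedly_invertible :: "'a hilbert \<Rightarrow> 'a operator \<Rightarrow> bool" where
  "boundedly_invertible H S \<longleftrightarrow>
     (\<forall>g\<in>elems H. \<exists>!u. (u, g) \<in> S) \<and>
     (\<exists>C. \<forall>u g. (u, g) \<in> S \<longrightarrow> hnorm H u \<le> C * hnorm H g)"

definition resolvent_set :: "'a hilbert \<Rightarrow> 'a operator \<Rightarrow> complex set" where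
  "resolvent_set H T = {z. boundedly_invertible H (op_shift H T (- z))}"

definition spectrum :: "'a hilbert \<Rightarrow> 'a operator \<Rightarrow> complex set" where
  "spectrum H T = - resolvent_set H T"

text \<open>Only meaningful for a bounded operator, because \<open>Sup\<close> is that of the reals.\<close>

definition op_norm :: "'a hilbert \<Rightarrow> 'a operator \<Rightarrow> real" where
  "op_norm H R = Sup {hnorm H v | u v. (u, v) \<in> R \<and> hnorm H u \<le> 1}"

text \<open>The operator in \<open>H\<close> associated with a sesquilinear form \<open>a\<close> with form domain \<open>V\<close>.\<close>

definition form_operator ::
    "'a hilbert \<Rightarrow> 'a set \<Rightarrow> ('a \<Rightarrow> 'a \<Rightarrow> complex) \<Rightarrow> 'a operator" where
  "form_operator H V a = {(u, g). u \<in> V \<and> g \<in> elems H \<and> (\<forall>v\<in>V. a u v = ip H g v)}"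

definition sector :: "real \<Rightarrow> complex set" where
  "sector \<theta> = {complex_of_real r * cis \<phi> | r \<phi>. 0 \<le> r \<and> \<phi> \<in> {- \<theta>..\<theta>}}"


section \<open>The space \<open>L\<^sub>2(\<Omega>)\<close>\<close>

text \<open>
  Functions on \<open>\<Omega>\<close> are total functions whose values outside \<open>\<Omega>\<close> are ignored, and elements of
  \<open>L\<^sub>2(\<Omega>)\<close> are classes of square integrable functions that agree almost everywhere on \<open>\<Omega>\<close>.
\<close>

type_synonym 'n cfun = "real ^ 'n \<Rightarrow> complex"

definition square_integrable :: "(real ^ 'n) set \<Rightarrow> (real ^ 'n \<Rightarrow> 'b::real_normed_vector) \<Rightarrow> bool" where
  "square_integrable \<Omega> f \<longleftrightarrow>
     f \<in> borel_measurable (lebesgue_on \<Omega>) \<and> integrable (lebesgue_on \<Omega>) (\<lambda>x. (norm (f x))\<^sup>2)"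

definition L2_class :: "(real ^ 'n) set \<Rightarrow> 'n cfun \<Rightarrow> 'n cfun set" where
  "L2_class \<Omega> f = {g. square_integrable \<Omega> g \<and> (AE x in lebesgue_on \<Omega>. g x = f x)}"

definition rep :: "'n cfun set \<Rightarrow> 'n cfun" where
  "rep X = (SOME f. f \<in> X)"

definition L2 :: "(real ^ 'n) set \<Rightarrow> 'n cfun set hilbert" where
  "L2 \<Omega> =
     \<lparr> elems = L2_class \<Omega> ` {f. square_integrable \<Omega> f},
       add = (\<lambda>u v. L2_class \<Omega> (\<lambda>x. rep u x + rep v x)),
       scale = (\<lambda>c u. L2_class \<Omega> (\<lambda>x. c * rep u x)),
       ip = (\<lambda>u v. \<integral>x. rep u x * cnj (rep v x) \<partial>lebesgue_on \<Omega>) \<rparr>"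


section \<open>The space \<open>W\<^sup>1\<^sup>,\<^sup>2(\<Omega>)\<close>\<close>

definition partial_deriv :: "'n \<Rightarrow> 'n::finite cfun \<Rightarrow> 'n cfun" where
  "partial_deriv k f x = frechet_derivative f (at x) (axis k 1)"

primrec C_diff :: "nat \<Rightarrow> 'n::finite cfun \<Rightarrow> bool" where
  "C_diff 0 f = continuous_on UNIV f"
| "C_diff (Suc j) f = ((\<forall>x. f differentiable (at x)) \<and> (\<forall>k. C_diff j (partial_deriv k f)))"

text \<open>
  \<open>C\<^sub>c\<^sup>\<infinity>(\<Omega>)\<close>, with each function extended by zero to the whole space.
\<close>

definition test_functions :: "(real ^ 'n::finite) set \<Rightarrow> 'n cfun set" where
  "test_functions \<Omega> =
     {\<phi>. (\<forall>j. C_diff j \<phi>) \<and> compact (closure {x. \<phi> x \<noteq> 0}) \<and> closure {x. \<phi> x \<noteq> 0} \<subseteq> \<Omega>}"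

definition weak_gradient ::
    "(real ^ 'n::finite) set \<Rightarrow> 'n cfun \<Rightarrow> (real ^ 'n \<Rightarrow> complex ^ 'n) \<Rightarrow> bool" where
  "weak_gradient \<Omega> f G \<longleftrightarrow>
     square_integrable \<Omega> G \<and>
     (\<forall>\<phi>\<in>test_functions \<Omega>. \<forall>k.
        (\<integral>x. f x * partial_deriv k \<phi> x \<partial>lebesgue_on \<Omega>) =
        - (\<integral>x. G x $ k * \<phi> x \<partial>lebesgue_on \<Omega>))"

definition grad :: "(real ^ 'n::finite) set \<Rightarrow> 'n cfun set \<Rightarrow> real ^ 'n \<Rightarrow> complex ^ 'n" where
  "grad \<Omega> u = (SOME G. weak_gradient \<Omega> (rep u) G)"

text \<open>The bilinear product \<open>\<eta> \<cdot> \<zeta>\<close>, without conjugation.\<close>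

definition cdot :: "complex ^ 'n::finite \<Rightarrow> complex ^ 'n \<Rightarrow> complex" where
  "cdot \<eta> \<zeta> = (\<Sum>k\<in>UNIV. \<eta> $ k * \<zeta> $ k)"

definition vcnj :: "complex ^ 'n::finite \<Rightarrow> complex ^ 'n" where
  "vcnj \<eta> = (\<chi> k. cnj (\<eta> $ k))"

definition W12 :: "(real ^ 'n::finite) set \<Rightarrow> 'n cfun set hilbert" where
  "W12 \<Omega> =
     \<lparr> elems = {u \<in> elems (L2 \<Omega>). \<exists>G. weak_gradient \<Omega> (rep u) G},
       add = add (L2 \<Omega>),
       scale = scale (L2 \<Omega>),
       ip = (\<lambda>u v. ip (L2 \<Omega>) u v +
                   (\<integral>x. cdot (grad \<Omega> u x) (vcnj (grad \<Omega> v x)) \<partial>lebesgue_on \<Omega>)) \<rparr>"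


section \<open>The elliptic form\<close>

definition elliptic_form ::
    "(real ^ 'n::finite) set \<Rightarrow> (real ^ 'n \<Rightarrow> complex ^ 'n ^ 'n)
      \<Rightarrow> 'n cfun set \<Rightarrow> 'n cfun set \<Rightarrow> complex" where
  "elliptic_form \<Omega> \<mu> u v =
     (\<integral>x. cdot (\<mu> x *v grad \<Omega> u x) (vcnj (grad \<Omega> v x)) \<partial>lebesgue_on \<Omega>)"

text \<open>
  The library's \<open>esssup\<close> needs a complete linear order as codomain, hence the detour through
  the extended reals; the value is finite for bounded measurable \<open>\<mu>\<close> and non-null \<open>\<Omega>\<close>.
\<close>

definition ess_sup_norm ::
    "(real ^ 'n::finite) set \<Rightarrow> (real ^ 'n \<Rightarrow> complex ^ 'n ^ 'n) \<Rightarrow> real" where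
  "ess_sup_norm \<Omega> \<mu> =
     real_of_ereal (esssup (lebesgue_on \<Omega>) (\<lambda>x. ereal (onorm (\<lambda>\<xi>. \<mu> x *v \<xi>))))"

end

theory Submission
  imports Defs
begin

text \<open>
  Write \<open>a\<close> for the elliptic form. Since \<open>\<bar>a u u\<bar> \<le> M * norm (grad u)^2 \<le> M / m * Re (a u u)\<close> and
  \<open>cos \<kappa> = m / M\<close>, the numerical range lies in the sector of angle \<open>\<kappa>\<close>. It is convex by the
  Toeplitz--Hausdorff theorem, so a point \<open>z\<close> outside its closure is strictly separated from it
  by a line. The separating inequality extends from the domain of the operator to \<open>V\<close>, the domain
  being dense in \<open>V\<close>, and a small tilt of the line makes a scalar multiple of \<open>a - z\<close>
  coercive on \<open>V\<close>; Lax--Milgram then gives surjectivity of \<open>A - z\<close>, and the distance of \<open>z\<close> to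
  the numerical range bounds the inverse. For \<open>- z\<close> with \<open>z\<close> in the sector of angle \<open>pi - \<theta>\<close> this
  distance is at least \<open>\<bar>z\<bar> * sin (\<theta> - \<kappa>)\<close>. That \<open>V\<close> is a Hilbert space on which \<open>a\<close> is sesquilinear
  rests on the completeness of \<open>L\<^sub>2\<close> and on the uniqueness of weak gradients, the latter
  by approximating indicators of boxes by products of the functions \<open>exp (- 1 / t)\<close>.
\<close>

section \<open>Square integrable functions\<close>

text \<open>Two obstacles shape the proof. First, vectors are classes with chosen representatives.
  The abstract part therefore computes only with values of sesquilinear forms, which may be
  degenerate, and definiteness of the product of \<open>L2\<close> leads back to equality of
  classes. Second, for \<open>z\<close> off the closed numerical range the easy estimate makes
  \<open>A - z\<close> injective with closed range, but not onto. An index argument would have to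
  reach \<open>z\<close> through a connected set from a point where surjectivity is known;
  separation by a line treats each \<open>z\<close> on its own. The line only gives a lower bound by
  the norm of \<open>L2\<close>, whereas Lax-Milgram needs the form norm. The tilt borrows a small
  multiple of the ellipticity inequality, which controls the gradient, and spends at most half of
  the gap between \<open>z\<close> and the line. The constant of the resolvent estimate is
  \<open>1 / sin (\<theta> - \<kappa>)\<close>, expanded by the subtraction formula with
  \<open>cos \<kappa> = m / M\<close> and
  \<open>sin \<kappa> = sqrt (M^2 - m^2) / M\<close>.\<close>

lemma integrable_norm_mult:
  fixes f :: "'a \<Rightarrow> 'b::{banach, second_countable_topology}"
    and g :: "'a \<Rightarrow> 'c::{banach, second_countable_topology}"
  assumes [measurable]: "f \<in> borel_measurable M" "g \<in> borel_measurable M"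
    and int: "integrable M (\<lambda>x. (norm (f x))\<^sup>2)" "integrable M (\<lambda>x. (norm (g x))\<^sup>2)"
  shows "integrable M (\<lambda>x. norm (f x) * norm (g x))"
proof (rule Bochner_Integration.integrable_bound[OF Bochner_Integration.integrable_add[OF int]])
  show "AE x in M. norm (norm (f x) * norm (g x)) \<le> norm ((norm (f x))\<^sup>2 + (norm (g x))\<^sup>2)"
  proof (rule AE_I2)
    fix x
    have "norm (f x) * norm (g x) \<le> (norm (f x))\<^sup>2 + (norm (g x))\<^sup>2"
      using sum_squares_bound[of "norm (f x)" "norm (g x)"]
        mult_nonneg_nonneg[OF norm_ge_zero[of "f x"] norm_ge_zero[of "g x"]] by linarith
    then show "norm (norm (f x) * norm (g x)) \<le> norm ((norm (f x))\<^sup>2 + (norm (g x))\<^sup>2)"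
      by (simp add: abs_mult)
  qed
qed simp

text \<open>The integral of \<open>(norm (f x) - t * norm (g x))^2\<close> is a quadratic in
  \<open>t\<close> that is never negative. Passing to norms first makes the inequality available for
  vector valued functions such as gradients.\<close>

lemma integral_cauchy_schwarz:
  fixes f :: "'a \<Rightarrow> 'b::{banach, second_countable_topology}"
    and g :: "'a \<Rightarrow> 'c::{banach, second_countable_topology}"
  assumes meas: "f \<in> borel_measurable M" "g \<in> borel_measurable M"
    and int: "integrable M (\<lambda>x. (norm (f x))\<^sup>2)" "integrable M (\<lambda>x. (norm (g x))\<^sup>2)"
  shows "(\<integral>x. norm (f x) * norm (g x) \<partial>M)\<^sup>2 \<le> (\<integral>x. (norm (f x))\<^sup>2 \<partial>M) * (\<integral>x. (norm (g x))\<^sup>2 \<partial>M)"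
proof -
  define A B r where "A = (\<integral>x. (norm (f x))\<^sup>2 \<partial>M)" and "B = (\<integral>x. (norm (g x))\<^sup>2 \<partial>M)"
    and "r = (\<integral>x. norm (f x) * norm (g x) \<partial>M)"
  note prod = integrable_norm_mult[OF meas int]
  have ineq: "0 \<le> A - 2 * t * r + t\<^sup>2 * B" for t
  proof -
    have "0 \<le> (\<integral>x. (norm (f x) - t * norm (g x))\<^sup>2 \<partial>M)" by simp
    also have "(\<lambda>x. (norm (f x) - t * norm (g x))\<^sup>2)
        = (\<lambda>x. (norm (f x))\<^sup>2 - 2 * t * (norm (f x) * norm (g x)) + t\<^sup>2 * (norm (g x))\<^sup>2)"
      by (auto simp: power2_eq_square algebra_simps)
    also have "(\<integral>x. (norm (f x))\<^sup>2 - 2 * t * (norm (f x) * norm (g x)) + t\<^sup>2 * (norm (g x))\<^sup>2 \<partial>M)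
        = A - 2 * t * r + t\<^sup>2 * B"
      using int prod by (simp add: A_def B_def r_def)
    finally show ?thesis .
  qed
  have "0 \<le> B" by (simp add: B_def)
  have "r\<^sup>2 \<le> A * B"
  proof (cases "B = 0")
    case True
    have "r = 0"
    proof (rule ccontr)
      assume "r \<noteq> 0"
      \<comment> \<open>With \<open>B = 0\<close> the quadratic is affine in \<open>t\<close>, and
        this \<open>t\<close> would give it the value -1.\<close>
      then show False using ineq[of "(A + 1) / (2 * r)"] True by simp
    qed
    then show ?thesis using True by simp
  next
    case False
    then have "0 \<le> A - r\<^sup>2 / B" using ineq[of "r / B"] by (simp add: power2_eq_square field_simps)
    then show ?thesis using False \<open>0 \<le> B\<close> by (simp add: field_simps)
  qed
  then show ?thesis by (simp add: A_def B_def r_def)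
qed

lemma norm_add_sq_le: "(norm (x + y))\<^sup>2 \<le> 2 * (norm x)\<^sup>2 + 2 * (norm (y :: 'a::real_normed_vector))\<^sup>2"
proof -
  have "(norm (x + y))\<^sup>2 \<le> (norm x + norm y)\<^sup>2"
    by (intro power_mono norm_triangle_ineq) auto
  also have "\<dots> \<le> 2 * (norm x)\<^sup>2 + 2 * (norm y)\<^sup>2"
    using zero_le_power2[of "norm x - norm y"] by (simp add: power2_eq_square algebra_simps)
  finally show ?thesis .
qed

lemma integrable_norm_add_sq:
  fixes f g :: "'a \<Rightarrow> 'b::{banach, second_countable_topology}"
  assumes [measurable]: "f \<in> borel_measurable M" "g \<in> borel_measurable M"
    and int: "integrable M (\<lambda>x. (norm (f x))\<^sup>2)" "integrable M (\<lambda>x. (norm (g x))\<^sup>2)"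
  shows "integrable M (\<lambda>x. (norm (f x + g x))\<^sup>2)"
proof (rule Bochner_Integration.integrable_bound)
  show "integrable M (\<lambda>x. 2 * (norm (f x))\<^sup>2 + 2 * (norm (g x))\<^sup>2)" using int by simp
  show "AE x in M. norm ((norm (f x + g x))\<^sup>2) \<le> norm (2 * (norm (f x))\<^sup>2 + 2 * (norm (g x))\<^sup>2)"
    using norm_add_sq_le[of "f _" "g _"] by (intro AE_I2) (simp add: abs_of_nonneg)
qed simp

lemma integrable_norm_diff_sq:
  fixes f g :: "'a \<Rightarrow> 'b::{banach, second_countable_topology}"
  assumes "f \<in> borel_measurable M" "g \<in> borel_measurable M"
    and "integrable M (\<lambda>x. (norm (f x))\<^sup>2)" "integrable M (\<lambda>x. (norm (g x))\<^sup>2)"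
  shows "integrable M (\<lambda>x. (norm (f x - g x))\<^sup>2)"
  using integrable_norm_add_sq[of f M "\<lambda>x. - g x"] assms by simp

text \<open>Riesz--Fischer: along a fast subsequence, \<open>\<Sum>k. 2^k * norm (f (r (Suc k)) x - f (r k) x)^2\<close> is
  integrable, which forces pointwise geometric decay of the increments almost everywhere.\<close>

lemma L2_complete:
  fixes f :: "nat \<Rightarrow> 'a \<Rightarrow> 'b::{banach, second_countable_topology}"
  assumes meas[measurable]: "\<And>n. f n \<in> borel_measurable M"
    and int: "\<And>n. integrable M (\<lambda>x. (norm (f n x))\<^sup>2)"
    and cauchy: "\<And>e. 0 < e \<Longrightarrow> \<exists>N. \<forall>m\<ge>N. \<forall>n\<ge>N. (\<integral>x. (norm (f m x - f n x))\<^sup>2 \<partial>M) < e"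
  obtains g where "g \<in> borel_measurable M" "integrable M (\<lambda>x. (norm (g x))\<^sup>2)"
    "(\<lambda>n. \<integral>x. (norm (f n x - g x))\<^sup>2 \<partial>M) \<longlonglongrightarrow> 0"
proof -
  note int_diff = integrable_norm_diff_sq[OF meas meas int int]
  have "\<exists>r. \<forall>k. (\<forall>m\<ge>r k. \<forall>n\<ge>r k. (\<integral>x. (norm (f m x - f n x))\<^sup>2 \<partial>M) < (1/4)^k) \<and> r k < r (Suc k)"
  proof (intro dependent_nat_choice)
    show "\<exists>N. \<forall>m\<ge>N. \<forall>n\<ge>N. (\<integral>x. (norm (f m x - f n x))\<^sup>2 \<partial>M) < (1/4)^0"
      using cauchy[of 1] by simp
    fix N k
    obtain N' where N': "\<forall>m\<ge>N'. \<forall>n\<ge>N'. (\<integral>x. (norm (f m x - f n x))\<^sup>2 \<partial>M) < (1/4)^Suc k"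
      using cauchy[of "(1/4)^Suc k"] by auto
    show "\<exists>N'. (\<forall>m\<ge>N'. \<forall>n\<ge>N'. (\<integral>x. (norm (f m x - f n x))\<^sup>2 \<partial>M) < (1/4)^Suc k) \<and> N < N'"
      using N' by (intro exI[of _ "max N' (Suc N)"]) auto
  qed
  then obtain r where fast: "\<And>k m n. m \<ge> r k \<Longrightarrow> n \<ge> r k \<Longrightarrow> (\<integral>x. (norm (f m x - f n x))\<^sup>2 \<partial>M) < (1/4)^k"
    and r_less: "\<And>k. r k < r (Suc k)" by blast
  have r_mono: "strict_mono r" using r_less by (simp add: strict_mono_Suc_iff)
  \<comment> \<open>The weight \<open>2^k\<close> against the bound \<open>(1/4)^k\<close> leaves
    the summable \<open>(1/2)^k\<close>, while boundedness of \<open>D k x\<close> in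
    \<open>k\<close> still forces increments of order \<open>sqrt (1/2) ^ k\<close>.\<close>
  define D where "D = (\<lambda>k x. 2^k * (norm (f (r (Suc k)) x - f (r k) x))\<^sup>2)"
  have D_meas[measurable]: "D k \<in> borel_measurable M" for k unfolding D_def by measurable
  have D_int: "(\<integral>\<^sup>+x. ennreal (D k x) \<partial>M) \<le> ennreal ((1/2)^k)" for k
  proof -
    have "(\<integral>\<^sup>+x. ennreal (D k x) \<partial>M) = ennreal (\<integral>x. D k x \<partial>M)"
      using int_diff by (intro nn_integral_eq_integral) (auto simp: D_def)
    also have "(\<integral>x. D k x \<partial>M) \<le> 2^k * (1/4)^k"
      unfolding D_def using fast[of k "r (Suc k)" "r k"] r_less[of k] by simp
    also have "(2::real)^k * (1/4)^k = (1/2)^k" by (simp flip: power_mult_distrib)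
    finally show ?thesis by (simp add: ennreal_leI)
  qed
  have "(\<integral>\<^sup>+x. (\<Sum>k. ennreal (D k x)) \<partial>M) = (\<Sum>k. \<integral>\<^sup>+x. ennreal (D k x) \<partial>M)"
    by (rule nn_integral_suminf) measurable
  also have "\<dots> \<le> (\<Sum>k. ennreal ((1/2)^k))" using D_int by (intro suminf_le) auto
  also have "\<dots> = ennreal (\<Sum>k. (1/2)^k)" by (intro suminf_ennreal2) (auto intro: summable_geometric)
  also have "\<dots> < \<infinity>" by simp
  finally have "AE x in M. (\<Sum>k. ennreal (D k x)) \<noteq> \<infinity>"
    by (intro nn_integral_PInf_AE) auto
  then have conv: "AE x in M. convergent (\<lambda>k. f (r k) x)"
  proof eventually_elim
    fix x assume x: "(\<Sum>k. ennreal (D k x)) \<noteq> \<infinity>"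
    define S where "S = enn2real (\<Sum>k. ennreal (D k x))"
    have D_le: "D k x \<le> S" for k
    proof -
      have "ennreal (D k x) \<le> (\<Sum>k. ennreal (D k x))"
        using sum_le_suminf[of "\<lambda>k. ennreal (D k x)" "{k}"] by simp
      then have "enn2real (ennreal (D k x)) \<le> S"
        unfolding S_def using x by (intro enn2real_mono) (auto simp: less_top)
      then show ?thesis by (simp add: D_def)
    qed
    have "norm (f (r (Suc k)) x - f (r k) x) \<le> sqrt S * sqrt (1/2) ^ k" for k
    proof -
      have "(norm (f (r (Suc k)) x - f (r k) x))\<^sup>2 \<le> S * (1/2)^k"
        using D_le[of k] by (simp add: D_def field_simps power_one_over)
      then have "norm (f (r (Suc k)) x - f (r k) x) \<le> sqrt (S * (1/2)^k)" by (rule real_le_rsqrt)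
      then show ?thesis by (simp only: real_sqrt_mult real_sqrt_power)
    qed
    moreover have "summable (\<lambda>k. sqrt S * sqrt (1/2) ^ k)"
      by (intro summable_mult summable_geometric) (auto simp: real_sqrt_lt_1_iff)
    ultimately have "summable (\<lambda>k. f (r (Suc k)) x - f (r k) x)"
      by (metis (no_types, lifting) summable_comparison_test')
    then have "convergent (\<lambda>n. \<Sum>k<n. f (r (Suc k)) x - f (r k) x)"
      by (simp add: summable_iff_convergent)
    then have "convergent (\<lambda>n. f (r n) x - f (r 0) x)"
      by (simp only: sum_lessThan_telescope[of "\<lambda>k. f (r k) x"])
    then show "convergent (\<lambda>k. f (r k) x)"
      using convergent_add[of "\<lambda>n. f (r n) x - f (r 0) x" "\<lambda>_. f (r 0) x"] by (simp add: convergent_const)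
  qed
  define g where "g = (\<lambda>x. lim (\<lambda>k. f (r k) x))"
  have g[measurable]: "g \<in> borel_measurable M" unfolding g_def by measurable
  have lim: "AE x in M. (\<lambda>k. f (r k) x) \<longlonglongrightarrow> g x"
    using conv by eventually_elim (simp add: g_def convergent_LIMSEQ_iff)
  \<comment> \<open>Fatou's lemma passes the Cauchy bound between \<open>f n\<close> and
    \<open>f (r k)\<close> to the limit in \<open>k\<close>. The bound holds for every large
    \<open>n\<close>, so the whole sequence converges and not only the subsequence.\<close>
  have fatou: "(\<integral>\<^sup>+x. ennreal ((norm (f n x - g x))\<^sup>2) \<partial>M) \<le> ennreal e"
    if e: "0 < e" and n: "\<forall>m\<ge>N. \<forall>n\<ge>N. (\<integral>x. (norm (f m x - f n x))\<^sup>2 \<partial>M) < e" "n \<ge> N" for n N e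
  proof -
    have "(\<integral>\<^sup>+x. ennreal ((norm (f n x - g x))\<^sup>2) \<partial>M)
        = (\<integral>\<^sup>+x. liminf (\<lambda>k. ennreal ((norm (f n x - f (r k) x))\<^sup>2)) \<partial>M)"
    proof (rule nn_integral_cong_AE, use lim in eventually_elim)
      fix x assume "(\<lambda>k. f (r k) x) \<longlonglongrightarrow> g x"
      then have "(\<lambda>k. ennreal ((norm (f n x - f (r k) x))\<^sup>2)) \<longlonglongrightarrow> ennreal ((norm (f n x - g x))\<^sup>2)"
        by (intro tendsto_intros)
      then show "ennreal ((norm (f n x - g x))\<^sup>2) = liminf (\<lambda>k. ennreal ((norm (f n x - f (r k) x))\<^sup>2))"
        by (rule lim_imp_Liminf[OF sequentially_bot, symmetric])
    qed
    also have "\<dots> \<le> liminf (\<lambda>k. \<integral>\<^sup>+x. ennreal ((norm (f n x - f (r k) x))\<^sup>2) \<partial>M)"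
      by (rule nn_integral_liminf) measurable
    also have "\<dots> \<le> limsup (\<lambda>k. \<integral>\<^sup>+x. ennreal ((norm (f n x - f (r k) x))\<^sup>2) \<partial>M)"
      by (rule Liminf_le_Limsup) simp
    also have "\<dots> \<le> ennreal e"
    proof (rule Limsup_bounded, rule eventually_sequentiallyI)
      fix k assume "N \<le> k"
      then have "N \<le> r k" using seq_suble[OF r_mono, of k] by simp
      then have "(\<integral>x. (norm (f n x - f (r k) x))\<^sup>2 \<partial>M) \<le> e" using n by (meson less_imp_le)
      moreover have "(\<integral>\<^sup>+x. ennreal ((norm (f n x - f (r k) x))\<^sup>2) \<partial>M)
          = ennreal (\<integral>x. (norm (f n x - f (r k) x))\<^sup>2 \<partial>M)"
        using int_diff by (intro nn_integral_eq_integral) auto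
      ultimately show "(\<integral>\<^sup>+x. ennreal ((norm (f n x - f (r k) x))\<^sup>2) \<partial>M) \<le> ennreal e"
        by (simp add: ennreal_leI)
    qed
    finally show ?thesis .
  qed
  obtain N where N: "\<forall>m\<ge>N. \<forall>n\<ge>N. (\<integral>x. (norm (f m x - f n x))\<^sup>2 \<partial>M) < 1"
    using cauchy[of 1] by auto
  have "integrable M (\<lambda>x. (norm (f N x - g x))\<^sup>2)"
    using fatou[OF _ N, of N] by (intro integrableI_nonneg) (auto simp: le_less_trans)
  \<comment> \<open>Here \<open>g\<close> is recovered as \<open>f N - (f N - g)\<close>, a
    difference of square integrable functions.\<close>
  then have "integrable M (\<lambda>x. (norm (f N x - (f N x - g x)))\<^sup>2)"
    using integrable_norm_diff_sq[of "f N" M "\<lambda>x. f N x - g x"] int by simp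
  then have g_int: "integrable M (\<lambda>x. (norm (g x))\<^sup>2)" by simp
  have "(\<lambda>n. \<integral>x. (norm (f n x - g x))\<^sup>2 \<partial>M) \<longlonglongrightarrow> 0"
  proof (rule LIMSEQ_I)
    fix e :: real assume e: "0 < e"
    then have e2: "0 < e / 2" by simp
    obtain N where N: "\<forall>m\<ge>N. \<forall>n\<ge>N. (\<integral>x. (norm (f m x - f n x))\<^sup>2 \<partial>M) < e / 2"
      using cauchy[OF e2] by auto
    have "norm ((\<integral>x. (norm (f n x - g x))\<^sup>2 \<partial>M) - 0) < e" if "n \<ge> N" for n
    proof -
      have "ennreal (\<integral>x. (norm (f n x - g x))\<^sup>2 \<partial>M) = (\<integral>\<^sup>+x. ennreal ((norm (f n x - g x))\<^sup>2) \<partial>M)"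
        using integrable_norm_diff_sq[OF meas g int g_int] by (intro nn_integral_eq_integral[symmetric]) auto
      then have "ennreal (\<integral>x. (norm (f n x - g x))\<^sup>2 \<partial>M) \<le> ennreal (e / 2)"
        using fatou[OF e2 N that] by simp
      then have "(\<integral>x. (norm (f n x - g x))\<^sup>2 \<partial>M) \<le> e / 2"
        using e2 by (subst (asm) ennreal_le_iff) auto
      then show ?thesis using e by simp
    qed
    then show "\<exists>N. \<forall>n\<ge>N. norm ((\<integral>x. (norm (f n x - g x))\<^sup>2 \<partial>M) - 0) < e" by blast
  qed
  then show ?thesis using that g g_int by blast
qed

section \<open>Sesquilinear forms on carriers\<close>

text \<open>No laws are postulated for \<open>add\<close> and \<open>sc\<close>. All algebra is done
  on values of forms, where additivity and homogeneity in each slot suffice; two vectors are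
  compared by pairing both with the others.\<close>

locale sesq_ops =
  fixes add :: "'a \<Rightarrow> 'a \<Rightarrow> 'a" and sc :: "complex \<Rightarrow> 'a \<Rightarrow> 'a"
begin

abbreviation diff :: "'a \<Rightarrow> 'a \<Rightarrow> 'a" where "diff u v \<equiv> add u (sc (-1) v)"

definition lin_closed :: "'a set \<Rightarrow> bool" where
  "lin_closed V \<longleftrightarrow> V \<noteq> {} \<and> (\<forall>u\<in>V. \<forall>v\<in>V. add u v \<in> V) \<and> (\<forall>c. \<forall>u\<in>V. sc c u \<in> V)"

definition antilinear_on :: "'a set \<Rightarrow> ('a \<Rightarrow> complex) \<Rightarrow> bool" where
  "antilinear_on V l \<longleftrightarrow>
     (\<forall>u\<in>V. \<forall>v\<in>V. l (add u v) = l u + l v) \<and> (\<forall>c. \<forall>u\<in>V. l (sc c u) = cnj c * l u)"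

text \<open>Linearity in the first slot is antilinearity of the conjugate, so one predicate serves
  both slots.\<close>

definition sesq :: "'a set \<Rightarrow> ('a \<Rightarrow> 'a \<Rightarrow> complex) \<Rightarrow> bool" where
  "sesq V b \<longleftrightarrow>
     (\<forall>u\<in>V. antilinear_on V (b u)) \<and> (\<forall>v\<in>V. antilinear_on V (\<lambda>u. cnj (b u v)))"

definition herm_pos :: "'a set \<Rightarrow> ('a \<Rightarrow> 'a \<Rightarrow> complex) \<Rightarrow> bool" where
  "herm_pos V h \<longleftrightarrow> sesq V h \<and> (\<forall>u\<in>V. \<forall>v\<in>V. h v u = cnj (h u v)) \<and> (\<forall>u\<in>V. 0 \<le> Re (h u u))"

text \<open>Distances stay squared to avoid roots. Limits may fail to be unique, since
  \<open>h\<close> may be only semidefinite.\<close>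

definition complete_wrt :: "('a \<Rightarrow> 'a \<Rightarrow> complex) \<Rightarrow> 'a set \<Rightarrow> bool" where
  "complete_wrt h V \<longleftrightarrow>
     (\<forall>x. (\<forall>n. x n \<in> V) \<and>
          (\<forall>e>0. \<exists>N. \<forall>m\<ge>N. \<forall>n\<ge>N. Re (h (diff (x m) (x n)) (diff (x m) (x n))) < e) \<longrightarrow>
          (\<exists>u\<in>V. (\<lambda>n::nat. Re (h (diff (x n) u) (diff (x n) u))) \<longlonglongrightarrow> 0))"

lemma lin_closedD:
  assumes "lin_closed V"
  shows "V \<noteq> {}" "u \<in> V \<Longrightarrow> v \<in> V \<Longrightarrow> add u v \<in> V" "u \<in> V \<Longrightarrow> sc c u \<in> V"
  using assms by (auto simp: lin_closed_def)

lemma antilinear_onD: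
  assumes "antilinear_on V l"
  shows "u \<in> V \<Longrightarrow> v \<in> V \<Longrightarrow> l (add u v) = l u + l v" "u \<in> V \<Longrightarrow> l (sc c u) = cnj c * l u"
  using assms by (auto simp: antilinear_on_def)

lemma sesqD:
  assumes "sesq V b" "u \<in> V" "v \<in> V"
  shows "w \<in> V \<Longrightarrow> b (add u v) w = b u w + b v w" "w \<in> V \<Longrightarrow> b w (add u v) = b w u + b w v"
    "b (sc c u) v = c * b u v" "b v (sc c u) = cnj c * b v u"
proof -
  have 1: "antilinear_on V (b x)" "antilinear_on V (\<lambda>u. cnj (b u x))" if "x \<in> V" for x
    using assms that by (auto simp: sesq_def)
  show "b (add u v) w = b u w + b v w" if "w \<in> V"
    using antilinear_onD(1)[OF 1(2)[OF that] assms(2,3)] by (metis complex_cnj_add complex_cnj_cnj)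
  show "b w (add u v) = b w u + b w v" if "w \<in> V"
    using antilinear_onD(1)[OF 1(1)[OF that] assms(2,3)] .
  show "b (sc c u) v = c * b u v"
    using antilinear_onD(2)[OF 1(2)[OF assms(3)] assms(2)] by (metis complex_cnj_mult complex_cnj_cnj)
  show "b v (sc c u) = cnj c * b v u"
    using antilinear_onD(2)[OF 1(1)[OF assms(3)] assms(2)] .
qed

lemma sesqI:
  assumes "\<And>u v w. u \<in> V \<Longrightarrow> v \<in> V \<Longrightarrow> w \<in> V \<Longrightarrow> b (add u v) w = b u w + b v w"
    and "\<And>u v w. u \<in> V \<Longrightarrow> v \<in> V \<Longrightarrow> w \<in> V \<Longrightarrow> b w (add u v) = b w u + b w v"
    and "\<And>c u v. u \<in> V \<Longrightarrow> v \<in> V \<Longrightarrow> b (sc c u) v = c * b u v"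
    and "\<And>c u v. u \<in> V \<Longrightarrow> v \<in> V \<Longrightarrow> b v (sc c u) = cnj c * b v u"
  shows "sesq V b"
  unfolding sesq_def antilinear_on_def using assms by auto

lemma sesq_expand:
  assumes "sesq V b" "lin_closed V" "u \<in> V" "v \<in> V"
  shows "b (add u (sc c v)) (add u (sc c v))
           = b u u + cnj c * b u v + c * b v u + c * cnj c * b v v"
  using assms by (simp add: sesqD[OF assms(1)] lin_closedD algebra_simps)

lemma sesq_subset: "sesq V b \<Longrightarrow> D \<subseteq> V \<Longrightarrow> sesq D b"
  by (auto simp: sesq_def antilinear_on_def subset_eq)

lemma herm_pos_subset: "herm_pos V b \<Longrightarrow> D \<subseteq> V \<Longrightarrow> herm_pos D b"
  unfolding herm_pos_def using sesq_subset[of V b D] by blast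

lemma herm_posD:
  assumes "herm_pos V h"
  shows "sesq V h" "u \<in> V \<Longrightarrow> v \<in> V \<Longrightarrow> h v u = cnj (h u v)" "u \<in> V \<Longrightarrow> 0 \<le> Re (h u u)"
  using assms unfolding herm_pos_def by blast+

lemma herm_pos_diag: "herm_pos V h \<Longrightarrow> u \<in> V \<Longrightarrow> h u u = of_real (Re (h u u))"
  using herm_posD(2)[of V h u u] by (simp add: complex_eq_iff)

lemma herm_pos_expand:
  assumes "herm_pos V h" "lin_closed V" "u \<in> V" "v \<in> V"
  shows "Re (h (add u (sc c v)) (add u (sc c v)))
           = Re (h u u) + 2 * Re (cnj c * h u v) + (cmod c)\<^sup>2 * Re (h v v)"
proof -
  have "h v u = cnj (h u v)" using assms herm_posD by auto
  moreover have "Re (c * cnj c * h v v) = (cmod c)\<^sup>2 * Re (h v v)"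
    by (simp flip: complex_norm_square del: of_real_power)
  ultimately show ?thesis
    using sesq_expand[OF herm_posD(1)[OF assms(1)] assms(2-4), of c] by simp
qed

text \<open>Since \<open>h\<close> is only semidefinite, \<open>B = 0\<close> does not make
  \<open>v\<close> the zero vector and needs its own case.\<close>

lemma cauchy_schwarz:
  assumes "herm_pos V h" "lin_closed V" "u \<in> V" "v \<in> V"
  shows "(cmod (h u v))\<^sup>2 \<le> Re (h u u) * Re (h v v)"
proof -
  define A B r where "A = Re (h u u)" and "B = Re (h v v)" and "r = (cmod (h u v))\<^sup>2"
  have pos: "0 \<le> A" "0 \<le> B" "0 \<le> r" using assms herm_posD by (auto simp: A_def B_def r_def)
  have ineq: "0 \<le> A - 2 * t * r + t\<^sup>2 * r * B" for t :: real
  proof -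
    \<comment> \<open>This multiple of \<open>h u v\<close> aligns the phases, so the cross term
      becomes the real number \<open>- 2 * t * r\<close>.\<close>
    let ?c = "- of_real t * h u v"
    have "0 \<le> Re (h (add u (sc ?c v)) (add u (sc ?c v)))"
      using assms by (intro herm_posD(3)) (auto intro: lin_closedD)
    also have "\<dots> = A + 2 * Re (cnj ?c * h u v) + (cmod ?c)\<^sup>2 * B"
      unfolding A_def B_def by (rule herm_pos_expand[OF assms])
    also have "cnj ?c * h u v = - of_real (t * r)"
      using complex_norm_square[of "h u v"] by (simp add: r_def mult_ac)
    also have "(cmod ?c)\<^sup>2 = t\<^sup>2 * r" by (simp add: r_def norm_mult power_mult_distrib)
    finally show ?thesis by (simp add: algebra_simps)
  qed
  have "r \<le> A * B"
  proof (cases "B = 0")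
    case True
    have "r = 0"
    proof (rule ccontr)
      assume "r \<noteq> 0"
      then have "0 < r" using pos by simp
      then show False using ineq[of "(A + 1) / (2 * r)"] True by simp
    qed
    then show ?thesis using pos by simp
  next
    case False
    then have "0 \<le> A - r / B" using ineq[of "1 / B"] by (simp add: power2_eq_square field_simps)
    then show ?thesis using False pos by (simp add: field_simps)
  qed
  then show ?thesis by (simp add: A_def B_def r_def)
qed

lemma form_tendsto_left:
  assumes "herm_pos V h" "lin_closed V" "\<And>n. x n \<in> V" "u \<in> V" "v \<in> V"
    and lim: "(\<lambda>n::nat. Re (h (diff (x n) u) (diff (x n) u))) \<longlonglongrightarrow> 0"
  shows "(\<lambda>n. h (x n) v) \<longlonglongrightarrow> h u v"
proof -
  have mem: "diff (x n) u \<in> V" for n using assms by (auto intro: lin_closedD)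
  have "(\<lambda>n. sqrt (Re (h (diff (x n) u) (diff (x n) u)) * Re (h v v))) \<longlonglongrightarrow> sqrt (0 * Re (h v v))"
    by (intro tendsto_intros lim)
  moreover have "cmod (h (diff (x n) u) v) \<le> sqrt (Re (h (diff (x n) u) (diff (x n) u)) * Re (h v v))" for n
    using cauchy_schwarz[OF assms(1,2) mem assms(5)] by (rule real_le_rsqrt)
  ultimately have "(\<lambda>n. h (diff (x n) u) v) \<longlonglongrightarrow> 0"
    by (metis (no_types, lifting) Lim_null_comparison always_eventually mult_zero_left real_sqrt_zero)
  moreover have "h (diff (x n) u) v = h (x n) v - h u v" for n
    using assms by (simp add: sesqD[OF herm_posD(1)[OF assms(1)]] lin_closedD)
  ultimately show ?thesis by (simp add: LIM_zero_iff)
qed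

text \<open>The representing vector minimizes \<open>h u u - 2 Re (l u)\<close>; minimizing sequences are Cauchy by
  the parallelogram identity.\<close>

lemma riesz_representation:
  assumes h: "herm_pos V h" and V: "lin_closed V" and complete: "complete_wrt h V"
    and l: "antilinear_on V l" and bd: "\<And>v. v \<in> V \<Longrightarrow> (cmod (l v))\<^sup>2 \<le> K * Re (h v v)" and K: "0 \<le> K"
  obtains u where "u \<in> V" "\<And>v. v \<in> V \<Longrightarrow> h u v = l v"
proof -
  note lin = lin_closedD[OF V]
  define J where "J = (\<lambda>u. Re (h u u) - 2 * Re (l u))"
  have J_add: "J (add u (sc c v)) = J u - 2 * Re (cnj c * (l v - h u v)) + (cmod c)\<^sup>2 * Re (h v v)"
    if "u \<in> V" "v \<in> V" for u v c
    using that by (simp add: J_def herm_pos_expand[OF h V] antilinear_onD[OF l] lin algebra_simps)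
  have J_lower: "- K \<le> J u" if "u \<in> V" for u
  proof -
    have pos: "0 \<le> Re (h u u)" by (rule herm_posD(3)[OF h that])
    \<comment> \<open>After squaring, the desired \<open>2 * cmod (l u) \<le> K + Re (h u u)\<close>
      is the inequality between geometric and arithmetic mean.\<close>
    have "(2 * cmod (l u))\<^sup>2 \<le> 4 * K * Re (h u u)" using bd[OF that] by (simp add: power_mult_distrib)
    also have "\<dots> \<le> (K + Re (h u u))\<^sup>2"
      using zero_le_power2[of "K - Re (h u u)"] by (simp add: power2_eq_square algebra_simps)
    finally have "2 * cmod (l u) \<le> K + Re (h u u)" by (rule power2_le_imp_le) (use pos K in simp)
    then show ?thesis using complex_Re_le_cmod[of "l u"] by (simp add: J_def)
  qed
  define d where "d = Inf (J ` V)"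
  have d_le: "d \<le> J u" if "u \<in> V" for u
    unfolding d_def using that J_lower by (intro cInf_lower bdd_belowI[of _ "- K"]) auto
  define \<epsilon> where "\<epsilon> = (\<lambda>n. inverse (real (Suc n)))"
  have \<epsilon>: "\<epsilon> \<longlonglongrightarrow> 0" "0 < \<epsilon> n" for n
    using LIMSEQ_inverse_real_of_nat by (auto simp: \<epsilon>_def)
  have "\<exists>u\<in>V. J u < d + \<epsilon> n" for n
    using cInf_lessD[of "J ` V" "d + \<epsilon> n"] lin(1) \<epsilon>(2)[of n] by (auto simp: d_def)
  then obtain x where xV: "\<And>n. x n \<in> V" and xJ: "\<And>n. J (x n) < d + \<epsilon> n"
    by metis
  have parallelogram: "Re (h (diff (x m) (x n)) (diff (x m) (x n))) \<le> 2 * \<epsilon> m + 2 * \<epsilon> n"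
    for m n
  proof -
    let ?y = "sc (1/2) (add (x m) (sc 1 (x n)))"
    have "?y \<in> V" using xV lin by blast
    have "Re (h (diff (x m) (x n)) (diff (x m) (x n))) = 2 * J (x m) + 2 * J (x n) - 4 * J ?y"
      using xV herm_posD(2)[OF h xV xV, of m n]
      by (simp add: J_def sesqD[OF herm_posD(1)[OF h]] antilinear_onD[OF l] lin algebra_simps)
    also have "\<dots> \<le> 2 * (d + \<epsilon> m) + 2 * (d + \<epsilon> n) - 4 * d"
      using d_le[OF \<open>?y \<in> V\<close>] xJ[of m] xJ[of n] by (smt (verit))
    finally show ?thesis by (simp add: algebra_simps)
  qed
  have "\<exists>N. \<forall>m\<ge>N. \<forall>n\<ge>N. Re (h (diff (x m) (x n)) (diff (x m) (x n))) < e" if e: "e > 0" for e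
  proof -
    have "\<forall>\<^sub>F n in sequentially. \<epsilon> n < e / 4"
      using e by (intro order_tendstoD(2)[OF \<epsilon>(1)]) simp
    then obtain N where N: "\<And>n. n \<ge> N \<Longrightarrow> \<epsilon> n < e / 4" by (auto simp: eventually_sequentially)
    have "Re (h (diff (x m) (x n)) (diff (x m) (x n))) < e" if "m \<ge> N" "n \<ge> N" for m n
      using parallelogram[of m n] N[OF that(1)] N[OF that(2)] by linarith
    then show ?thesis by blast
  qed
  then obtain u where uV: "u \<in> V"
    and lim: "(\<lambda>n. Re (h (diff (x n) u) (diff (x n) u))) \<longlonglongrightarrow> 0"
    using complete xV unfolding complete_wrt_def by blast
  show ?thesis
  proof
    fix v assume v: "v \<in> V"
    define r B where "r = l v - h u v" and "B = Re (h v v)"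
    have pos: "0 \<le> B" using herm_posD(3)[OF h v] by (simp add: B_def)
    have conv: "(\<lambda>n. h (x n) v) \<longlonglongrightarrow> h u v" by (rule form_tendsto_left[OF h V xV uV v lim])
    \<comment> \<open>Near-minimality is used at \<open>x n\<close>, with error
      \<open>\<epsilon> n\<close>, and only then passed to the limit. Convergence of
      \<open>h (x n) v\<close> is enough for this; no continuity of \<open>J\<close> enters.\<close>
    have nonneg: "0 \<le> - 2 * Re (cnj c * r) + (cmod c)\<^sup>2 * B" for c
    proof (rule LIMSEQ_le[OF _ _ exI[of _ 0]])
      show "(\<lambda>n. - \<epsilon> n) \<longlonglongrightarrow> 0"
        using tendsto_minus[OF \<epsilon>(1)] by simp
      show "(\<lambda>n. - 2 * Re (cnj c * (l v - h (x n) v)) + (cmod c)\<^sup>2 * B)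
              \<longlonglongrightarrow> - 2 * Re (cnj c * r) + (cmod c)\<^sup>2 * B"
        unfolding r_def by (intro tendsto_intros conv)
      show "\<forall>n\<ge>0. - \<epsilon> n \<le> - 2 * Re (cnj c * (l v - h (x n) v)) + (cmod c)\<^sup>2 * B"
      proof (intro allI impI)
        fix n
        show "- \<epsilon> n \<le> - 2 * Re (cnj c * (l v - h (x n) v)) + (cmod c)\<^sup>2 * B"
          using d_le[OF lin(2)[OF xV[of n] lin(3)[OF v, of c]]] J_add[OF xV[of n] v, of c] xJ[of n]
          by (simp add: B_def)
      qed
    qed
    \<comment> \<open>Adding 1 to \<open>B\<close> covers \<open>B = 0\<close> and makes
      \<open>t * B - 2\<close> negative, which forces \<open>r\<close> to vanish.\<close>
    define t where "t = 1 / (B + 1)"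
    have t: "0 < t" "t * B < 1" using pos by (auto simp: t_def field_simps)
    have "cnj (of_real t * r) * r = of_real (t * (cmod r)\<^sup>2)"
      using complex_norm_square[of r] by (simp add: mult_ac)
    moreover have "(cmod (of_real t * r))\<^sup>2 = t\<^sup>2 * (cmod r)\<^sup>2"
      by (simp add: norm_mult power_mult_distrib)
    ultimately have "0 \<le> - 2 * (t * (cmod r)\<^sup>2) + t\<^sup>2 * (cmod r)\<^sup>2 * B"
      using nonneg[of "of_real t * r"] by (simp only: Re_complex_of_real)
    then have "0 \<le> t * (cmod r)\<^sup>2 * (t * B - 2)" by (simp add: power2_eq_square algebra_simps)
    then have "(cmod r)\<^sup>2 \<le> 0" using t by (simp add: zero_le_mult_iff mult_le_0_iff)
    then show "h u v = l v" by (simp add: r_def)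
  qed (fact uV)
qed

text \<open>With \<open>h (T u) v = b u v\<close>, the Riesz theorem for the inner product \<open>(u, v) \<mapsto> b u (T v)\<close>
  produces \<open>u\<close> such that \<open>b u - l\<close> annihilates the range of \<open>T\<close>, which is dense by coercivity.\<close>

lemma lax_milgram:
  assumes h: "herm_pos V h" and V: "lin_closed V" and complete: "complete_wrt h V"
    and b: "sesq V b" and bd: "\<And>u v. u \<in> V \<Longrightarrow> v \<in> V \<Longrightarrow> (cmod (b u v))\<^sup>2 \<le> C * Re (h u u) * Re (h v v)"
    and "0 \<le> C" and coercive: "\<And>u. u \<in> V \<Longrightarrow> c * Re (h u u) \<le> Re (b u u)" and "0 < c"
    and l: "antilinear_on V l" and l_bd: "\<And>v. v \<in> V \<Longrightarrow> (cmod (l v))\<^sup>2 \<le> K * Re (h v v)" and "0 \<le> K"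
  obtains u where "u \<in> V" "\<And>v. v \<in> V \<Longrightarrow> b u v = l v"
proof -
  note lin = lin_closedD[OF V] and hD = herm_posD[OF h] and hs = sesqD[OF herm_posD(1)[OF h]]
    and bs = sesqD[OF b]
  have "\<exists>w\<in>V. \<forall>v\<in>V. h w v = b u v" if u: "u \<in> V" for u
  proof -
    obtain w where "w \<in> V" "\<And>v. v \<in> V \<Longrightarrow> h w v = b u v"
      using riesz_representation[OF h V complete, of "b u" "C * Re (h u u)"] b u bd \<open>0 \<le> C\<close> hD(3)
      by (metis (no_types, lifting) mult_nonneg_nonneg sesq_def)
    then show ?thesis by blast
  qed
  then obtain T where TV: "\<And>u. u \<in> V \<Longrightarrow> T u \<in> V"
    and T: "\<And>u v. u \<in> V \<Longrightarrow> v \<in> V \<Longrightarrow> h (T u) v = b u v"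
    by metis
  obtain g where gV: "g \<in> V" and g: "\<And>v. v \<in> V \<Longrightarrow> h g v = l v"
    using riesz_representation[OF h V complete l l_bd \<open>0 \<le> K\<close>] by metis
  \<comment> \<open>\<open>k u v\<close> equals \<open>h (T u) (T v)\<close>. Written with
    \<open>b\<close> it is visibly linear in \<open>u\<close>, although \<open>T\<close> is a mere
    choice function whose linearity is never established; the other slot follows by Hermitian
    symmetry.\<close>
  define k where "k = (\<lambda>u v. b u (T v))"
  have k_herm: "k v u = cnj (k u v)" if "u \<in> V" "v \<in> V" for u v
    unfolding k_def using that T TV hD(2) by metis
  have k_left: "antilinear_on V (\<lambda>u. cnj (k u v))" if "v \<in> V" for v
    using that TV by (auto simp: antilinear_on_def k_def bs)
  have k_sesq: "sesq V k"
    unfolding sesq_def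
  proof (intro conjI ballI k_left)
    fix u assume u: "u \<in> V"
    show "antilinear_on V (k u)"
      unfolding antilinear_on_def
    proof (intro conjI ballI allI)
      fix v w assume vw: "v \<in> V" "w \<in> V"
      show "k u (add v w) = k u v + k u w"
        using antilinear_onD(1)[OF k_left[OF u] vw] k_herm[OF _ u] vw lin(2)[OF vw] by metis
    next
      fix v c assume v: "v \<in> V"
      show "k u (sc c v) = cnj c * k u v"
        using antilinear_onD(2)[OF k_left[OF u] v] k_herm[OF _ u] v lin(3)[OF v] by metis
    qed
  qed
  have kT: "k u u = h (T u) (T u)" if "u \<in> V" for u
    unfolding k_def using T TV that by simp
  have k_pos: "herm_pos V k"
    unfolding herm_pos_def
  proof (intro conjI ballI k_sesq)
    show "k v u = cnj (k u v)" if "u \<in> V" "v \<in> V" for u v by (rule k_herm[OF that])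
    show "0 \<le> Re (k u u)" if "u \<in> V" for u by (simp add: kT[OF that] hD(3)[OF TV[OF that]])
  qed
  \<comment> \<open>Together with \<open>k_le_h\<close> this makes \<open>k\<close> equivalent to
    \<open>h\<close>, so completeness carries over.\<close>
  have h_le_k: "c\<^sup>2 * Re (h u u) \<le> Re (k u u)" if u: "u \<in> V" for u
  proof (cases "Re (h u u) = 0")
    case False
    then have pos: "0 < Re (h u u)" using hD(3)[OF u] by simp
    have "c * Re (h u u) \<le> cmod (h (T u) u)"
      using coercive[OF u] complex_Re_le_cmod[of "b u u"] T[OF u u] by simp
    then have "(c * Re (h u u))\<^sup>2 \<le> (cmod (h (T u) u))\<^sup>2"
      using \<open>0 < c\<close> pos by (intro power_mono) auto
    also have "\<dots> \<le> Re (k u u) * Re (h u u)"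
      using cauchy_schwarz[OF h V TV[OF u] u] kT[OF u] by simp
    finally show ?thesis using pos by (simp add: power2_eq_square)
  qed (use hD(3) TV u kT in auto)
  have k_le_h: "Re (k u u) \<le> C * Re (h u u)" if u: "u \<in> V" for u
  proof (cases "Re (k u u) = 0")
    case False
    then have pos: "0 < Re (k u u)" using herm_posD(3)[OF k_pos u] by simp
    have "(Re (k u u))\<^sup>2 \<le> (cmod (b u (T u)))\<^sup>2"
      using pos complex_Re_le_cmod[of "k u u"] by (intro power_mono) (auto simp: k_def)
    also have "\<dots> \<le> C * Re (h u u) * Re (k u u)"
      using bd[OF u TV[OF u]] kT[OF u] by simp
    finally show ?thesis using pos by (simp add: power2_eq_square)
  qed (use hD(3) u \<open>0 \<le> C\<close> in auto)
  have k_complete: "complete_wrt k V"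
    unfolding complete_wrt_def
  proof (intro allI impI, elim conjE)
    fix x :: "nat \<Rightarrow> 'a"
    assume x: "\<forall>n. x n \<in> V"
      and cauchy: "\<forall>e>0. \<exists>N. \<forall>m\<ge>N. \<forall>n\<ge>N. Re (k (diff (x m) (x n)) (diff (x m) (x n))) < e"
    have "\<exists>N. \<forall>m\<ge>N. \<forall>n\<ge>N. Re (h (diff (x m) (x n)) (diff (x m) (x n))) < e" if e: "e > 0" for e
    proof -
      obtain N where N: "\<And>m n. m \<ge> N \<Longrightarrow> n \<ge> N \<Longrightarrow> Re (k (diff (x m) (x n)) (diff (x m) (x n))) < c\<^sup>2 * e"
        using cauchy \<open>0 < c\<close> e by (meson mult_pos_pos zero_less_power)
      have "Re (h (diff (x m) (x n)) (diff (x m) (x n))) < e" if "m \<ge> N" "n \<ge> N" for m n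
      proof -
        have "c\<^sup>2 * Re (h (diff (x m) (x n)) (diff (x m) (x n))) < c\<^sup>2 * e"
          using h_le_k[of "diff (x m) (x n)"] N[OF that] x lin by (meson le_less_trans)
        then show ?thesis using \<open>0 < c\<close> by simp
      qed
      then show ?thesis by blast
    qed
    then obtain u where u: "u \<in> V" and lim: "(\<lambda>n. Re (h (diff (x n) u) (diff (x n) u))) \<longlonglongrightarrow> 0"
      using complete x unfolding complete_wrt_def by blast
    have mem: "diff (x n) u \<in> V" for n using x u lin by blast
    have "(\<lambda>n. Re (k (diff (x n) u) (diff (x n) u))) \<longlonglongrightarrow> 0"
      by (rule tendsto_sandwich[OF _ _ tendsto_const tendsto_mult_right_zero[OF lim, of C]])
        (use k_le_h[OF mem] herm_posD(3)[OF k_pos mem] in auto)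
    then show "\<exists>u\<in>V. (\<lambda>n. Re (k (diff (x n) u) (diff (x n) u))) \<longlonglongrightarrow> 0" using u by blast
  qed
  have "antilinear_on V (\<lambda>v. h g (T v))"
  proof -
    have "h g (T v) = cnj (b v g)" if "v \<in> V" for v
      using that TV T gV hD(2) by metis
    then show ?thesis using gV lin by (simp add: antilinear_on_def bs)
  qed
  moreover have "(cmod (h g (T v)))\<^sup>2 \<le> Re (h g g) * Re (k v v)" if "v \<in> V" for v
    using cauchy_schwarz[OF h V gV TV[OF that]] kT[OF that] by simp
  ultimately obtain u where u: "u \<in> V" and ku: "\<And>v. v \<in> V \<Longrightarrow> k u v = h g (T v)"
    using riesz_representation[OF k_pos V k_complete, of "\<lambda>v. h g (T v)" "Re (h g g)"] hD(3)[OF gV]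
    by metis
  \<comment> \<open>By the choice of \<open>u\<close>, \<open>y\<close> is
    \<open>h\<close>-orthogonal to the range of \<open>T\<close>. Testing with \<open>T y\<close>
    gives \<open>b y y = 0\<close>, and coercivity makes \<open>y\<close> null for
    \<open>h\<close>.\<close>
  define y where "y = diff (T u) g"
  have y: "y \<in> V" unfolding y_def using u gV TV lin by blast
  have hy: "h y v = b u v - l v" if "v \<in> V" for v
    unfolding y_def using that u gV TV T g lin by (simp add: hs)
  have "h y (T y) = 0"
    using hy[OF TV[OF y]] ku[OF y] g[OF TV[OF y]] by (simp add: k_def)
  then have "b y y = 0" using T[OF y y] hD(2)[OF y TV[OF y]] by simp
  then have "Re (h y y) = 0" using coercive[OF y] hD(3)[OF y] \<open>0 < c\<close>
    by (simp add: mult_le_0_iff)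
  then have "h y v = 0" if "v \<in> V" for v
    using cauchy_schwarz[OF h V y that] by simp
  then show ?thesis using that[OF u] hy by simp
qed

end

section \<open>The operator associated with a coercive form\<close>

text \<open>\<open>H\<close> with \<open>p\<close> models the space \<open>L2\<close>, and
  \<open>V\<close> with \<open>h\<close> the form domain with the product of \<open>W12\<close>, so
  \<open>h - p\<close> is the Dirichlet energy. Ellipticity, in \<open>a_coercive\<close>, controls
  this energy but not \<open>p\<close>. The assumption \<open>null\<close> stands for the fact that
  a vector of norm zero in \<open>L2\<close> is zero.\<close>

locale form_setting = sesq_ops add sc
  for add :: "'a \<Rightarrow> 'a \<Rightarrow> 'a" and sc :: "complex \<Rightarrow> 'a \<Rightarrow> 'a" +
  fixes H V :: "'a set" and p h a :: "'a \<Rightarrow> 'a \<Rightarrow> complex" and C m :: real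
  assumes H: "lin_closed H" and V: "lin_closed V" and VH: "V \<subseteq> H"
    and p: "herm_pos H p" and h: "herm_pos V h" and complete: "complete_wrt h V"
    and p_le_h: "\<And>u. u \<in> V \<Longrightarrow> Re (p u u) \<le> Re (h u u)"
    and null: "\<And>u. u \<in> V \<Longrightarrow> Re (p u u) = 0 \<Longrightarrow> Re (h u u) = 0"
    and a: "sesq V a" and C: "0 \<le> C" and m: "0 < m"
    and a_bound: "\<And>u v. u \<in> V \<Longrightarrow> v \<in> V \<Longrightarrow> (cmod (a u v))\<^sup>2 \<le> C * Re (h u u) * Re (h v v)"
    and a_coercive: "\<And>u. u \<in> V \<Longrightarrow> m * (Re (h u u) - Re (p u u)) \<le> Re (a u u)"
begin

definition graph :: "('a \<times> 'a) set" where
  "graph = {(u, g). u \<in> V \<and> g \<in> H \<and> (\<forall>v\<in>V. a u v = p g v)}"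

definition num_range :: "complex set" where
  "num_range = {p g u | u g. (u, g) \<in> graph \<and> Re (p u u) = 1}"

lemmas linV = lin_closedD[OF V] and linH = lin_closedD[OF H]
  and pV = herm_pos_subset[OF p VH]

lemma graphD:
  assumes "(u, g) \<in> graph"
  shows "u \<in> V" "g \<in> H" "v \<in> V \<Longrightarrow> a u v = p g v"
  using assms by (auto simp: graph_def)

lemma graph_add:
  assumes "(u, g) \<in> graph" "(v, k) \<in> graph"
  shows "(add u v, add g k) \<in> graph"
  using assms VH by (auto simp: graph_def linV linH subset_iff sesqD[OF a] sesqD[OF herm_posD(1)[OF p]])

lemma graph_scale:
  assumes "(u, g) \<in> graph"
  shows "(sc c u, sc c g) \<in> graph"
  using assms VH by (auto simp: graph_def linV linH subset_iff sesqD[OF a] sesqD[OF herm_posD(1)[OF p]])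

lemma p_bound:
  assumes "g \<in> H" "v \<in> V"
  shows "(cmod (p g v))\<^sup>2 \<le> Re (p g g) * Re (h v v)"
proof -
  have "(cmod (p g v))\<^sup>2 \<le> Re (p g g) * Re (p v v)"
    using assms VH by (intro cauchy_schwarz[OF p H]) auto
  also have "\<dots> \<le> Re (p g g) * Re (h v v)"
    using assms p_le_h herm_posD(3)[OF p] by (intro mult_left_mono) auto
  finally show ?thesis .
qed

text \<open>The subspace \<open>D\<close> will be \<open>V\<close> itself or, in
  \<open>domain_dense\<close>, the closure of the operator domain.\<close>

lemma coercive_solvable:
  assumes D: "D \<subseteq> V" "lin_closed D" "complete_wrt h D"
    and b: "sesq D b" "\<And>u v. u \<in> D \<Longrightarrow> v \<in> D \<Longrightarrow> (cmod (b u v))\<^sup>2 \<le> C' * Re (h u u) * Re (h v v)" "0 \<le> C'"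
    and coercive: "\<And>u. u \<in> D \<Longrightarrow> c * Re (h u u) \<le> Re (b u u)" "0 < c"
    and l: "antilinear_on D l" "\<And>v. v \<in> D \<Longrightarrow> (cmod (l v))\<^sup>2 \<le> K * Re (h v v)" "0 \<le> K"
  shows "\<exists>u\<in>D. \<forall>v\<in>D. b u v = l v"
  by (rule lax_milgram[OF herm_pos_subset[OF h D(1)] D(2,3) b coercive l]) blast+

text \<open>The two coefficients cover the rotated shift of \<open>a\<close>, the affine
  normalization in \<open>convex_num_range\<close> and the separating form in
  \<open>resolvent_surjective\<close>.\<close>

lemma combined_sesq: "sesq V (\<lambda>u v. \<gamma> * a u v - \<zeta> * p u v)"
  by (rule sesqI) (auto simp: sesqD[OF a] sesqD[OF herm_posD(1)[OF pV]] algebra_simps)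

lemma combined_bound:
  assumes u: "u \<in> V" and v: "v \<in> V"
  shows "(cmod (\<gamma> * a u v - \<zeta> * p u v))\<^sup>2
           \<le> (2 * (cmod \<gamma>)\<^sup>2 * C + 2 * (cmod \<zeta>)\<^sup>2) * Re (h u u) * Re (h v v)"
proof -
  have "(cmod (p u v))\<^sup>2 \<le> Re (h u u) * Re (h v v)"
    using p_bound[of u v] u v VH mult_right_mono[OF p_le_h[OF u] herm_posD(3)[OF h v]] by auto
  then have 1: "(cmod \<zeta>)\<^sup>2 * (cmod (p u v))\<^sup>2 \<le> (cmod \<zeta>)\<^sup>2 * (Re (h u u) * Re (h v v))"
    by (intro mult_left_mono) auto
  have 2: "(cmod \<gamma>)\<^sup>2 * (cmod (a u v))\<^sup>2 \<le> (cmod \<gamma>)\<^sup>2 * (C * Re (h u u) * Re (h v v))"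
    using a_bound[OF u v] by (intro mult_left_mono) auto
  have "(cmod (\<gamma> * a u v - \<zeta> * p u v))\<^sup>2
          \<le> 2 * ((cmod \<gamma>)\<^sup>2 * (cmod (a u v))\<^sup>2) + 2 * ((cmod \<zeta>)\<^sup>2 * (cmod (p u v))\<^sup>2)"
    using norm_add_sq_le[of "\<gamma> * a u v" "- (\<zeta> * p u v)"]
    by (simp add: norm_mult power_mult_distrib)
  also have "\<dots> \<le> 2 * ((cmod \<gamma>)\<^sup>2 * (C * Re (h u u) * Re (h v v)))
      + 2 * ((cmod \<zeta>)\<^sup>2 * (Re (h u u) * Re (h v v)))"
    using 1 2 by linarith
  also have "\<dots> = (2 * (cmod \<gamma>)\<^sup>2 * C + 2 * (cmod \<zeta>)\<^sup>2) * Re (h u u) * Re (h v v)"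
    by (simp only: distrib_left distrib_right mult_ac)
  finally show ?thesis .
qed

lemma p_antilinear: "g \<in> H \<Longrightarrow> antilinear_on V (\<lambda>v. \<gamma> * p g v)"
  using VH by (auto simp: antilinear_on_def subset_iff sesqD[OF herm_posD(1)[OF p]] algebra_simps)

text \<open>The real part of \<open>a - z p\<close> need not be coercive. The factor
  \<open>\<gamma>\<close> rotates the form until it is, and is cancelled from the solved
  equation.\<close>

lemma shifted_solvable:
  assumes g: "g \<in> H" and c: "0 < c"
    and coercive: "\<And>u. u \<in> V \<Longrightarrow> c * Re (h u u) \<le> Re (\<gamma> * (a u u - z * p u u))"
  shows "\<exists>u\<in>V. \<forall>v\<in>V. a u v - z * p u v = p g v"
proof (cases "\<gamma> = 0")
  \<comment> \<open>Then the coercivity assumption forces \<open>h\<close> to vanish on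
    \<open>V\<close>, all forms involved are zero, and any \<open>u\<close> is a solution.\<close>
  case True
  then have 0: "Re (h u u) = 0" if "u \<in> V" for u
    using coercive[OF that] herm_posD(3)[OF h that] c by (simp add: mult_le_0_iff)
  obtain u where u: "u \<in> V" using linV(1) by blast
  have "a u v = 0" "p g v = 0" "p u v = 0" if v: "v \<in> V" for v
    using a_bound[OF u v] p_bound[OF g v] p_bound[of u v] 0[OF v] u v VH by auto
  then have "\<forall>v\<in>V. a u v - z * p u v = p g v" by simp
  then show ?thesis using u by blast
next
  case False
  have "\<exists>u\<in>V. \<forall>v\<in>V. \<gamma> * a u v - \<gamma> * z * p u v = \<gamma> * p g v"
  proof (rule coercive_solvable[OF subset_refl V complete combined_sesq combined_bound _ _ c
        p_antilinear[OF g]])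
    show "c * Re (h u u) \<le> Re (\<gamma> * a u u - \<gamma> * z * p u u)" if "u \<in> V" for u
      using coercive[OF that] by (simp only: right_diff_distrib mult.assoc)
    show "(cmod (\<gamma> * p g v))\<^sup>2 \<le> ((cmod \<gamma>)\<^sup>2 * Re (p g g)) * Re (h v v)" if "v \<in> V" for v
      using mult_left_mono[OF p_bound[OF g that], of "(cmod \<gamma>)\<^sup>2"]
      by (simp add: norm_mult power_mult_distrib mult.assoc)
  qed (use C herm_posD(3)[OF p g] in auto)
  then have "\<exists>u\<in>V. \<forall>v\<in>V. \<gamma> * (a u v - z * p u v) = \<gamma> * p g v"
    by (simp only: right_diff_distrib mult.assoc)
  then show ?thesis using False by simp
qed

text \<open>By the parallelogram identity the defect is the squared norm of
  \<open>u + w - 2 v\<close>.\<close>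

lemma triangle_sq:
  assumes "u \<in> V" "v \<in> V" "w \<in> V"
  shows "Re (h (diff u w) (diff u w)) \<le> 2 * Re (h (diff u v) (diff u v)) + 2 * Re (h (diff v w) (diff v w))"
proof -
  \<comment> \<open>The coefficient 1 gives the sum the shape \<open>add u (sc c v)\<close> that
    \<open>herm_pos_expand\<close> rewrites.\<close>
  have mem: "add u (sc 1 w) \<in> V" using assms linV by blast
  then have "add (add u (sc 1 w)) (sc (-2) v) \<in> V" using assms linV by blast
  then have "0 \<le> Re (h (add (add u (sc 1 w)) (sc (-2) v)) (add (add u (sc 1 w)) (sc (-2) v)))"
    by (rule herm_posD(3)[OF h])
  moreover have "h (add u (sc 1 w)) v = h u v + h w v"
    using assms by (simp add: sesqD[OF herm_posD(1)[OF h]] linV)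
  moreover have "Re (h w v) = Re (h v w)" using herm_posD(2)[OF h assms(2,3)] by simp
  ultimately show ?thesis
    using assms mem by (simp add: herm_pos_expand[OF h V])
qed

lemma parallelogram_sq:
  assumes "v \<in> V" "x \<in> V" "w \<in> V" "y \<in> V"
  shows "Re (h (diff (add v w) (add x y)) (diff (add v w) (add x y)))
           \<le> 2 * Re (h (diff v x) (diff v x)) + 2 * Re (h (diff w y) (diff w y))"
proof -
  \<comment> \<open>\<open>?A\<close> and \<open>?B\<close> differ by a rearrangement of summands.
    They are identified only under \<open>h\<close>, one slot at a time.\<close>
  let ?A = "diff (add v w) (add x y)" and ?B = "add (diff v x) (sc 1 (diff w y))"
  have mem: "?A \<in> V" "?B \<in> V" "diff v x \<in> V" "diff w y \<in> V" using assms by (simp_all add: linV(2,3))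
  have 1: "h ?A z = h ?B z" if "z \<in> V" for z
    using assms that by (simp add: sesqD[OF herm_posD(1)[OF h]] linV)
  have 2: "h z ?A = h z ?B" if "z \<in> V" for z
    using assms that by (simp add: sesqD[OF herm_posD(1)[OF h]] linV)
  have 3: "h ?A ?A = h ?B ?B" unfolding 1[OF mem(1)] by (rule 2[OF mem(2)])
  have "add (diff v x) (sc (-1) (diff w y)) \<in> V" using mem linV by blast
  then have "0 \<le> Re (h (add (diff v x) (sc (-1) (diff w y))) (add (diff v x) (sc (-1) (diff w y))))"
    by (rule herm_posD(3)[OF h])
  then show ?thesis
    unfolding 3 herm_pos_expand[OF h V mem(3,4)] by simp
qed

text \<open>If \<open>d\<close> is the projection of \<open>u\<close> to the closure of the domain with respect to the adjoint of
  \<open>a + p\<close>, then \<open>u - d\<close> is orthogonal to the range of \<open>A + I\<close>, which is everything.\<close>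

lemma domain_dense:
  assumes u: "u \<in> V" and e: "0 < e"
  shows "\<exists>x g. (x, g) \<in> graph \<and> Re (h (diff u x) (diff u x)) < e"
proof -
  define D where
    "D = {v\<in>V. \<forall>e>0. \<exists>x g. (x, g) \<in> graph \<and> Re (h (diff v x) (diff v x)) < e}"
  have DV: "D \<subseteq> V" by (auto simp: D_def)
  have solve: "\<exists>x g. (x, g) \<in> graph \<and> (\<forall>v\<in>V. a x v + p x v = p w v)" if w: "w \<in> V" for w
  proof -
    \<comment> \<open>Splitting \<open>h\<close> into the energy \<open>h - p\<close>, with constant
      \<open>m\<close> from ellipticity, and \<open>p\<close>, with constant 1, makes
      \<open>a + p\<close> coercive with the smaller of the two.\<close>
    define c where "c = min 1 m"
    have "\<exists>x\<in>V. \<forall>v\<in>V. a x v - (-1) * p x v = p w v"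
    proof (rule shifted_solvable[of _ c 1])
      show "0 < c" using m by (simp add: c_def)
      fix u assume u: "u \<in> V"
      have "c * Re (h u u) = c * (Re (h u u) - Re (p u u)) + c * Re (p u u)" by (simp add: algebra_simps)
      also have "\<dots> \<le> m * (Re (h u u) - Re (p u u)) + 1 * Re (p u u)"
        using u p_le_h herm_posD(3)[OF pV] by (intro add_mono mult_right_mono) (auto simp: c_def)
      also have "\<dots> \<le> Re (1 * (a u u - (-1) * p u u))"
        using a_coercive[OF u] by simp
      finally show "c * Re (h u u) \<le> Re (1 * (a u u - (-1) * p u u))" .
    qed (use w VH in auto)
    then obtain x where x: "x \<in> V" "\<And>v. v \<in> V \<Longrightarrow> a x v + p x v = p w v" by auto
    moreover have "(x, diff w x) \<in> graph"
      using x w VH by (auto simp: graph_def linH subset_iff sesqD[OF herm_posD(1)[OF p]] eq_diff_eq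
          simp flip: diff_conv_add_uminus)
    ultimately show ?thesis by blast
  qed
  have dom_D: "x \<in> D" if "(x, g) \<in> graph" for x g
  proof -
    have "Re (h (diff x x) (diff x x)) = 0"
      using graphD(1)[OF that] by (simp add: sesqD[OF herm_posD(1)[OF h]] linV)
    then show ?thesis using that graphD(1)[OF that] unfolding D_def by force
  qed
  have D_add: "add v w \<in> D" if v: "v \<in> D" and w: "w \<in> D" for v w
    unfolding D_def
  proof safe
    show "add v w \<in> V" using v w DV linV by blast
    fix e :: real assume e: "0 < e"
    then have e4: "0 < e / 4" by simp
    then obtain x g y k where x: "(x, g) \<in> graph" "Re (h (diff v x) (diff v x)) < e / 4"
      and y: "(y, k) \<in> graph" "Re (h (diff w y) (diff w y)) < e / 4"
      using v w unfolding D_def by blast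
    have mem: "v \<in> V" "w \<in> V" "x \<in> V" "y \<in> V" using v w DV x y graphD(1) by blast+
    then have "Re (h (diff (add v w) (add x y)) (diff (add v w) (add x y)))
        \<le> 2 * Re (h (diff v x) (diff v x)) + 2 * Re (h (diff w y) (diff w y))"
      by (intro parallelogram_sq) auto
    then show "\<exists>x g. (x, g) \<in> graph \<and> Re (h (diff (add v w) x) (diff (add v w) x)) < e"
      using graph_add[OF x(1) y(1)] x(2) y(2) by fastforce
  qed
  have D_scale: "sc c w \<in> D" if w: "w \<in> D" for w c
    unfolding D_def
  proof safe
    show "sc c w \<in> V" using w DV linV by blast
    fix e :: real assume e: "0 < e"
    \<comment> \<open>The summand 1 keeps the divisor positive when \<open>c = 0\<close>.\<close>
    have pos: "0 < 1 + (cmod c)\<^sup>2" by (simp add: add_pos_nonneg)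
    then have "0 < e / (1 + (cmod c)\<^sup>2)" using e by simp
    then obtain y k where y: "(y, k) \<in> graph" "Re (h (diff w y) (diff w y)) < e / (1 + (cmod c)\<^sup>2)"
      using w unfolding D_def by blast
    have mem: "w \<in> V" "y \<in> V" "diff w y \<in> V" using w DV y graphD(1) linV by blast+
    have "h (diff (sc c w) (sc c y)) (diff (sc c w) (sc c y)) = of_real ((cmod c)\<^sup>2) * h (diff w y) (diff w y)"
      unfolding complex_norm_square
      using mem by (simp add: sesqD[OF herm_posD(1)[OF h]] linV algebra_simps)
    then have "Re (h (diff (sc c w) (sc c y)) (diff (sc c w) (sc c y))) = (cmod c)\<^sup>2 * Re (h (diff w y) (diff w y))"
      by (simp del: of_real_power)
    also have "\<dots> \<le> (1 + (cmod c)\<^sup>2) * Re (h (diff w y) (diff w y))"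
      using herm_posD(3)[OF h mem(3)] by (intro mult_right_mono) auto
    also have "\<dots> < e" using y(2) pos by (simp add: field_simps)
    finally show "\<exists>x g. (x, g) \<in> graph \<and> Re (h (diff (sc c w) x) (diff (sc c w) x)) < e"
      using graph_scale[OF y(1)] by blast
  qed
  obtain x0 g0 where "(x0, g0) \<in> graph" using solve linV(1) by blast
  then have D: "lin_closed D" using D_add D_scale dom_D by (auto simp: lin_closed_def)
  have D_complete: "complete_wrt h D"
    unfolding complete_wrt_def
  proof (intro allI impI, elim conjE)
    fix x :: "nat \<Rightarrow> 'a"
    assume x: "\<forall>n. x n \<in> D"
      and "\<forall>e>0. \<exists>N. \<forall>m\<ge>N. \<forall>n\<ge>N. Re (h (diff (x m) (x n)) (diff (x m) (x n))) < e"
    then obtain v where v: "v \<in> V" and lim: "(\<lambda>n. Re (h (diff (x n) v) (diff (x n) v))) \<longlonglongrightarrow> 0"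
      using complete DV unfolding complete_wrt_def by blast
    have "v \<in> D"
      unfolding D_def
    proof safe
      fix e :: real assume "0 < e"
      then have e4: "0 < e / 4" by simp
      obtain n where n: "Re (h (diff (x n) v) (diff (x n) v)) < e / 4"
        using order_tendstoD(2)[OF lim e4] by (auto simp: eventually_sequentially)
      obtain y g where y: "(y, g) \<in> graph" "Re (h (diff (x n) y) (diff (x n) y)) < e / 4"
        using x e4 unfolding D_def by blast
      have mem: "x n \<in> V" "y \<in> V" using x DV y graphD(1) by blast+
      have "h (diff v (x n)) (diff v (x n)) = h (diff (x n) v) (diff (x n) v)"
        using v mem by (simp add: sesqD[OF herm_posD(1)[OF h]] linV algebra_simps)
      then have "Re (h (diff v y) (diff v y)) < e"
        using triangle_sq[OF v mem] n y(2) by simp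
      then show "\<exists>x g. (x, g) \<in> graph \<and> Re (h (diff v x) (diff v x)) < e" using y(1) by blast
    qed (fact v)
    then show "\<exists>u\<in>D. (\<lambda>n. Re (h (diff (x n) u) (diff (x n) u))) \<longlonglongrightarrow> 0" using lim by blast
  qed
  \<comment> \<open>Solutions provided by \<open>solve\<close> sit in the first slot of
    \<open>a\<close>, so orthogonality to \<open>D\<close> must be tested in that slot; hence the
    adjoint.\<close>
  define b where "b = (\<lambda>v x. cnj (a x v + p x v))"
  have b_sesq: "sesq V b"
    unfolding b_def
    by (rule sesqI) (auto simp: sesqD[OF a] sesqD[OF herm_posD(1)[OF pV]] algebra_simps)
  have b_bound: "(cmod (b v x))\<^sup>2 \<le> (2 * C + 2) * Re (h v v) * Re (h x x)" if "v \<in> V" "x \<in> V" for v x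
    using combined_bound[OF that(2,1), of 1 "-1"] unfolding b_def complex_mod_cnj by (simp add: mult_ac)
  have b_coercive: "min 1 m * Re (h v v) \<le> Re (b v v)" if v: "v \<in> V" for v
  proof -
    define c where "c = min 1 m"
    have "c * Re (h v v) = c * (Re (h v v) - Re (p v v)) + c * Re (p v v)" by (simp add: algebra_simps)
    also have "\<dots> \<le> m * (Re (h v v) - Re (p v v)) + 1 * Re (p v v)"
      using v p_le_h herm_posD(3)[OF pV] by (intro add_mono mult_right_mono) (auto simp: c_def)
    also have "\<dots> \<le> Re (b v v)"
      using a_coercive[OF v] by (simp add: b_def)
    finally show ?thesis by (simp add: c_def)
  qed
  have "\<exists>d\<in>D. \<forall>x\<in>D. b d x = b u x"
    using DV u m C b_bound b_coercive b_sesq herm_posD(3)[OF h u]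
    by (intro coercive_solvable[where c = "min 1 m" and C' = "2 * C + 2" and K = "(2 * C + 2) * Re (h u u)"]
        D D_complete sesq_subset[OF b_sesq]) (auto simp: sesq_def antilinear_on_def subset_iff)
  then obtain d where d: "d \<in> D" "\<And>x. x \<in> D \<Longrightarrow> b d x = b u x" by blast
  define w where "w = diff u d"
  have w: "w \<in> V" unfolding w_def using u d DV linV by blast
  have w0: "b w x = 0" if "x \<in> D" for x
    unfolding w_def using d u DV that by (simp add: sesqD[OF b_sesq] linV subset_iff)
  \<comment> \<open>This \<open>x\<close> solves \<open>(A + I) x = w\<close> and lies in
    \<open>D\<close>. Orthogonality makes \<open>a x w + p x w\<close> zero, and the equation tested
    with \<open>w\<close> says that this number is \<open>p w w\<close>.\<close>
  obtain x g where x: "(x, g) \<in> graph" "\<And>v. v \<in> V \<Longrightarrow> a x v + p x v = p w v"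
    using solve[OF w] by blast
  have "p w w = 0" using w0[OF dom_D[OF x(1)]] x(2)[OF w] by (simp add: b_def flip: complex_cnj_add)
  then have hw: "Re (h (diff u d) (diff u d)) = 0" using null[OF w] by (simp add: w_def)
  have e2: "0 < e / 2" using e by simp
  obtain y k where y: "(y, k) \<in> graph" "Re (h (diff d y) (diff d y)) < e / 2"
    using d(1) e2 unfolding D_def by blast
  have "Re (h (diff u y) (diff u y)) < e"
    using triangle_sq[of u d y] u d DV graphD(1)[OF y(1)] hw y(2) by auto
  then show ?thesis using y(1) by blast
qed

section \<open>The numerical range: convexity, surjectivity off its closure, and the resolvent
  bound\<close>

lemma num_range_quotient:
  assumes g: "(u, g) \<in> graph" and pos: "0 < Re (p u u)"
  shows "p g u / of_real (Re (p u u)) \<in> num_range"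
proof -
  define P where "P = Re (p u u)"
  define c where "c = complex_of_real (1 / sqrt P)"
  have pos': "0 < P" using pos by (simp add: P_def)
  have u: "u \<in> V" "g \<in> H" "u \<in> H" using graphD[OF g] VH by auto
  have cc: "c * c = of_real (1 / P)" "cnj c = c"
    using pos by (simp_all add: c_def P_def flip: of_real_mult)
  have "p (sc c g) (sc c u) = (c * c) * p g u" "p (sc c u) (sc c u) = (c * c) * p u u"
    using u by (simp_all add: sesqD[OF herm_posD(1)[OF p]] linH cc(2) mult.assoc)
  moreover have "p u u = of_real P" using herm_pos_diag[OF p u(3)] by (simp add: P_def)
  ultimately have "p (sc c g) (sc c u) = p g u / of_real P" "p (sc c u) (sc c u) = 1"
    using pos' by (simp_all add: cc(1))
  then show ?thesis
    unfolding num_range_def P_def[symmetric] using graph_scale[OF g, of c] by force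
qed

text \<open>Toeplitz--Hausdorff: after an affine change of the form, the two given values are 0 and 1, and
  a phase \<open>e\<close> makes the form real along the segment from \<open>u\<close> to \<open>e v\<close>.\<close>

lemma convex_num_range: "convex num_range"
proof (rule convexI)
  fix \<alpha> \<beta> :: complex and s t :: real
  assume \<alpha>: "\<alpha> \<in> num_range" and \<beta>: "\<beta> \<in> num_range" and st: "0 \<le> s" "0 \<le> t" "s + t = 1"
  show "s *\<^sub>R \<alpha> + t *\<^sub>R \<beta> \<in> num_range"
  proof (cases "\<alpha> = \<beta>")
    case True
    then show ?thesis using \<alpha> st by (simp flip: scaleR_left_distrib)
  next
    case False
    obtain u g where u: "(u, g) \<in> graph" "Re (p u u) = 1" "\<alpha> = p g u"
      using \<alpha> by (auto simp: num_range_def)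
    obtain v k where v: "(v, k) \<in> graph" "Re (p v v) = 1" "\<beta> = p k v"
      using \<beta> by (auto simp: num_range_def)
    have mem: "u \<in> V" "v \<in> V" using u v graphD by blast+
    have p1: "p u u = 1" "p v v = 1"
      using herm_pos_diag[OF pV mem(1)] herm_pos_diag[OF pV mem(2)] u v by simp_all
    define b where "b = (\<lambda>x y. 1 / (\<beta> - \<alpha>) * a x y - \<alpha> / (\<beta> - \<alpha>) * p x y)"
    have b: "sesq V b" unfolding b_def by (rule combined_sesq)
    have b01: "b u u = 0" "b v v = 1"
      using graphD(3)[OF u(1) mem(1)] graphD(3)[OF v(1) mem(2)] u v p1 False by (simp_all add: b_def flip: diff_divide_distrib)
    define X Y where "X = b u v" and "Y = b v u"
    \<comment> \<open>The imaginary part of \<open>cnj e * X + e * Y\<close> is that of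
      \<open>e * (Y - cnj X)\<close>, so the conjugate phase of \<open>Y - cnj X\<close> removes it.
      If that number is 0 any phase serves, and 1 is taken.\<close>
    define e where "e = (if Y = cnj X then 1 else cnj (Y - cnj X) / of_real (cmod (Y - cnj X)))"
    have e: "cmod e = 1" by (auto simp: e_def norm_divide simp del: complex_cnj_diff)
    have "e * (Y - cnj X) = of_real (cmod (Y - cnj X))"
    proof (cases "Y = cnj X")
      case False
      then show ?thesis
        using complex_norm_square[of "Y - cnj X"]
        by (simp add: e_def power2_eq_square field_simps del: complex_cnj_diff)
    qed (simp add: e_def)
    then have "Im (e * (Y - cnj X)) = 0" by (metis Im_complex_of_real)
    then have im0: "Im (cnj e * X + e * Y) = 0" by (simp add: algebra_simps)
    define \<rho> where "\<rho> = Re (cnj e * X + e * Y)"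
    have \<rho>: "cnj e * X + e * Y = of_real \<rho>" using im0 by (simp add: complex_eq_iff \<rho>_def)
    \<comment> \<open>A path from \<open>u\<close> to \<open>e v\<close>. Along it
      \<open>B r\<close> is the value of \<open>b\<close> and \<open>P r\<close> the squared norm,
      so \<open>B r / P r\<close> runs continuously from 0 to 1 and takes the value
      \<open>t\<close>.\<close>
    define x where "x = (\<lambda>r. add (sc (of_real (1 - r)) u) (sc (of_real r * e) v))"
    define B P where "B = (\<lambda>r. (1 - r) * r * \<rho> + r\<^sup>2)"
      and "P = (\<lambda>r. (1 - r)\<^sup>2 + r\<^sup>2 + 2 * (1 - r) * r * Re (cnj e * p u v))"
    have xV: "x r \<in> V" for r unfolding x_def using mem by (simp add: linV(2,3))
    have bx: "b (x r) (x r) = of_real (B r)" for r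
    proof -
      have "b (x r) (x r) = of_real (1 - r) * of_real r * (cnj e * X + e * Y) + (of_real r)\<^sup>2 * (e * cnj e)"
        unfolding x_def X_def Y_def using mem b01
        by (simp add: sesqD[OF b] linV(2,3) power2_eq_square algebra_simps)
      also have "e * cnj e = 1" using e complex_norm_square[of e] by simp
      finally show ?thesis unfolding \<rho> by (simp add: B_def)
    qed
    have px: "Re (p (x r) (x r)) = P r" for r
    proof -
      have "Re (p (x r) (x r)) = Re (p (sc (of_real (1 - r)) u) (sc (of_real (1 - r)) u))
        + 2 * Re (cnj (of_real r * e) * p (sc (of_real (1 - r)) u) v) + (cmod (of_real r * e))\<^sup>2 * Re (p v v)"
        unfolding x_def by (rule herm_pos_expand[OF pV V]) (use mem linV(3) in auto)
      also have "p (sc (of_real (1 - r)) u) (sc (of_real (1 - r)) u) = of_real ((1 - r)\<^sup>2)"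
        using mem p1 by (simp add: sesqD[OF herm_posD(1)[OF pV]] linV(3) power2_eq_square)
      also have "cnj (of_real r * e) * p (sc (of_real (1 - r)) u) v = of_real ((1 - r) * r) * (cnj e * p u v)"
        using mem by (simp add: sesqD[OF herm_posD(1)[OF pV]])
      also have "Re (of_real ((1 - r) * r) * (cnj e * p u v)) = (1 - r) * r * Re (cnj e * p u v)"
        by (simp only: times_complex.sel Re_complex_of_real Im_complex_of_real mult_zero_left diff_zero)
      also have "(cmod (of_real r * e))\<^sup>2 * Re (p v v) = r\<^sup>2" using e v by (simp add: norm_mult)
      finally show ?thesis by (simp add: P_def del: of_real_power)
    qed
    \<comment> \<open>If its norm vanished, \<open>x r\<close> would be annihilated by every form.
      Pairing it with \<open>v\<close> on the right and with \<open>u\<close> on the left then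
      forces \<open>r = 0\<close>, where \<open>P\<close> is 1.\<close>
    have P_pos: "0 < P r" for r
    proof (rule ccontr)
      assume "\<not> 0 < P r"
      then have "Re (p (x r) (x r)) = 0" using herm_posD(3)[OF pV xV] px by (metis less_eq_real_def)
      then have 0: "Re (h (x r) (x r)) = 0" by (rule null[OF xV])
      have "a (x r) y = 0" "a y (x r) = 0" "p (x r) y = 0" "p y (x r) = 0" if "y \<in> V" for y
        using a_bound[OF xV that, of r] a_bound[OF that xV, of r] p_bound[of "x r" y] p_bound[of y "x r"] that 0
          xV VH \<open>Re (p (x r) (x r)) = 0\<close> by (auto simp: subset_iff)
      then have "b (x r) v = 0" "b u (x r) = 0" using mem by (simp_all add: b_def)
      then have "of_real (1 - r) * X + of_real r * e = 0" "of_real r * cnj e * X = 0"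
        unfolding x_def X_def using mem b01 by (simp_all add: sesqD[OF b] linV(2,3))
      then show False using e px[of r] \<open>\<not> 0 < P r\<close> by (cases "r = 0") (auto simp: P_def)
    qed
    have "\<exists>r\<ge>0. r \<le> 1 \<and> B r / P r = t"
    proof (rule IVT')
      show "B 0 / P 0 \<le> t" "t \<le> B 1 / P 1" using st by (simp_all add: B_def P_def)
      show "continuous_on {0..1} (\<lambda>r. B r / P r)"
        unfolding B_def using P_pos unfolding P_def
        by (intro continuous_intros) (metis less_irrefl)
    qed simp
    then obtain r where r: "B r / P r = t" by blast
    have G: "(x r, add (sc (of_real (1 - r)) g) (sc (of_real r * e) k)) \<in> graph" (is "(_, ?G) \<in> _")
      unfolding x_def using graph_add graph_scale u(1) v(1) by blast
    have "p ?G (x r) / of_real (P r) \<in> num_range"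
      using num_range_quotient[OF G] px P_pos by simp
    moreover have "p ?G (x r) / of_real (P r) = s *\<^sub>R \<alpha> + t *\<^sub>R \<beta>"
    proof -
      have "p (x r) (x r) = of_real (P r)" using herm_pos_diag[OF pV xV] px by simp
      then have "(p ?G (x r) - \<alpha> * of_real (P r)) / (\<beta> - \<alpha>) = of_real (B r)"
        using bx[of r] graphD(3)[OF G xV[of r]] by (simp only: b_def diff_divide_distrib) simp
      then have "p ?G (x r) - \<alpha> * of_real (P r) = of_real (B r) * (\<beta> - \<alpha>)"
        using False by (simp only: nonzero_divide_eq_eq right_minus_eq if_False)
      then have "p ?G (x r) = \<alpha> * of_real (P r) + of_real (B r) * (\<beta> - \<alpha>)"
        by (simp only: diff_eq_eq add.commute)
      moreover have "of_real (B r) = complex_of_real t * of_real (P r)"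
        using r P_pos[of r] by (auto simp flip: of_real_mult)
      ultimately have "p ?G (x r) / of_real (P r) = \<alpha> + (\<beta> - \<alpha>) * of_real t"
        using P_pos[of r] by (simp add: add_divide_distrib)
      also have "\<dots> = s *\<^sub>R \<alpha> + t *\<^sub>R \<beta>"
      proof -
        have "s = 1 - t" using st by simp
        then show ?thesis by (simp only: scaleR_conv_of_real of_real_diff of_real_1) (simp add: algebra_simps)
      qed
      finally show ?thesis .
    qed
    ultimately show ?thesis by simp
  qed
qed

text \<open>Separating \<open>z\<close> from the numerical range gives a direction \<open>\<beta>\<close> in which the shifted form is
  bounded below by the norm of \<open>L\<^sub>2\<close>; tilting \<open>\<beta>\<close> slightly towards 1 adds control of the form norm.\<close>

lemma resolvent_surjective:
  assumes z: "z \<notin> closure num_range" and g: "g \<in> H"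
  shows "\<exists>u\<in>V. \<forall>v\<in>V. a u v - z * p u v = p g v"
proof -
  obtain \<beta> b where z_less: "inner \<beta> z < b" and less: "\<And>w. w \<in> closure num_range \<Longrightarrow> b < inner \<beta> w"
    using separating_hyperplane_closed_point[OF convex_closure[OF convex_num_range] closed_closure z] by blast
  have inner: "inner \<beta> w = Re (cnj \<beta> * w)" for w by (simp add: inner_complex_def)
  have dom: "b * Re (p x x) \<le> Re (cnj \<beta> * a x x)" if x: "(x, k) \<in> graph" for x k
  proof (cases "Re (p x x) = 0")
    case True
    then have "Re (h x x) = 0" using null graphD[OF x] by blast
    then have "a x x = 0" using a_bound[of x x] graphD(1)[OF x] by simp
    then show ?thesis using True by simp
  next
    case False
    then have pos: "0 < Re (p x x)" using herm_posD(3)[OF pV graphD(1)[OF x]] by simp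
    have "b < Re (cnj \<beta> * (p k x / of_real (Re (p x x))))"
      using less[OF subsetD[OF closure_subset num_range_quotient[OF x pos]]] unfolding inner .
    also have "\<dots> = Re (cnj \<beta> * a x x) / Re (p x x)"
      using graphD(3)[OF x graphD(1)[OF x]] by (metis Re_divide_of_real times_divide_eq_right)
    finally show ?thesis using pos by (simp add: field_simps)
  qed
  \<comment> \<open>The numerical range sees only the operator domain, so \<open>dom\<close> has to
    be carried to \<open>V\<close> by density in the form norm.\<close>
  have form: "b * Re (p u u) \<le> Re (cnj \<beta> * a u u)" if u: "u \<in> V" for u
  proof -
    define q where "q = (\<lambda>u v. cnj \<beta> * a u v - of_real b * p u v)"
    define K where "K = 2 * (cmod (cnj \<beta>))\<^sup>2 * C + 2 * (cmod (of_real b))\<^sup>2"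
    define N where "N = Re (h u u)"
    have q: "sesq V q" unfolding q_def by (rule combined_sesq)
    have q_bound: "cmod (q v w) \<le> sqrt (K * Re (h v v) * Re (h w w))" if "v \<in> V" "w \<in> V" for v w
      unfolding q_def K_def using combined_bound[OF that] by (rule real_le_rsqrt)
    have K: "0 \<le> K" using C by (simp add: K_def)
    have N: "0 \<le> N" using herm_posD(3)[OF h u] by (simp add: N_def)
    define \<epsilon> where "\<epsilon> = (\<lambda>n. inverse (real (Suc n)))"
    have \<epsilon>: "\<epsilon> \<longlonglongrightarrow> 0" "\<And>n. 0 < \<epsilon> n"
      using LIMSEQ_inverse_real_of_nat by (auto simp: \<epsilon>_def)
    \<comment> \<open>With \<open>x\<close> in the domain and \<open>w = u - x\<close>, expanding
      \<open>q x x \<ge> 0\<close> around \<open>u\<close> leaves \<open>q w w\<close> and two cross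
      terms, all small because \<open>w\<close> is small in the form norm.\<close>
    have lower: "- (sqrt (K * \<epsilon> n * \<epsilon> n) + 2 * sqrt (K * N * \<epsilon> n)) \<le> Re (q u u)" for n
    proof -
      obtain x k where x: "(x, k) \<in> graph" "Re (h (diff u x) (diff u x)) < \<epsilon> n"
        using domain_dense[OF u \<epsilon>(2)] by blast
      define w where "w = diff u x"
      have xV: "x \<in> V" using graphD[OF x(1)] by blast
      have w: "w \<in> V" unfolding w_def using u xV by (simp add: linV(2,3))
      have hw: "0 \<le> Re (h w w)" "Re (h w w) \<le> \<epsilon> n" using herm_posD(3)[OF h w] x(2) by (auto simp: w_def)
      have "q x x = q w w + q u u - q u w - q w u"
        unfolding w_def using u xV by (simp add: sesqD[OF q] linV(2,3) algebra_simps)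
      moreover have "0 \<le> Re (q x x)"
        using dom[OF x(1)] by (simp add: q_def)
      moreover have "cmod (q w w) \<le> sqrt (K * \<epsilon> n * \<epsilon> n)"
        by (rule order_trans[OF q_bound[OF w w]])
          (use hw K \<epsilon>(2)[of n] in \<open>intro real_sqrt_le_mono mult_mono, auto\<close>)
      moreover have "cmod (q u w) \<le> sqrt (K * N * \<epsilon> n)"
        by (rule order_trans[OF q_bound[OF u w]])
          (use hw K N in \<open>unfold N_def, intro real_sqrt_le_mono mult_left_mono, auto\<close>)
      moreover have "cmod (q w u) \<le> sqrt (K * N * \<epsilon> n)"
      proof (rule order_trans[OF q_bound[OF w u]])
        have "K * Re (h w w) * N \<le> K * \<epsilon> n * N"
          using hw K N by (intro mult_right_mono mult_left_mono) auto
        then show "sqrt (K * Re (h w w) * Re (h u u)) \<le> sqrt (K * N * \<epsilon> n)"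
          by (intro real_sqrt_le_mono) (simp add: N_def mult_ac)
      qed
      ultimately show ?thesis
        using complex_Re_le_cmod[of "q w w"] abs_Re_le_cmod[of "q u w"] abs_Re_le_cmod[of "q w u"] by simp
    qed
    have "(\<lambda>n. - (sqrt (K * \<epsilon> n * \<epsilon> n) + 2 * sqrt (K * N * \<epsilon> n))) \<longlonglongrightarrow>
        - (sqrt (K * 0 * 0) + 2 * sqrt (K * N * 0))"
      by (intro tendsto_intros \<epsilon>(1))
    then have "0 \<le> Re (q u u)"
      by (intro LIMSEQ_le_const2[of _ 0]) (use lower in auto)
    then show ?thesis by (simp add: q_def)
  qed
  define \<delta> where "\<delta> = b - inner \<beta> z"
  \<comment> \<open>Chosen so that \<open>\<epsilon> * Re z\<close> is at most half of the gap
    \<open>\<delta>\<close>; the summand 1 covers \<open>Re z = 0\<close>.\<close>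
  define \<epsilon> where "\<epsilon> = \<delta> / (2 * (\<bar>Re z\<bar> + 1))"
  have \<delta>: "0 < \<delta>" using z_less by (simp add: \<delta>_def)
  then have \<epsilon>: "0 < \<epsilon>" by (simp add: \<epsilon>_def)
  have "\<epsilon> * Re z \<le> \<epsilon> * (\<bar>Re z\<bar> + 1)" using \<epsilon> by (intro mult_left_mono) auto
  also have "\<dots> = \<delta> / 2"
  proof -
    have "\<delta> / (2 * r) * r = \<delta> / 2" if "0 < r" for r :: real using that by simp
    from this[of "\<bar>Re z\<bar> + 1"] show ?thesis unfolding \<epsilon>_def by linarith
  qed
  finally have \<epsilon>z: "\<epsilon> * Re z \<le> \<delta> / 2" .
  \<comment> \<open>Half of the gap pays for the \<open>p\<close> part of \<open>h\<close>, and the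
    tilt pays for the energy part with constant \<open>\<epsilon> * m\<close>.\<close>
  define c where "c = min (\<delta> / 2) (\<epsilon> * m)"
  have c: "0 < c" using \<delta> \<epsilon> m by (simp add: c_def)
  show ?thesis
  proof (rule shifted_solvable[OF g c, of "cnj \<beta> + of_real \<epsilon>"])
    fix u assume u: "u \<in> V"
    have p0: "0 \<le> Re (p u u)" using herm_posD(3)[OF pV u] .
    have pr: "p u u = of_real (Re (p u u))" using herm_pos_diag[OF pV u] .
    have "c * Re (h u u) = c * (Re (h u u) - Re (p u u)) + c * Re (p u u)" by (simp add: algebra_simps)
    also have "\<dots> \<le> \<epsilon> * m * (Re (h u u) - Re (p u u)) + \<delta> / 2 * Re (p u u)"
      using u p_le_h p0 by (intro add_mono mult_right_mono) (auto simp: c_def)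
    also have "\<dots> \<le> \<epsilon> * Re (a u u) + (\<delta> - \<epsilon> * Re z) * Re (p u u)"
    proof (rule add_mono)
      show "\<epsilon> * m * (Re (h u u) - Re (p u u)) \<le> \<epsilon> * Re (a u u)"
        using mult_left_mono[OF a_coercive[OF u], of \<epsilon>] \<epsilon> by (simp add: mult.assoc)
      show "\<delta> / 2 * Re (p u u) \<le> (\<delta> - \<epsilon> * Re z) * Re (p u u)"
        using \<epsilon>z p0 by (intro mult_right_mono) auto
    qed
    also have "\<dots> = \<epsilon> * Re (a u u) + b * Re (p u u) - Re (cnj \<beta> * z) * Re (p u u) - \<epsilon> * Re z * Re (p u u)"
      by (simp add: \<delta>_def inner algebra_simps)
    also have "\<dots> \<le> \<epsilon> * Re (a u u) + Re (cnj \<beta> * a u u) - Re (cnj \<beta> * z) * Re (p u u) - \<epsilon> * Re z * Re (p u u)"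
      using form[OF u] by simp
    also have "\<dots> = Re ((cnj \<beta> + of_real \<epsilon>) * (a u u - z * p u u))"
    proof -
      obtain P where "p u u = of_real P" using pr by blast
      then show ?thesis by (simp add: algebra_simps)
    qed
    finally show "c * Re (h u u) \<le> Re ((cnj \<beta> + of_real \<epsilon>) * (a u u - z * p u u))" .
  qed
qed

text \<open>Pairing \<open>(A - z) u\<close> with \<open>u\<close> gives \<open>w - z\<close> times
  \<open>p u u\<close>, where \<open>w\<close> is the Rayleigh quotient of \<open>u\<close>, a point
  of the numerical range. Cauchy-Schwarz finishes.\<close>

lemma resolvent_bound:
  assumes \<delta>: "0 \<le> \<delta>" "\<And>w. w \<in> num_range \<Longrightarrow> \<delta> \<le> cmod (w - z)" and g: "(u, g) \<in> graph"
  shows "\<delta>\<^sup>2 * Re (p u u) \<le> Re (p (add g (sc (- z) u)) (add g (sc (- z) u)))"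
proof (cases "Re (p u u) = 0")
  case True
  have "add g (sc (- z) u) \<in> H" using graphD[OF g] VH linH(2,3) by blast
  then show ?thesis using herm_posD(3)[OF p] True by simp
next
  case False
  let ?f = "add g (sc (- z) u)"
  have u: "u \<in> V" "u \<in> H" "g \<in> H" using graphD[OF g] VH by auto
  have f: "?f \<in> H" using u linH(2,3) by blast
  have pos: "0 < Re (p u u)" using herm_posD(3)[OF p u(2)] False by simp
  have pr: "p u u = of_real (Re (p u u))" using herm_pos_diag[OF p u(2)] .
  have "\<delta> \<le> cmod (p g u / of_real (Re (p u u)) - z)" using \<delta>(2) num_range_quotient[OF g pos] .
  also have "p g u / of_real (Re (p u u)) - z = p ?f u / of_real (Re (p u u))"
  proof -
    have "p ?f u = p g u - z * of_real (Re (p u u))"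
      using u pr by (simp add: sesqD[OF herm_posD(1)[OF p]] linH(3))
    then show ?thesis using pos by (simp add: diff_divide_distrib)
  qed
  finally have "\<delta> * Re (p u u) \<le> cmod (p ?f u)" using pos by (simp add: norm_divide field_simps)
  then have "(\<delta> * Re (p u u))\<^sup>2 \<le> (cmod (p ?f u))\<^sup>2" using \<delta>(1) pos by (intro power_mono) auto
  also have "\<dots> \<le> Re (p ?f ?f) * Re (p u u)" by (rule cauchy_schwarz[OF p H f u(2)])
  finally show ?thesis using pos by (simp add: power2_eq_square)
qed

end

section \<open>Test functions\<close>

lemma partial_deriv_eq: "(f has_derivative f') (at x) \<Longrightarrow> partial_deriv k f x = f' (axis k 1)"
  unfolding partial_deriv_def using frechet_derivative_at by metis

text \<open>The product rule in \<open>C_diff_mult\<close> puts the undifferentiated factors back,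
  so they must be known to be smooth of the lower order too.\<close>

lemma C_diff_SucD: "C_diff (Suc j) f \<Longrightarrow> C_diff j f"
proof (induction j arbitrary: f)
  case 0
  then show ?case
    by (auto intro: differentiable_imp_continuous_on simp: differentiable_on_def differentiable_at_withinI)
qed auto

lemma C_diff_const: "C_diff j (\<lambda>_. c)"
proof (induction j arbitrary: c)
  case (Suc j)
  have "partial_deriv k (\<lambda>_. c) = (\<lambda>_. 0)" for k :: 'a
    by (auto simp: partial_deriv_eq[OF has_derivative_const])
  then show ?case using Suc by simp
qed simp

lemma C_diff_add: "C_diff j f \<Longrightarrow> C_diff j g \<Longrightarrow> C_diff j (\<lambda>x. f x + g x)"
proof (induction j arbitrary: f g)
  case (Suc j)
  then have d: "f differentiable (at x)" "g differentiable (at x)" for x by auto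
  have "partial_deriv k (\<lambda>x. f x + g x) = (\<lambda>x. partial_deriv k f x + partial_deriv k g x)" for k
    using partial_deriv_eq[OF has_derivative_add[OF d[unfolded frechet_derivative_works]]]
    by (auto simp: partial_deriv_def)
  then show ?case using Suc d by auto
qed (auto intro: continuous_on_add)

lemma C_diff_mult: "C_diff j f \<Longrightarrow> C_diff j g \<Longrightarrow> C_diff j (\<lambda>x. f x * g x)"
proof (induction j arbitrary: f g)
  case (Suc j)
  then have d: "f differentiable (at x)" "g differentiable (at x)" for x by auto
  have "partial_deriv k (\<lambda>x. f x * g x) = (\<lambda>x. f x * partial_deriv k g x + partial_deriv k f x * g x)" for k
    using partial_deriv_eq[OF has_derivative_mult[OF d[unfolded frechet_derivative_works]]]
    by (auto simp: partial_deriv_def)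
  moreover have "C_diff j f" "C_diff j g" using Suc.prems C_diff_SucD by auto
  ultimately show ?case using Suc d by (auto intro: C_diff_add)
qed (auto intro: continuous_on_mult)

lemma C_diff_prod: "(\<And>i. i \<in> I \<Longrightarrow> C_diff j (f i)) \<Longrightarrow> C_diff j (\<lambda>x. \<Prod>i\<in>I. f i x)"
  by (induction I rule: infinite_finite_induct) (auto intro: C_diff_const C_diff_mult)

section \<open>Flat exponentials and smooth bumps on boxes\<close>

lemma poly_div_exp_tendsto_0: "((\<lambda>y. poly P y * exp (- y)) \<longlongrightarrow> (0::real)) at_top"
proof -
  have "((\<lambda>y. \<Sum>i\<le>degree P. coeff P i * (y ^ i / exp y)) \<longlongrightarrow> (\<Sum>i\<le>degree P. coeff P i * 0)) at_top"
    by (intro tendsto_intros tendsto_power_div_exp_0)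
  then show ?thesis
    by (simp add: poly_altdef sum_distrib_right exp_minus divide_inverse mult.assoc)
qed

text \<open>The family \<open>p (1/t) exp (-1/t)\<close>, with \<open>p\<close> a polynomial, is closed under differentiation.\<close>

definition flat_exp :: "real poly \<Rightarrow> real \<Rightarrow> real" where
  "flat_exp P t = (if 0 < t then poly P (1 / t) * exp (- (1 / t)) else 0)"

text \<open>In the variable \<open>s = 1 / t\<close> differentiation by \<open>t\<close> is
  \<open>- s^2\<close> times differentiation by \<open>s\<close>, which turns
  \<open>P(s) exp (- s)\<close> into \<open>s^2 (P - P') exp (- s)\<close>; the factor
  \<open>[:0, 0, 1:]\<close> is \<open>s^2\<close>.\<close>

lemma flat_exp_has_derivative:
  "(flat_exp P has_real_derivative flat_exp ([:0, 0, 1:] * (P - pderiv P)) t) (at t)"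
proof -
  consider "t < 0" | "t = 0" | "0 < t" by linarith
  then show ?thesis
  proof cases
    case 1
    have "((\<lambda>_. 0) has_real_derivative 0) (at t)" by simp
    then have "(flat_exp P has_real_derivative 0) (at t)"
      by (rule has_field_derivative_transform_within_open[of _ _ _ "{..<0}"])
        (use 1 in \<open>auto simp: flat_exp_def\<close>)
    then show ?thesis using 1 by (simp add: flat_exp_def)
  next
    case 2
    \<comment> \<open>The difference quotient at 0 is \<open>s P(s) exp (- s)\<close> with
      \<open>s = 1 / y\<close>, and \<open>pCons 0 P\<close> is the polynomial
      \<open>s P(s)\<close>.\<close>
    have "((\<lambda>y. poly (pCons 0 P) (inverse y) * exp (- inverse y)) \<longlongrightarrow> 0) (at_right 0)"
      using filterlim_compose[OF poly_div_exp_tendsto_0 filterlim_inverse_at_top_right] .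
    then have "((\<lambda>y. flat_exp P y / y) \<longlongrightarrow> 0) (at_right 0)"
      by (rule Lim_transform_eventually)
        (auto simp: eventually_at_filter flat_exp_def divide_inverse mult_ac intro!: always_eventually)
    moreover have "((\<lambda>y. flat_exp P y / y) \<longlongrightarrow> 0) (at_left 0)"
      by (rule Lim_transform_eventually[OF tendsto_const])
        (auto simp: eventually_at_filter flat_exp_def intro!: always_eventually)
    ultimately have "((\<lambda>y. flat_exp P y / y) \<longlongrightarrow> 0) (at 0)"
      by (simp add: filterlim_at_split)
    then show ?thesis using 2 by (simp add: has_field_derivative_iff flat_exp_def)
  next
    case 3
    have "((\<lambda>t. poly P (1 / t) * exp (- (1 / t))) has_real_derivative
        poly ([:0, 0, 1:] * (P - pderiv P)) (1 / t) * exp (- (1 / t))) (at t)"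
      using 3
      by (auto intro!: derivative_eq_intros simp: power2_eq_square field_simps)
    then have "(flat_exp P has_real_derivative
        poly ([:0, 0, 1:] * (P - pderiv P)) (1 / t) * exp (- (1 / t))) (at t)"
      by (rule has_field_derivative_transform_within_open[of _ _ _ "{0<..}"])
        (use 3 in \<open>auto simp: flat_exp_def\<close>)
    then show ?thesis using 3 by (simp add: flat_exp_def)
  qed
qed

lemma C_diff_flat_exp: "C_diff j (\<lambda>x :: real ^ 'n::finite. of_real (flat_exp P (c * x $ i + d)))"
proof (induction j arbitrary: P)
  case 0
  have "continuous_on UNIV (flat_exp P)"
    using flat_exp_has_derivative DERIV_isCont continuous_at_imp_continuous_on by blast
  then have "continuous_on UNIV (\<lambda>x :: real ^ 'n. flat_exp P (c * x $ i + d))"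
    by (rule continuous_on_compose2) (auto intro!: continuous_intros)
  then show ?case by (simp add: continuous_on_of_real)
next
  case (Suc j)
  define Q where "Q = [:0, 0, 1:] * (P - pderiv P)"
  have D: "((\<lambda>x :: real ^ 'n. complex_of_real (flat_exp P (c * x $ i + d))) has_derivative
      (\<lambda>v. of_real (flat_exp Q (c * x $ i + d) * (c * v $ i)))) (at x)" for x
  proof -
    have 1: "((\<lambda>x :: real ^ 'n. c * x $ i + d) has_derivative (\<lambda>v. c * v $ i)) (at x)"
      by (auto intro!: derivative_eq_intros bounded_linear_imp_has_derivative bounded_linear_vec_nth)
    show ?thesis
      by (rule has_derivative_of_real)
        (use has_derivative_compose[OF 1 flat_exp_has_derivative[THEN has_field_derivative_imp_has_derivative]]
          in \<open>simp add: Q_def mult_ac\<close>)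
  qed
  have "partial_deriv k (\<lambda>x :: real ^ 'n. complex_of_real (flat_exp P (c * x $ i + d))) =
      (\<lambda>x. of_real (c * axis k 1 $ i) * of_real (flat_exp Q (c * x $ i + d)))" for k
    unfolding partial_deriv_eq[OF D, abs_def] by (auto simp: partial_deriv_eq[OF D] mult_ac)
  then show ?case
    using Suc D by (auto simp: differentiable_def intro!: C_diff_mult[OF C_diff_const])
qed

text \<open>The arguments are \<open>(n + 1) (x_i - a_i)\<close> and
  \<open>(n + 1) (b_i - x_i)\<close>, written in the affine shape of \<open>C_diff_flat_exp\<close>.
  Every member is nonzero exactly on the open box; growing \<open>n\<close> only steepens
  it.\<close>

definition box_bump :: "real ^ 'n::finite \<Rightarrow> real ^ 'n \<Rightarrow> nat \<Rightarrow> 'n cfun" where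
  "box_bump a b n x = (\<Prod>i\<in>UNIV. of_real (flat_exp 1 (Suc n * x $ i + - Suc n * a $ i))
      * of_real (flat_exp 1 (- Suc n * x $ i + Suc n * b $ i)))"

lemma flat_exp_1: "0 \<le> flat_exp 1 t" "flat_exp 1 t \<le> 1" "flat_exp 1 t \<noteq> 0 \<longleftrightarrow> 0 < t"
  by (auto simp: flat_exp_def)

lemma box_bump_support: "box_bump a b n x \<noteq> 0 \<longleftrightarrow> x \<in> box a b"
proof -
  have 1: "0 < Suc n * x $ i + - Suc n * a $ i \<longleftrightarrow> a $ i < x $ i" for i
    by (simp flip: right_diff_distrib del: of_nat_Suc add: zero_less_mult_iff)
  have 2: "0 < - Suc n * x $ i + Suc n * b $ i \<longleftrightarrow> x $ i < b $ i" for i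
    by (simp flip: right_diff_distrib del: of_nat_Suc add: zero_less_mult_iff)
  show ?thesis
    unfolding box_bump_def using 1 2 flat_exp_1(3) by (auto simp: mem_box_cart simp del: of_nat_Suc)
qed

lemma box_bump_le_1: "cmod (box_bump a b n x) \<le> 1"
  unfolding box_bump_def prod_norm[symmetric] norm_mult norm_of_real
  by (rule prod_le_1) (use flat_exp_1 in \<open>auto intro!: mult_le_one\<close>)

lemma box_bump_tendsto: "(\<lambda>n. box_bump a b n x) \<longlonglongrightarrow> of_real (indicator (box a b) x)"
proof (cases "x \<in> box a b")
  case True
  have lim: "(\<lambda>n. flat_exp 1 (Suc n * s)) \<longlonglongrightarrow> 1" if "0 < s" for s :: real
  proof -
    have "(\<lambda>n. exp (- (inverse (Suc n) * (1 / s)))) \<longlonglongrightarrow> exp (- (0 * (1 / s)))"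
      by (intro tendsto_intros LIMSEQ_inverse_real_of_nat)
    then show ?thesis
      using that by (simp add: flat_exp_def divide_inverse zero_less_mult_iff del: of_nat_Suc)
  qed
  have "(\<lambda>n. of_real (flat_exp 1 (Suc n * (x $ i - a $ i))) * of_real (flat_exp 1 (Suc n * (b $ i - x $ i))))
      \<longlonglongrightarrow> complex_of_real 1 * of_real 1" for i
    using True by (intro tendsto_intros lim) (auto simp: mem_box_cart)
  then have "(\<lambda>n. \<Prod>i\<in>UNIV. of_real (flat_exp 1 (Suc n * (x $ i - a $ i)))
      * of_real (flat_exp 1 (Suc n * (b $ i - x $ i)))) \<longlonglongrightarrow> (\<Prod>i\<in>(UNIV :: 'a set). complex_of_real 1 * of_real 1)"
    by (intro tendsto_prod) auto
  moreover have "box_bump a b n x = (\<Prod>i\<in>UNIV. of_real (flat_exp 1 (Suc n * (x $ i - a $ i)))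
      * of_real (flat_exp 1 (Suc n * (b $ i - x $ i))))" for n
    unfolding box_bump_def by (simp add: right_diff_distrib del: of_nat_Suc)
  ultimately show ?thesis using True by simp
next
  case False
  then have "box_bump a b n x = 0" for n using box_bump_support by blast
  then show ?thesis using False by simp
qed

lemma box_bump_test_function:
  assumes "cbox a b \<subseteq> \<Omega>"
  shows "box_bump a b n \<in> test_functions \<Omega>"
proof -
  have supp: "{x. box_bump a b n x \<noteq> 0} = box a b" using box_bump_support by blast
  have "closure (box a b) \<subseteq> cbox a b" by (intro closure_minimal box_subset_cbox closed_cbox)
  moreover have "compact (closure (box a b))" by (simp add: compact_closure bounded_box)
  moreover have "C_diff j (box_bump a b n)" for j
    unfolding box_bump_def by (intro C_diff_prod C_diff_mult C_diff_flat_exp)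
  ultimately show ?thesis using assms by (auto simp: test_functions_def supp)
qed

section \<open>The fundamental lemma of the calculus of variations\<close>

lemma integral_boxes_zero_imp_AE_zero:
  fixes F :: "'a::euclidean_space \<Rightarrow> 'b::{banach, second_countable_topology}"
  assumes int: "integrable lebesgue F"
    and zero: "\<And>a b. set_lebesgue_integral lebesgue (box a b) F = 0"
  shows "AE x in lebesgue. F x = 0"
proof -
  \<comment> \<open>Open boxes are stable under intersection and generate the Borel sets, so
    vanishing integrals spread to all Borel sets by a Dynkin argument, then to Lebesgue sets up to
    null sets. Uniqueness of densities concludes.\<close>
  let ?E = "range (\<lambda>(a, b). box a b :: 'a set)"
  have set_int: "set_integrable lebesgue A F" if "A \<in> sets lebesgue" for A
    unfolding set_integrable_def by (rule integrable_mult_indicator[OF that int])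
  \<comment> \<open>The complement step of the Dynkin argument needs the integral over the whole
    space, which is exhausted by boxes.\<close>
  have total: "integral\<^sup>L lebesgue F = 0"
  proof -
    let ?B = "\<lambda>n::nat. box (- (real n *\<^sub>R One)) (real n *\<^sub>R One) :: 'a set"
    have "(\<lambda>n. \<integral>x. indicator (?B n) x *\<^sub>R F x \<partial>lebesgue) \<longlonglongrightarrow> integral\<^sup>L lebesgue F"
    proof (rule integral_dominated_convergence[where w = "\<lambda>x. norm (F x)"])
      show "AE x in lebesgue. (\<lambda>n. indicator (?B n) x *\<^sub>R F x) \<longlonglongrightarrow> F x"
      proof (rule AE_I2, rule tendsto_eventually)
        fix x :: 'a
        obtain k where k: "x \<in> ?B k" using UN_box_eq_UNIV by blast
        show "\<forall>\<^sub>F n in sequentially. indicator (?B n) x *\<^sub>R F x = F x"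
        proof (rule eventually_sequentiallyI)
          fix n assume "k \<le> n"
          then have "x \<in> ?B n" using k by (force simp: mem_box)
          then show "indicator (?B n) x *\<^sub>R F x = F x" by simp
        qed
      qed
      show "(\<lambda>x. indicator (?B n) x *\<^sub>R F x) \<in> borel_measurable lebesgue" for n
        using int by (intro borel_measurable_scaleR borel_measurable_indicator) auto
      show "AE x in lebesgue. norm (indicator (?B n) x *\<^sub>R F x) \<le> norm (F x)" for n
        by (auto simp: indicator_def)
    qed (use int in auto)
    moreover have "(\<integral>x. indicator (?B n) x *\<^sub>R F x \<partial>lebesgue) = 0" for n
      using zero by (simp add: set_lebesgue_integral_def)
    ultimately show ?thesis by (simp add: LIMSEQ_const_iff)
  qed
  have borel: "set_lebesgue_integral lebesgue A F = 0" if "A \<in> sets borel" for A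
  proof -
    have E: "Int_stable ?E" "?E \<subseteq> Pow UNIV" by (auto simp: Int_stable_def box_Int_box)
    have sets: "sigma_sets UNIV ?E = sets (borel :: 'a measure)"
      unfolding borel_eq_box by (simp add: sets_measure_of)
    have "A \<in> sigma_sets UNIV ?E" using that sets by simp
    with E show ?thesis
    proof (induct rule: sigma_sets_induct_disjoint)
      case (basic A)
      then show ?case using zero by auto
    next
      case empty
      then show ?case by (simp add: set_lebesgue_integral_def)
    next
      case (compl A)
      then have "A \<in> sets lebesgue" using sets by auto
      moreover have "indicator (UNIV - A) x *\<^sub>R F x = F x - indicator A x *\<^sub>R F x" for x
        by (simp add: indicator_def)
      ultimately have "set_lebesgue_integral lebesgue (UNIV - A) F
          = integral\<^sup>L lebesgue F - set_lebesgue_integral lebesgue A F"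
        using Bochner_Integration.integral_diff[OF int set_int[of A, unfolded set_integrable_def]]
        by (simp add: set_lebesgue_integral_def)
      then show ?case using compl total by simp
    next
      case (union A)
      then have A: "A i \<in> sets lebesgue" for i using sets by auto
      have "set_lebesgue_integral lebesgue (\<Union>i. A i) F = (\<Sum>i. set_lebesgue_integral lebesgue (A i) F)"
        using union(1) A by (intro lebesgue_integral_countable_add set_int)
          (auto simp: disjoint_family_on_def)
      then show ?case using union by simp
    qed
  qed
  have "set_lebesgue_integral lebesgue A F = set_lebesgue_integral lebesgue A (\<lambda>_. 0)"
    if "A \<in> sets lebesgue" for A
  proof -
    obtain S N N' where A: "A = S \<union> N" "N \<subseteq> N'" "N' \<in> null_sets lborel" "S \<in> sets lborel"
      using sets_completionE[OF \<open>A \<in> sets lebesgue\<close>] by blast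
    have "AE x in lebesgue. x \<notin> N'"
      using A(3) by (intro AE_not_in null_sets_completionI)
    then have "AE x in lebesgue. x \<in> A \<longleftrightarrow> x \<in> S" by eventually_elim (use A in auto)
    then have ae: "AE x in lebesgue. indicator A x *\<^sub>R F x = indicator S x *\<^sub>R F x"
      by eventually_elim (simp add: indicator_def)
    have "S \<in> sets lebesgue" using A(4) by simp
    then have "set_lebesgue_integral lebesgue A F = set_lebesgue_integral lebesgue S F"
      unfolding set_lebesgue_integral_def
      using that int by (intro integral_cong_AE ae borel_measurable_scaleR borel_measurable_indicator) auto
    then show ?thesis using borel A(4) by (simp add: set_lebesgue_integral_def)
  qed
  moreover have "sigma_finite_measure (lebesgue :: 'a measure)"
  proof
    obtain A :: "'a set set" where A: "countable A" "A \<subseteq> sets lborel" "\<Union>A = space lborel"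
      "\<forall>a\<in>A. emeasure lborel a \<noteq> \<infinity>"
      using lborel.sigma_finite_countable by blast
    then have "A \<subseteq> sets lebesgue" "\<forall>a\<in>A. emeasure lebesgue a \<noteq> \<infinity>" by auto
    then show "\<exists>A :: 'a set set. countable A \<and> A \<subseteq> sets lebesgue \<and> \<Union>A = space lebesgue \<and>
        (\<forall>a\<in>A. emeasure lebesgue a \<noteq> \<infinity>)"
      using A(1,3) by (intro exI[of _ A]) simp
  qed
  ultimately show ?thesis
    by (intro sigma_finite_measure.density_unique_banach[OF _ int]) auto
qed

lemma square_integrable_compact_support:
  fixes \<psi> :: "'n::finite cfun"
  assumes "continuous_on UNIV \<psi>" "compact K" "\<And>x. x \<notin> K \<Longrightarrow> \<psi> x = 0" and \<Omega>: "\<Omega> \<in> sets lebesgue"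
  shows "square_integrable \<Omega> \<psi>"
proof -
  have meas: "\<psi> \<in> borel_measurable (lebesgue_on \<Omega>)"
    using borel_measurable_continuous_onI[OF assms(1)]
    by (intro measurable_restrict_space1) (simp add: measurable_completion)
  have "compact (\<psi> ` K)" using assms by (intro compact_continuous_image) (auto intro: continuous_on_subset)
  then obtain B where B: "\<And>x. x \<in> K \<Longrightarrow> cmod (\<psi> x) \<le> B" 
    using compact_imp_bounded bounded_iff by (metis imageI)
  have "integrable (lebesgue_on \<Omega>) (\<lambda>x. (norm (\<psi> x))\<^sup>2)"
  proof (rule Bochner_Integration.integrable_bound)
    have "integrable lebesgue (\<lambda>x. indicator \<Omega> x *\<^sub>R (B\<^sup>2 * indicator K x))"
      using lmeasurable_compact[OF assms(2)] \<Omega> by (intro integrable_mult_indicator integrable_mult_right)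
        (auto simp: integrable_indicator_iff fmeasurable_def)
    then show "integrable (lebesgue_on \<Omega>) (\<lambda>x. B\<^sup>2 * indicator K x)"
      using \<Omega> by (subst integrable_restrict_space) auto
    show "AE x in lebesgue_on \<Omega>. norm ((norm (\<psi> x))\<^sup>2) \<le> norm (B\<^sup>2 * indicat_real K x)"
      using B assms(3) by (intro AE_I2) (auto simp: indicator_def intro!: power_mono)
  qed (use meas in simp)
  then show ?thesis using meas by (simp add: square_integrable_def)
qed

lemma test_function_square_integrable:
  fixes \<Omega> :: "(real ^ 'n::finite) set"
  assumes \<phi>: "\<phi> \<in> test_functions \<Omega>" and \<Omega>: "\<Omega> \<in> sets lebesgue"
  shows "square_integrable \<Omega> \<phi>" "square_integrable \<Omega> (partial_deriv k \<phi>)"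
proof -
  let ?K = "closure {x. \<phi> x \<noteq> 0}"
  have smooth: "C_diff 0 \<phi>" "C_diff (Suc 0) \<phi>" and K: "compact ?K"
    using \<phi> unfolding test_functions_def by blast+
  have zero: "\<phi> x = 0" if "x \<notin> ?K" for x using that closure_subset[of "{x. \<phi> x \<noteq> 0}"] by auto
  have cont: "continuous_on UNIV \<phi>" "continuous_on UNIV (partial_deriv k \<phi>)" using smooth by simp_all
  show "square_integrable \<Omega> \<phi>"
    by (rule square_integrable_compact_support[OF cont(1) K zero \<Omega>])
  have "partial_deriv k \<phi> x = 0" if x: "x \<notin> ?K" for x
  proof -
    have "((\<lambda>_. 0) has_derivative (\<lambda>_. 0)) (at x)" by simp
    then have "(\<phi> has_derivative (\<lambda>_. 0)) (at x)"
    proof (rule has_derivative_transform_within_open)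
      show "open (- ?K)" by (simp add: open_Compl)
      show "x \<in> - ?K" using x by simp
      show "0 = \<phi> y" if "y \<in> - ?K" for y using zero[of y] that by simp
    qed
    then show ?thesis by (rule partial_deriv_eq)
  qed
  then show "square_integrable \<Omega> (partial_deriv k \<phi>)"
    by (rule square_integrable_compact_support[OF cont(2) K _ \<Omega>])
qed

lemma square_integrable_mult:
  fixes f g :: "real ^ 'n \<Rightarrow> complex"
  assumes "square_integrable \<Omega> f" "square_integrable \<Omega> g"
  shows "integrable (lebesgue_on \<Omega>) (\<lambda>x. f x * g x)"
proof (rule Bochner_Integration.integrable_bound)
  show "integrable (lebesgue_on \<Omega>) (\<lambda>x. norm (f x) * norm (g x))"
    using assms unfolding square_integrable_def by (intro integrable_norm_mult) auto
qed (use assms in \<open>auto simp: square_integrable_def norm_mult intro!: borel_measurable_times\<close>)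

text \<open>Bounded convergence of the bumps gives integral zero over boxes in
  \<open>\<Omega>\<close>. As \<open>G\<close> is square integrable but perhaps not integrable on
  \<open>\<Omega>\<close>, the box criterion is applied inside one closed box at a time, and
  countably many of these cover \<open>\<Omega>\<close>.\<close>

lemma fundamental_lemma:
  fixes G :: "real ^ 'n::finite \<Rightarrow> complex"
  assumes \<Omega>: "open \<Omega>" and G: "square_integrable \<Omega> G"
    and zero: "\<And>\<phi>. \<phi> \<in> test_functions \<Omega> \<Longrightarrow> (\<integral>x. G x * \<phi> x \<partial>lebesgue_on \<Omega>) = 0"
  shows "AE x in lebesgue_on \<Omega>. G x = 0"
proof -
  have \<Omega>s: "\<Omega> \<in> sets lebesgue" using \<Omega> by simp
  have meas: "G \<in> borel_measurable (lebesgue_on \<Omega>)" using G by (simp add: square_integrable_def)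
  have ind_int: "square_integrable \<Omega> (\<lambda>x. complex_of_real (indicator S x))" if "S \<in> lmeasurable" for S
  proof -
    have "integrable lebesgue (\<lambda>x. indicator \<Omega> x *\<^sub>R indicat_real S x)"
      using \<Omega>s that by (intro integrable_mult_indicator) (auto simp: integrable_indicator_iff fmeasurable_def)
    then have "integrable (lebesgue_on \<Omega>) (indicat_real S)"
      using \<Omega>s by (subst integrable_restrict_space) auto
    moreover have "(\<lambda>x. (norm (complex_of_real (indicator S x)))\<^sup>2) = indicat_real S"
      by (auto simp: indicator_def)
    ultimately show ?thesis
      unfolding square_integrable_def
      using measurable_compose[OF borel_measurable_integrable borel_measurable_of_real] by simp
  qed
  have box_zero: "(\<integral>x. G x * of_real (indicator (box a b) x) \<partial>lebesgue_on \<Omega>) = 0" if ab: "cbox a b \<subseteq> \<Omega>" for a b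
  proof -
    have "(\<lambda>n. \<integral>x. G x * box_bump a b n x \<partial>lebesgue_on \<Omega>)
        \<longlonglongrightarrow> (\<integral>x. G x * of_real (indicator (box a b) x) \<partial>lebesgue_on \<Omega>)"
    proof (rule integral_dominated_convergence[where w = "\<lambda>x. norm (G x * of_real (indicator (cbox a b) x))"])
      show "(\<lambda>x. G x * of_real (indicator (box a b) x)) \<in> borel_measurable (lebesgue_on \<Omega>)"
        using meas ind_int[OF lmeasurable_box[of a b]]
        by (intro borel_measurable_times) (auto simp: square_integrable_def)
      show "(\<lambda>x. G x * box_bump a b n x) \<in> borel_measurable (lebesgue_on \<Omega>)" for n
        using test_function_square_integrable(1)[OF box_bump_test_function[OF ab] \<Omega>s] meas
        by (intro borel_measurable_times) (auto simp: square_integrable_def)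
      show "integrable (lebesgue_on \<Omega>) (\<lambda>x. norm (G x * of_real (indicator (cbox a b) x)))"
        by (intro integrable_norm square_integrable_mult G ind_int lmeasurable_cbox)
      show "AE x in lebesgue_on \<Omega>. (\<lambda>n. G x * box_bump a b n x) \<longlonglongrightarrow> G x * of_real (indicator (box a b) x)"
        by (intro AE_I2 tendsto_mult tendsto_const box_bump_tendsto)
      show "AE x in lebesgue_on \<Omega>. norm (G x * box_bump a b n x) \<le> norm (G x * of_real (indicator (cbox a b) x))" for n
      proof (rule AE_I2)
        fix x
        have "cmod (box_bump a b n x) \<le> indicator (cbox a b) x"
          using box_bump_le_1[of a b n x] box_bump_support[of a b n x] box_subset_cbox[of a b]
          by (auto simp: indicator_def)
        then show "norm (G x * box_bump a b n x) \<le> norm (G x * of_real (indicator (cbox a b) x))"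
          by (simp add: norm_mult mult_left_mono)
      qed
    qed
    moreover have "(\<integral>x. G x * box_bump a b n x \<partial>lebesgue_on \<Omega>) = 0" for n
      by (rule zero[OF box_bump_test_function[OF ab]])
    ultimately show ?thesis by (simp add: LIMSEQ_const_iff)
  qed
  have local_zero: "AE x in lebesgue. x \<in> cbox a b \<longrightarrow> G x = 0" if ab: "cbox a b \<subseteq> \<Omega>" for a b
  proof -
    define F where "F = (\<lambda>x. indicator \<Omega> x *\<^sub>R (G x * of_real (indicator (box a b) x)))"
    have int: "integrable lebesgue F"
      unfolding F_def using square_integrable_mult[OF G ind_int[OF lmeasurable_box[of a b]]] \<Omega>s
      by (subst (asm) integrable_restrict_space) auto
    have "set_lebesgue_integral lebesgue (box c d) F = 0" for c d
    proof -
      obtain p q where pq: "box a b \<inter> box c d = box p q" using box_Int_box[of a b c d] by blast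
      then have "indicator (box c d) x *\<^sub>R F x = indicator \<Omega> x *\<^sub>R (G x * of_real (indicator (box p q) x))" for x
        unfolding F_def pq[symmetric] by (simp add: indicator_def)
      then have eq: "set_lebesgue_integral lebesgue (box c d) F
          = (\<integral>x. G x * of_real (indicator (box p q) x) \<partial>lebesgue_on \<Omega>)"
        unfolding set_lebesgue_integral_def using \<Omega>s by (subst integral_restrict_space) auto
      show ?thesis
      \<comment> \<open>A nonempty \<open>box p q\<close> has closure \<open>cbox p q\<close>, which
        therefore stays inside \<open>cbox a b\<close>. For an empty one \<open>cbox p q\<close>
        could leave \<open>\<Omega>\<close>.\<close>
      proof (cases "box p q = {}")
        case True
        then show ?thesis unfolding eq by simp
      next
        case False
        have "box p q \<subseteq> cbox a b" using pq box_subset_cbox[of a b] by blast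
        then have "cbox p q \<subseteq> cbox a b" using False closure_box[of p q] closure_minimal closed_cbox by metis
        then show ?thesis unfolding eq using box_zero[of p q] ab by blast
      qed
    qed
    then have "AE x in lebesgue. F x = 0" by (rule integral_boxes_zero_imp_AE_zero[OF int])
    moreover have "AE x in lebesgue. x \<notin> cbox a b - box a b"
      using negligible_frontier_interval[of a b] by (intro AE_not_in) (simp add: negligible_iff_null_sets)
    ultimately show ?thesis
    proof eventually_elim
      fix x assume x: "F x = 0" "x \<notin> cbox a b - box a b"
      show "x \<in> cbox a b \<longrightarrow> G x = 0"
      proof
        assume "x \<in> cbox a b"
        then have "x \<in> \<Omega>" "x \<in> box a b" using ab x(2) by blast+
        then show "G x = 0" using x(1) by (simp add: F_def)
      qed
    qed
  qed
  obtain \<D> where \<D>: "countable \<D>" "\<D> \<subseteq> Pow \<Omega>" "\<And>X. X \<in> \<D> \<Longrightarrow> \<exists>a b. X = cbox a b" "\<Union>\<D> = \<Omega>"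
    using open_countable_Union_open_cbox[OF \<Omega>] by blast
  have "AE x in lebesgue. x \<in> X \<longrightarrow> G x = 0" if "X \<in> \<D>" for X
    using \<D>(2,3) local_zero that by (metis PowD subsetD)
  then have "AE x in lebesgue. \<forall>X\<in>\<D>. x \<in> X \<longrightarrow> G x = 0"
    unfolding AE_ball_countable[OF \<D>(1)] by blast
  then have "AE x in lebesgue. x \<in> \<Omega> \<longrightarrow> G x = 0"
    by eventually_elim (use \<D>(4) in blast)
  then show ?thesis using \<Omega>s by (subst AE_restrict_space_iff) auto
qed

section \<open>Operations preserving square integrability\<close>

lemma square_integrable_meas: "square_integrable \<Omega> f \<Longrightarrow> f \<in> borel_measurable (lebesgue_on \<Omega>)"
  by (simp add: square_integrable_def)

lemma square_integrable_int: "square_integrable \<Omega> f \<Longrightarrow> integrable (lebesgue_on \<Omega>) (\<lambda>x. (norm (f x))\<^sup>2)"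
  by (simp add: square_integrable_def)

lemma square_integrable_add:
  fixes f g :: "real ^ 'n \<Rightarrow> 'b::{banach, second_countable_topology}"
  shows "square_integrable \<Omega> f \<Longrightarrow> square_integrable \<Omega> g \<Longrightarrow> square_integrable \<Omega> (\<lambda>x. f x + g x)"
  unfolding square_integrable_def using integrable_norm_add_sq borel_measurable_add by blast

lemma square_integrable_le:
  fixes f :: "real ^ 'n \<Rightarrow> 'b::real_normed_vector" and g :: "real ^ 'n \<Rightarrow> 'c::real_normed_vector"
  assumes "square_integrable \<Omega> f" "g \<in> borel_measurable (lebesgue_on \<Omega>)"
    and "\<And>x. norm (g x) \<le> C * norm (f x)"
  shows "square_integrable \<Omega> g"
proof -
  have "integrable (lebesgue_on \<Omega>) (\<lambda>x. (norm (g x))\<^sup>2)"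
  proof (rule Bochner_Integration.integrable_bound)
    show "integrable (lebesgue_on \<Omega>) (\<lambda>x. C\<^sup>2 * (norm (f x))\<^sup>2)"
      using square_integrable_int[OF assms(1)] by simp
    show "AE x in lebesgue_on \<Omega>. norm ((norm (g x))\<^sup>2) \<le> norm (C\<^sup>2 * (norm (f x))\<^sup>2)"
      using power_mono[OF assms(3), of _ 2] by (intro AE_I2) (simp add: power_mult_distrib)
  qed (use assms(2) in simp)
  then show ?thesis using assms(2) by (simp add: square_integrable_def)
qed

lemma measurable_vec_nth:
  fixes G :: "'x \<Rightarrow> 'b::{euclidean_space} ^ 'n::finite"
  assumes "G \<in> borel_measurable M"
  shows "(\<lambda>x. G x $ k) \<in> borel_measurable M"
  using measurable_compose[OF assms borel_measurable_continuous_onI[of "\<lambda>v. v $ k"]]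
  by (simp add: continuous_on_component)

lemma square_integrable_component:
  fixes G :: "real ^ 'n \<Rightarrow> complex ^ 'm::finite"
  assumes "square_integrable \<Omega> G"
  shows "square_integrable \<Omega> (\<lambda>x. G x $ k)"
  by (rule square_integrable_le[OF assms measurable_vec_nth[OF square_integrable_meas[OF assms]], of k 1])
    (simp add: Finite_Cartesian_Product.norm_nth_le)

lemma norm_vector_scalar_mult: "norm (c *s (G :: complex ^ 'm::finite)) = cmod c * norm G"
  by (simp add: norm_vec_def L2_set_left_distrib vector_scalar_mult_def norm_mult L2_set_right_distrib)

lemma measurable_vector_scalar_mult:
  fixes G :: "'x \<Rightarrow> complex ^ 'm::finite"
  assumes "G \<in> borel_measurable M"
  shows "(\<lambda>x. c *s G x) \<in> borel_measurable M"
proof -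
  have "continuous_on UNIV (\<lambda>v :: complex ^ 'm. c *s v)"
    unfolding vector_scalar_mult_def by (intro continuous_intros)
  then show ?thesis using measurable_compose[OF assms borel_measurable_continuous_onI] by blast
qed

lemma square_integrable_vector_scalar_mult:
  fixes G :: "real ^ 'n \<Rightarrow> complex ^ 'm::finite"
  assumes "square_integrable \<Omega> G"
  shows "square_integrable \<Omega> (\<lambda>x. c *s G x)"
  by (rule square_integrable_le[OF assms measurable_vector_scalar_mult[OF square_integrable_meas[OF assms]],
        of c "cmod c"]) (simp add: norm_vector_scalar_mult)

lemma square_integrable_scale:
  fixes f :: "real ^ 'n \<Rightarrow> complex"
  assumes "square_integrable \<Omega> f"
  shows "square_integrable \<Omega> (\<lambda>x. c * f x)"
  by (rule square_integrable_le[OF assms, of _ "cmod c"])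
    (use assms in \<open>auto simp: norm_mult square_integrable_def\<close>)

section \<open>Weak gradients\<close>

lemma weak_gradient_integrable:
  assumes \<Omega>: "open \<Omega>" and f: "square_integrable \<Omega> f" and G: "square_integrable \<Omega> G"
    and \<phi>: "\<phi> \<in> test_functions \<Omega>"
  shows "integrable (lebesgue_on \<Omega>) (\<lambda>x. f x * partial_deriv k \<phi> x)"
    "integrable (lebesgue_on \<Omega>) (\<lambda>x. G x $ k * \<phi> x)"
  using test_function_square_integrable[OF \<phi>] \<Omega> f G square_integrable_component
  by (auto intro!: square_integrable_mult)

lemma weak_gradient_add:
  assumes \<Omega>: "open \<Omega>" and f: "square_integrable \<Omega> f" "square_integrable \<Omega> f'"
    and G: "weak_gradient \<Omega> f G" "weak_gradient \<Omega> f' G'"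
  shows "weak_gradient \<Omega> (\<lambda>x. f x + f' x) (\<lambda>x. G x + G' x)"
proof -
  have sq: "square_integrable \<Omega> G" "square_integrable \<Omega> G'" using G by (auto simp: weak_gradient_def)
  note int = weak_gradient_integrable[OF \<Omega> f(1) sq(1)] weak_gradient_integrable[OF \<Omega> f(2) sq(2)]
  show ?thesis
    using G int square_integrable_add[OF sq] by (simp add: weak_gradient_def distrib_right)
qed

lemma weak_gradient_scale:
  assumes G: "weak_gradient \<Omega> f G"
  shows "weak_gradient \<Omega> (\<lambda>x. c * f x) (\<lambda>x. c *s G x)"
  using G square_integrable_vector_scalar_mult[of \<Omega> G c] by (simp add: weak_gradient_def mult.assoc)

lemma weak_gradient_cong_AE:
  assumes \<Omega>: "open \<Omega>" and f: "square_integrable \<Omega> f" "square_integrable \<Omega> f'"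
    and ae: "AE x in lebesgue_on \<Omega>. f' x = f x" and G: "weak_gradient \<Omega> f G"
  shows "weak_gradient \<Omega> f' G"
proof -
  have "(\<integral>x. f' x * partial_deriv k \<phi> x \<partial>lebesgue_on \<Omega>) = (\<integral>x. f x * partial_deriv k \<phi> x \<partial>lebesgue_on \<Omega>)"
    if \<phi>: "\<phi> \<in> test_functions \<Omega>" for \<phi> k
  proof (rule integral_cong_AE)
    have "square_integrable \<Omega> (partial_deriv k \<phi>)"
      using test_function_square_integrable(2)[OF \<phi>] \<Omega> by simp
    then show "(\<lambda>x. f' x * partial_deriv k \<phi> x) \<in> borel_measurable (lebesgue_on \<Omega>)"
      "(\<lambda>x. f x * partial_deriv k \<phi> x) \<in> borel_measurable (lebesgue_on \<Omega>)"
      using f by (auto simp: square_integrable_def intro!: borel_measurable_times)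
    show "AE x in lebesgue_on \<Omega>. f' x * partial_deriv k \<phi> x = f x * partial_deriv k \<phi> x"
      using ae by eventually_elim simp
  qed
  then show ?thesis using G by (simp add: weak_gradient_def)
qed

text \<open>This makes \<open>grad\<close> additive and homogeneous almost everywhere, although it
  is defined by an arbitrary choice.\<close>

lemma weak_gradient_unique:
  assumes \<Omega>: "open \<Omega>" and f: "square_integrable \<Omega> f"
    and G: "weak_gradient \<Omega> f G" "weak_gradient \<Omega> f G'"
  shows "AE x in lebesgue_on \<Omega>. G x = G' x"
proof -
  have sq: "square_integrable \<Omega> G" "square_integrable \<Omega> G'" using G by (auto simp: weak_gradient_def)
  have "AE x in lebesgue_on \<Omega>. G x $ k + (-1) * G' x $ k = 0" for k
  proof (rule fundamental_lemma[OF \<Omega>])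
    show "square_integrable \<Omega> (\<lambda>x. G x $ k + (-1) * G' x $ k)"
      by (intro square_integrable_add square_integrable_scale square_integrable_component sq)
    fix \<phi> assume \<phi>: "\<phi> \<in> test_functions \<Omega>"
    note int = weak_gradient_integrable(2)[OF \<Omega> f sq(1) \<phi>, of k] weak_gradient_integrable(2)[OF \<Omega> f sq(2) \<phi>, of k]
    have "(\<integral>x. (G x $ k + (-1) * G' x $ k) * \<phi> x \<partial>lebesgue_on \<Omega>)
        = (\<integral>x. G x $ k * \<phi> x - G' x $ k * \<phi> x \<partial>lebesgue_on \<Omega>)"
      by (simp add: left_diff_distrib)
    also have "\<dots> = (\<integral>x. G x $ k * \<phi> x \<partial>lebesgue_on \<Omega>) - (\<integral>x. G' x $ k * \<phi> x \<partial>lebesgue_on \<Omega>)"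
      by (rule Bochner_Integration.integral_diff[OF int])
    also have "\<dots> = 0"
      using G \<phi> unfolding weak_gradient_def by (metis (no_types, lifting) neg_equal_iff_equal right_minus_eq)
    finally show "(\<integral>x. (G x $ k + (-1) * G' x $ k) * \<phi> x \<partial>lebesgue_on \<Omega>) = 0" .
  qed
  then have "AE x in lebesgue_on \<Omega>. \<forall>k\<in>UNIV. G x $ k + (-1) * G' x $ k = 0"
    by (intro AE_finite_allI) auto
  then show ?thesis by eventually_elim (simp add: vec_eq_iff)
qed

lemma integral_mult_tendsto:
  fixes f :: "nat \<Rightarrow> real ^ 'n \<Rightarrow> complex"
  assumes f: "\<And>n. square_integrable \<Omega> (f n)" "square_integrable \<Omega> g" "square_integrable \<Omega> \<psi>"
    and lim: "(\<lambda>n. \<integral>x. (norm (f n x - g x))\<^sup>2 \<partial>lebesgue_on \<Omega>) \<longlonglongrightarrow> 0"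
  shows "(\<lambda>n. \<integral>x. f n x * \<psi> x \<partial>lebesgue_on \<Omega>) \<longlonglongrightarrow> (\<integral>x. g x * \<psi> x \<partial>lebesgue_on \<Omega>)"
proof -
  let ?I = "\<lambda>n. \<integral>x. (norm (f n x - g x))\<^sup>2 \<partial>lebesgue_on \<Omega>"
    and ?P = "\<integral>x. (norm (\<psi> x))\<^sup>2 \<partial>lebesgue_on \<Omega>"
  have diff: "square_integrable \<Omega> (\<lambda>x. f n x - g x)" for n
    using square_integrable_add[OF f(1) square_integrable_scale[OF f(2), of "-1"], of n] by simp
  have bound: "cmod ((\<integral>x. f n x * \<psi> x \<partial>lebesgue_on \<Omega>) - (\<integral>x. g x * \<psi> x \<partial>lebesgue_on \<Omega>)) \<le> sqrt (?I n * ?P)" for n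
  proof -
    have "(\<integral>x. f n x * \<psi> x \<partial>lebesgue_on \<Omega>) - (\<integral>x. g x * \<psi> x \<partial>lebesgue_on \<Omega>)
        = (\<integral>x. (f n x - g x) * \<psi> x \<partial>lebesgue_on \<Omega>)"
      using square_integrable_mult[OF f(1) f(3)] square_integrable_mult[OF f(2) f(3)]
      by (simp add: left_diff_distrib)
    also have "cmod \<dots> \<le> (\<integral>x. norm (f n x - g x) * norm (\<psi> x) \<partial>lebesgue_on \<Omega>)"
      using integral_norm_bound[of "lebesgue_on \<Omega>" "\<lambda>x. (f n x - g x) * \<psi> x"] by (simp add: norm_mult)
    also have "\<dots> \<le> sqrt (?I n * ?P)"
      by (rule real_le_rsqrt, rule integral_cauchy_schwarz)
        (use diff f(3) in \<open>auto simp: square_integrable_def\<close>)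
    finally show ?thesis .
  qed
  have "(\<lambda>n. sqrt (?I n * ?P)) \<longlonglongrightarrow> sqrt (0 * ?P)" by (intro tendsto_intros lim)
  then have "(\<lambda>n. sqrt (?I n * ?P)) \<longlonglongrightarrow> 0" by simp
  then have "(\<lambda>n. (\<integral>x. f n x * \<psi> x \<partial>lebesgue_on \<Omega>) - (\<integral>x. g x * \<psi> x \<partial>lebesgue_on \<Omega>)) \<longlonglongrightarrow> 0"
    by (rule Lim_null_comparison[rotated]) (use bound in auto)
  then show ?thesis by (simp add: LIM_zero_iff)
qed

text \<open>For a fixed test function both sides of the defining identity are continuous for
  convergence in mean square. This closedness is the source of completeness of
  \<open>W12\<close>.\<close>

lemma weak_gradient_closed:
  assumes \<Omega>: "open \<Omega>" and f: "\<And>n. square_integrable \<Omega> (f n)" "square_integrable \<Omega> g"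
    and G: "\<And>n. weak_gradient \<Omega> (f n) (G n)" "square_integrable \<Omega> H"
    and lim: "(\<lambda>n. \<integral>x. (norm (f n x - g x))\<^sup>2 \<partial>lebesgue_on \<Omega>) \<longlonglongrightarrow> 0"
      "(\<lambda>n. \<integral>x. (norm (G n x - H x))\<^sup>2 \<partial>lebesgue_on \<Omega>) \<longlonglongrightarrow> 0"
  shows "weak_gradient \<Omega> g H"
  unfolding weak_gradient_def
proof (intro conjI ballI allI G(2))
  have sq: "square_integrable \<Omega> (G n)" for n using G by (auto simp: weak_gradient_def)
  fix \<phi> k assume \<phi>: "\<phi> \<in> test_functions \<Omega>"
  note test = test_function_square_integrable[OF \<phi>]
  have 1: "(\<lambda>n. \<integral>x. f n x * partial_deriv k \<phi> x \<partial>lebesgue_on \<Omega>)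
      \<longlonglongrightarrow> (\<integral>x. g x * partial_deriv k \<phi> x \<partial>lebesgue_on \<Omega>)"
    using \<Omega> by (intro integral_mult_tendsto f lim test) simp
  have "(\<lambda>n. \<integral>x. G n x $ k * \<phi> x \<partial>lebesgue_on \<Omega>) \<longlonglongrightarrow> (\<integral>x. H x $ k * \<phi> x \<partial>lebesgue_on \<Omega>)"
  proof (intro integral_mult_tendsto square_integrable_component sq G(2) test)
    show "\<Omega> \<in> sets lebesgue" using \<Omega> by simp
    show "(\<lambda>n. \<integral>x. (norm (G n x $ k - H x $ k))\<^sup>2 \<partial>lebesgue_on \<Omega>) \<longlonglongrightarrow> 0"
    proof (rule tendsto_sandwich[OF _ _ tendsto_const lim(2)])
      have int: "integrable (lebesgue_on \<Omega>) (\<lambda>x. (norm (G n x - H x))\<^sup>2)" for n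
        using sq G(2) unfolding square_integrable_def by (intro integrable_norm_diff_sq) auto
      have "(\<integral>x. (norm (G n x $ k - H x $ k))\<^sup>2 \<partial>lebesgue_on \<Omega>) \<le> (\<integral>x. (norm (G n x - H x))\<^sup>2 \<partial>lebesgue_on \<Omega>)" for n
        using Finite_Cartesian_Product.norm_nth_le[of "G n _ - H _" k]
        by (intro integral_mono'[OF int]) (auto intro!: power_mono)
      then show "\<forall>\<^sub>F n in sequentially. (\<integral>x. (norm (G n x $ k - H x $ k))\<^sup>2 \<partial>lebesgue_on \<Omega>)
          \<le> (\<integral>x. (norm (G n x - H x))\<^sup>2 \<partial>lebesgue_on \<Omega>)" by simp
    qed simp
  qed
  then have 2: "(\<lambda>n. - (\<integral>x. G n x $ k * \<phi> x \<partial>lebesgue_on \<Omega>)) \<longlonglongrightarrow> - (\<integral>x. H x $ k * \<phi> x \<partial>lebesgue_on \<Omega>)"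
    by (rule tendsto_minus)
  have "(\<integral>x. f n x * partial_deriv k \<phi> x \<partial>lebesgue_on \<Omega>) = - (\<integral>x. G n x $ k * \<phi> x \<partial>lebesgue_on \<Omega>)" for n
    using G(1) \<phi> unfolding weak_gradient_def by blast
  then show "(\<integral>x. g x * partial_deriv k \<phi> x \<partial>lebesgue_on \<Omega>) = - (\<integral>x. H x $ k * \<phi> x \<partial>lebesgue_on \<Omega>)"
    using LIMSEQ_unique[OF 1] 2 by simp
qed

section \<open>The Hilbert spaces\<close>

lemma rep_L2_class:
  assumes "square_integrable \<Omega> f"
  shows "square_integrable \<Omega> (rep (L2_class \<Omega> f))" "AE x in lebesgue_on \<Omega>. rep (L2_class \<Omega> f) x = f x"
proof -
  have "f \<in> L2_class \<Omega> f" using assms by (simp add: L2_class_def)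
  then have "rep (L2_class \<Omega> f) \<in> L2_class \<Omega> f" unfolding rep_def by (rule someI[of "\<lambda>g. g \<in> L2_class \<Omega> f"])
  then show "square_integrable \<Omega> (rep (L2_class \<Omega> f))" "AE x in lebesgue_on \<Omega>. rep (L2_class \<Omega> f) x = f x"
    by (auto simp: L2_class_def)
qed

lemma L2_class_cong:
  assumes "AE x in lebesgue_on \<Omega>. f x = g x"
  shows "L2_class \<Omega> f = L2_class \<Omega> g"
proof -
  have "(AE x in lebesgue_on \<Omega>. h x = f x) \<longleftrightarrow> (AE x in lebesgue_on \<Omega>. h x = g x)" for h
  proof
    assume "AE x in lebesgue_on \<Omega>. h x = f x"
    then show "AE x in lebesgue_on \<Omega>. h x = g x" using assms by eventually_elim simp
  next
    assume "AE x in lebesgue_on \<Omega>. h x = g x"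
    then show "AE x in lebesgue_on \<Omega>. h x = f x" using assms by eventually_elim simp
  qed
  then show ?thesis by (simp add: L2_class_def)
qed

lemma L2_class_mem: "square_integrable \<Omega> f \<Longrightarrow> L2_class \<Omega> f \<in> elems (L2 \<Omega>)"
  by (simp add: L2_def)

lemma rep_square_integrable: "u \<in> elems (L2 \<Omega>) \<Longrightarrow> square_integrable \<Omega> (rep u)"
  using rep_L2_class by (auto simp: L2_def)

lemma L2_class_rep: "u \<in> elems (L2 \<Omega>) \<Longrightarrow> L2_class \<Omega> (rep u) = u"
  using L2_class_cong[OF rep_L2_class(2)] by (auto simp: L2_def)

lemma L2_eqI:
  assumes "u \<in> elems (L2 \<Omega>)" "v \<in> elems (L2 \<Omega>)" "AE x in lebesgue_on \<Omega>. rep u x = rep v x"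
  shows "u = v"
  using assms L2_class_rep L2_class_cong by metis

lemma L2_add:
  assumes "u \<in> elems (L2 \<Omega>)" "v \<in> elems (L2 \<Omega>)"
  shows "add (L2 \<Omega>) u v \<in> elems (L2 \<Omega>)"
    "AE x in lebesgue_on \<Omega>. rep (add (L2 \<Omega>) u v) x = rep u x + rep v x"
proof -
  have sq: "square_integrable \<Omega> (\<lambda>x. rep u x + rep v x)"
    using assms by (intro square_integrable_add rep_square_integrable)
  have eq: "add (L2 \<Omega>) u v = L2_class \<Omega> (\<lambda>x. rep u x + rep v x)" by (simp add: L2_def)
  show "add (L2 \<Omega>) u v \<in> elems (L2 \<Omega>)" unfolding eq by (rule L2_class_mem[OF sq])
  show "AE x in lebesgue_on \<Omega>. rep (add (L2 \<Omega>) u v) x = rep u x + rep v x"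
    unfolding eq by (rule rep_L2_class(2)[OF sq])
qed

lemma L2_scale:
  assumes "u \<in> elems (L2 \<Omega>)"
  shows "scale (L2 \<Omega>) c u \<in> elems (L2 \<Omega>)"
    "AE x in lebesgue_on \<Omega>. rep (scale (L2 \<Omega>) c u) x = c * rep u x"
proof -
  have sq: "square_integrable \<Omega> (\<lambda>x. c * rep u x)"
    using assms by (intro square_integrable_scale rep_square_integrable)
  have eq: "scale (L2 \<Omega>) c u = L2_class \<Omega> (\<lambda>x. c * rep u x)" by (simp add: L2_def)
  show "scale (L2 \<Omega>) c u \<in> elems (L2 \<Omega>)" unfolding eq by (rule L2_class_mem[OF sq])
  show "AE x in lebesgue_on \<Omega>. rep (scale (L2 \<Omega>) c u) x = c * rep u x"
    unfolding eq by (rule rep_L2_class(2)[OF sq])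
qed

text \<open>Reading the gradient part of the product as the elliptic form of the identity matrix
  lets the results on \<open>bounded_coefficient\<close> serve \<open>W12\<close> as well.\<close>

lemma W12_simps:
  "u \<in> elems (W12 \<Omega>) \<longleftrightarrow> u \<in> elems (L2 \<Omega>) \<and> (\<exists>G. weak_gradient \<Omega> (rep u) G)"
  "add (W12 \<Omega>) = add (L2 \<Omega>)" "scale (W12 \<Omega>) = scale (L2 \<Omega>)"
  "ip (W12 \<Omega>) u v = ip (L2 \<Omega>) u v + elliptic_form \<Omega> (\<lambda>_. mat 1) u v"
  by (simp_all add: W12_def elliptic_form_def)

lemma grad_weak_gradient: "u \<in> elems (W12 \<Omega>) \<Longrightarrow> weak_gradient \<Omega> (rep u) (grad \<Omega> u)"
  unfolding grad_def W12_simps using someI_ex[of "weak_gradient \<Omega> (rep u)"] by blast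

lemma grad_square_integrable: "u \<in> elems (W12 \<Omega>) \<Longrightarrow> square_integrable \<Omega> (grad \<Omega> u)"
  using grad_weak_gradient unfolding weak_gradient_def by blast

text \<open>It transfers a known function with a known weak gradient to the arbitrary choices
  \<open>rep u\<close> and \<open>grad \<Omega> u\<close>.\<close>

lemma W12_memI:
  assumes \<Omega>: "open \<Omega>" and u: "u \<in> elems (L2 \<Omega>)" and f: "square_integrable \<Omega> f"
    and G: "weak_gradient \<Omega> f G" and ae: "AE x in lebesgue_on \<Omega>. rep u x = f x"
  shows "u \<in> elems (W12 \<Omega>)" "AE x in lebesgue_on \<Omega>. grad \<Omega> u x = G x"
proof -
  have wg: "weak_gradient \<Omega> (rep u) G"
    by (rule weak_gradient_cong_AE[OF \<Omega> f rep_square_integrable[OF u] ae G])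
  then show 1: "u \<in> elems (W12 \<Omega>)" using u W12_simps(1) by blast
  show "AE x in lebesgue_on \<Omega>. grad \<Omega> u x = G x"
    by (rule weak_gradient_unique[OF \<Omega> rep_square_integrable[OF u] grad_weak_gradient[OF 1] wg])
qed

lemma W12_add:
  assumes \<Omega>: "open \<Omega>" and uv: "u \<in> elems (W12 \<Omega>)" "v \<in> elems (W12 \<Omega>)"
  shows "add (L2 \<Omega>) u v \<in> elems (W12 \<Omega>)"
    "AE x in lebesgue_on \<Omega>. grad \<Omega> (add (L2 \<Omega>) u v) x = grad \<Omega> u x + grad \<Omega> v x"
proof -
  have L: "u \<in> elems (L2 \<Omega>)" "v \<in> elems (L2 \<Omega>)" using uv W12_simps(1) by blast+
  note sq = rep_square_integrable[OF L(1)] rep_square_integrable[OF L(2)]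
  note * = W12_memI[OF \<Omega> L2_add(1)[OF L] square_integrable_add[OF sq]
      weak_gradient_add[OF \<Omega> sq grad_weak_gradient[OF uv(1)] grad_weak_gradient[OF uv(2)]] L2_add(2)[OF L]]
  show "add (L2 \<Omega>) u v \<in> elems (W12 \<Omega>)" by (rule *(1))
  show "AE x in lebesgue_on \<Omega>. grad \<Omega> (add (L2 \<Omega>) u v) x = grad \<Omega> u x + grad \<Omega> v x" by (rule *(2))
qed

lemma W12_scale:
  assumes \<Omega>: "open \<Omega>" and u: "u \<in> elems (W12 \<Omega>)"
  shows "scale (L2 \<Omega>) c u \<in> elems (W12 \<Omega>)"
    "AE x in lebesgue_on \<Omega>. grad \<Omega> (scale (L2 \<Omega>) c u) x = c *s grad \<Omega> u x"
proof -
  have L: "u \<in> elems (L2 \<Omega>)" using u W12_simps(1) by blast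
  note sq = rep_square_integrable[OF L]
  note * = W12_memI[OF \<Omega> L2_scale(1)[OF L] square_integrable_scale[OF sq]
      weak_gradient_scale[OF grad_weak_gradient[OF u]] L2_scale(2)[OF L]]
  show "scale (L2 \<Omega>) c u \<in> elems (W12 \<Omega>)" by (rule *(1))
  show "AE x in lebesgue_on \<Omega>. grad \<Omega> (scale (L2 \<Omega>) c u) x = c *s grad \<Omega> u x" by (rule *(2))
qed

text \<open>Operations on classes agree with pointwise operations only almost everywhere, which the
  integral does not see. The map \<open>X\<close> will be \<open>rep\<close> or
  \<open>grad \<Omega>\<close>, and \<open>s\<close> the scaling of complex numbers or of
  vectors.\<close>

lemma sesq_integral:
  fixes add :: "'u \<Rightarrow> 'u \<Rightarrow> 'u" and sc :: "complex \<Rightarrow> 'u \<Rightarrow> 'u"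
    and X :: "'u \<Rightarrow> 'x \<Rightarrow> 'e::ab_group_add" and \<beta> :: "'x \<Rightarrow> 'e \<Rightarrow> 'e \<Rightarrow> complex"
  assumes closed: "sesq_ops.lin_closed add sc V"
    and int: "\<And>u v. u \<in> V \<Longrightarrow> v \<in> V \<Longrightarrow> integrable M (\<lambda>x. \<beta> x (X u x) (X v x))"
    and add: "\<And>u v. u \<in> V \<Longrightarrow> v \<in> V \<Longrightarrow> AE x in M. X (add u v) x = X u x + X v x"
    and sc: "\<And>c u. u \<in> V \<Longrightarrow> AE x in M. X (sc c u) x = s c (X u x)"
    and \<beta>: "\<And>x p q r. \<beta> x (p + q) r = \<beta> x p r + \<beta> x q r" "\<And>x p q r. \<beta> x r (p + q) = \<beta> x r p + \<beta> x r q"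
      "\<And>x c p q. \<beta> x (s c p) q = c * \<beta> x p q" "\<And>x c p q. \<beta> x q (s c p) = cnj c * \<beta> x q p"
  shows "sesq_ops.sesq add sc V (\<lambda>u v. \<integral>x. \<beta> x (X u x) (X v x) \<partial>M)"
proof -
  interpret sesq_ops add sc .
  note lin = lin_closedD[OF closed]
  note meas = borel_measurable_integrable[OF int]
  show ?thesis
  proof (rule sesqI)
    fix u v w assume u: "u \<in> V" and v: "v \<in> V" and w: "w \<in> V"
    have "(\<integral>x. \<beta> x (X (add u v) x) (X w x) \<partial>M) = (\<integral>x. \<beta> x (X u x) (X w x) + \<beta> x (X v x) (X w x) \<partial>M)"
    proof (rule integral_cong_AE)
      show "AE x in M. \<beta> x (X (add u v) x) (X w x) = \<beta> x (X u x) (X w x) + \<beta> x (X v x) (X w x)"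
        using add[OF u v] by eventually_elim (simp add: \<beta>)
    qed (intro meas borel_measurable_add lin u v w)+
    then show "(\<integral>x. \<beta> x (X (add u v) x) (X w x) \<partial>M)
        = (\<integral>x. \<beta> x (X u x) (X w x) \<partial>M) + (\<integral>x. \<beta> x (X v x) (X w x) \<partial>M)"
      using int[OF u w] int[OF v w] by simp
    have "(\<integral>x. \<beta> x (X w x) (X (add u v) x) \<partial>M) = (\<integral>x. \<beta> x (X w x) (X u x) + \<beta> x (X w x) (X v x) \<partial>M)"
    proof (rule integral_cong_AE)
      show "AE x in M. \<beta> x (X w x) (X (add u v) x) = \<beta> x (X w x) (X u x) + \<beta> x (X w x) (X v x)"
        using add[OF u v] by eventually_elim (simp add: \<beta>)
    qed (intro meas borel_measurable_add lin u v w)+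
    then show "(\<integral>x. \<beta> x (X w x) (X (add u v) x) \<partial>M)
        = (\<integral>x. \<beta> x (X w x) (X u x) \<partial>M) + (\<integral>x. \<beta> x (X w x) (X v x) \<partial>M)"
      using int[OF w u] int[OF w v] by simp
  next
    fix c u v assume u: "u \<in> V" and v: "v \<in> V"
    have "(\<integral>x. \<beta> x (X (sc c u) x) (X v x) \<partial>M) = (\<integral>x. c * \<beta> x (X u x) (X v x) \<partial>M)"
    proof (rule integral_cong_AE)
      show "AE x in M. \<beta> x (X (sc c u) x) (X v x) = c * \<beta> x (X u x) (X v x)"
        using sc[OF u, of c] by eventually_elim (simp add: \<beta>)
    qed (intro meas borel_measurable_times borel_measurable_const lin u v)+
    then show "(\<integral>x. \<beta> x (X (sc c u) x) (X v x) \<partial>M) = c * (\<integral>x. \<beta> x (X u x) (X v x) \<partial>M)" by simp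
    have "(\<integral>x. \<beta> x (X v x) (X (sc c u) x) \<partial>M) = (\<integral>x. cnj c * \<beta> x (X v x) (X u x) \<partial>M)"
    proof (rule integral_cong_AE)
      show "AE x in M. \<beta> x (X v x) (X (sc c u) x) = cnj c * \<beta> x (X v x) (X u x)"
        using sc[OF u, of c] by eventually_elim (simp add: \<beta>)
    qed (intro meas borel_measurable_times borel_measurable_const lin u v)+
    then show "(\<integral>x. \<beta> x (X v x) (X (sc c u) x) \<partial>M) = cnj c * (\<integral>x. \<beta> x (X v x) (X u x) \<partial>M)" by simp
  qed
qed

lemma L2_lin_closed:
  fixes \<Omega> :: "(real ^ 'n) set"
  shows "sesq_ops.lin_closed (add (L2 \<Omega>)) (scale (L2 \<Omega>)) (elems (L2 \<Omega>))"
proof -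
  have "square_integrable \<Omega> (\<lambda>_. 0 :: complex)" by (simp add: square_integrable_def)
  then have "elems (L2 \<Omega>) \<noteq> {}" using L2_class_mem by blast
  then show ?thesis by (simp add: sesq_ops.lin_closed_def L2_add L2_scale)
qed

lemma L2_ip: "ip (L2 \<Omega>) u v = (\<integral>x. rep u x * cnj (rep v x) \<partial>lebesgue_on \<Omega>)"
  by (simp add: L2_def)

lemma square_integrable_cnj:
  fixes f :: "real ^ 'n \<Rightarrow> complex"
  assumes "square_integrable \<Omega> f"
  shows "square_integrable \<Omega> (\<lambda>x. cnj (f x))"
proof -
  have "(\<lambda>x. cnj (f x)) \<in> borel_measurable (lebesgue_on \<Omega>)"
    using measurable_compose[OF square_integrable_meas[OF assms] borel_measurable_continuous_onI[of cnj]]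
    by (simp add: continuous_intros)
  then show ?thesis using square_integrable_int[OF assms] by (simp add: square_integrable_def)
qed

lemma L2_ip_diag: "Re (ip (L2 \<Omega>) u u) = (\<integral>x. (cmod (rep u x))\<^sup>2 \<partial>lebesgue_on \<Omega>)"
proof -
  have "ip (L2 \<Omega>) u u = (\<integral>x. complex_of_real ((cmod (rep u x))\<^sup>2) \<partial>lebesgue_on \<Omega>)"
    unfolding L2_ip complex_norm_square ..
  also have "\<dots> = complex_of_real (\<integral>x. (cmod (rep u x))\<^sup>2 \<partial>lebesgue_on \<Omega>)"
    by (rule integral_complex_of_real)
  finally show ?thesis by (simp only: Re_complex_of_real)
qed

lemma L2_herm_pos:
  fixes \<Omega> :: "(real ^ 'n) set"
  shows "sesq_ops.herm_pos (add (L2 \<Omega>)) (scale (L2 \<Omega>)) (elems (L2 \<Omega>)) (ip (L2 \<Omega>))"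
proof -
  interpret sesq_ops "add (L2 \<Omega>)" "scale (L2 \<Omega>)" .
  have "sesq (elems (L2 \<Omega>)) (ip (L2 \<Omega>))"
    unfolding L2_ip[abs_def]
  proof (rule sesq_integral[OF L2_lin_closed, where s = "(*)"])
    show "integrable (lebesgue_on \<Omega>) (\<lambda>x. rep u x * cnj (rep v x))"
      if "u \<in> elems (L2 \<Omega>)" "v \<in> elems (L2 \<Omega>)" for u v
      using that by (intro square_integrable_mult square_integrable_cnj rep_square_integrable)
  qed (auto simp: L2_add L2_scale algebra_simps)
  moreover have "ip (L2 \<Omega>) v u = cnj (ip (L2 \<Omega>) u v)" for u v
    unfolding L2_ip Bochner_Integration.integral_cnj[symmetric]
    by (intro Bochner_Integration.integral_cong) (auto simp: mult.commute)
  moreover have "0 \<le> Re (ip (L2 \<Omega>) u u)" for u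
    unfolding L2_ip_diag by simp
  ultimately show ?thesis unfolding herm_pos_def by blast
qed

text \<open>The bridge from values of forms back to equality of vectors.\<close>

lemma L2_zero_imp_eq:
  assumes u: "u \<in> elems (L2 \<Omega>)" "v \<in> elems (L2 \<Omega>)"
    and "Re (ip (L2 \<Omega>) (add (L2 \<Omega>) u (scale (L2 \<Omega>) (-1) v)) (add (L2 \<Omega>) u (scale (L2 \<Omega>) (-1) v))) = 0"
  shows "u = v"
proof -
  let ?w = "add (L2 \<Omega>) u (scale (L2 \<Omega>) (-1) v)"
  have w: "?w \<in> elems (L2 \<Omega>)" using u by (simp add: L2_add L2_scale)
  have "AE x in lebesgue_on \<Omega>. (cmod (rep ?w x))\<^sup>2 = 0"
    using assms(3) square_integrable_int[OF rep_square_integrable[OF w]] unfolding L2_ip_diag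
    by (subst (asm) integral_nonneg_eq_0_iff_AE) auto
  moreover have "AE x in lebesgue_on \<Omega>. rep ?w x = rep u x + rep (scale (L2 \<Omega>) (-1) v) x"
    using u by (intro L2_add L2_scale)
  moreover have "AE x in lebesgue_on \<Omega>. rep (scale (L2 \<Omega>) (-1) v) x = -1 * rep v x"
    by (rule L2_scale[OF u(2)])
  ultimately have "AE x in lebesgue_on \<Omega>. rep u x = rep v x" by eventually_elim simp
  then show ?thesis by (rule L2_eqI[OF u])
qed

lemma W12_lin_closed:
  fixes \<Omega> :: "(real ^ 'n::finite) set"
  assumes "open \<Omega>"
  shows "sesq_ops.lin_closed (add (L2 \<Omega>)) (scale (L2 \<Omega>)) (elems (W12 \<Omega>))"
proof -
  have sq: "square_integrable \<Omega> (\<lambda>_. 0 :: complex)" by (simp add: square_integrable_def)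
  have "weak_gradient \<Omega> (\<lambda>_. 0) (\<lambda>_. 0)" by (simp add: weak_gradient_def square_integrable_def)
  then have "L2_class \<Omega> (\<lambda>_. 0) \<in> elems (W12 \<Omega>)"
    by (rule W12_memI(1)[OF assms L2_class_mem[OF sq] sq _ rep_L2_class(2)[OF sq]])
  then have "elems (W12 \<Omega>) \<noteq> {}" by blast
  then show ?thesis using W12_add[OF assms] W12_scale[OF assms] by (simp add: sesq_ops.lin_closed_def)
qed

section \<open>The elliptic form: sesquilinearity, bound and coercivity\<close>

lemma cdot_vcnj_norm: "cmod (cdot \<xi> (vcnj \<eta>)) \<le> norm \<xi> * norm \<eta>"
proof -
  have "cmod (cdot \<xi> (vcnj \<eta>)) \<le> (\<Sum>k\<in>UNIV. cmod (\<xi> $ k) * cmod (\<eta> $ k))"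
    unfolding cdot_def vcnj_def by (rule order_trans[OF norm_sum]) (simp add: norm_mult)
  also have "\<dots> \<le> L2_set (\<lambda>k. cmod (\<xi> $ k)) UNIV * L2_set (\<lambda>k. cmod (\<eta> $ k)) UNIV"
    using L2_set_mult_ineq[of "\<lambda>k. cmod (\<xi> $ k)" "\<lambda>k. cmod (\<eta> $ k)" UNIV] by simp
  finally show ?thesis by (simp add: norm_vec_def)
qed

lemma cdot_vcnj_self: "cdot \<xi> (vcnj \<xi>) = of_real ((norm \<xi>)\<^sup>2)"
proof -
  have "(norm \<xi>)\<^sup>2 = (\<Sum>k\<in>UNIV. (cmod (\<xi> $ k))\<^sup>2)"
    by (simp add: norm_vec_def L2_set_def sum_nonneg)
  then show ?thesis
    by (simp only: cdot_def vcnj_def vec_lambda_beta of_real_sum complex_norm_square)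
qed

lemma cdot_sesquilinear:
  "cdot (A *v (p + q)) (vcnj r) = cdot (A *v p) (vcnj r) + cdot (A *v q) (vcnj r)"
  "cdot (A *v r) (vcnj (p + q)) = cdot (A *v r) (vcnj p) + cdot (A *v r) (vcnj q)"
  "cdot (A *v (c *s p)) (vcnj q) = c * cdot (A *v p) (vcnj q)"
  "cdot (A *v q) (vcnj (c *s p)) = cnj c * cdot (A *v q) (vcnj p)"
  by (simp_all add: matrix_vector_right_distrib vector_scalar_commute cdot_def vcnj_def
      sum.distrib sum_distrib_left algebra_simps)

lemma elliptic_integrand_measurable:
  fixes \<mu> :: "'x \<Rightarrow> complex ^ 'n::finite ^ 'n"
  assumes "\<mu> \<in> borel_measurable M" "G \<in> borel_measurable M" "G' \<in> borel_measurable M"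
  shows "(\<lambda>x. cdot (\<mu> x *v G x) (vcnj (G' x))) \<in> borel_measurable M"
proof -
  have cnj: "cnj \<in> borel_measurable borel"
    by (intro borel_measurable_continuous_onI continuous_intros)
  show ?thesis
    unfolding cdot_def vcnj_def matrix_vector_mult_def vec_lambda_beta
    by (intro borel_measurable_sum borel_measurable_times measurable_vec_nth assms
        measurable_compose[OF _ cnj])
qed

text \<open>It is used for \<open>\<mu>\<close> with \<open>K\<close> the essential supremum, which
  bounds only almost everywhere, and for the identity matrix with \<open>K = 1\<close>.\<close>

locale bounded_coefficient =
  fixes \<Omega> :: "(real ^ 'n::finite) set" and \<mu> :: "real ^ 'n \<Rightarrow> complex ^ 'n ^ 'n" and K :: real
  assumes open_domain: "open \<Omega>" and meas: "\<mu> \<in> borel_measurable (lebesgue_on \<Omega>)" and K: "0 \<le> K"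
    and bound: "AE x in lebesgue_on \<Omega>. \<forall>\<xi>. norm (\<mu> x *v \<xi>) \<le> K * norm \<xi>"
begin

lemma integrand_bound:
  "AE x in lebesgue_on \<Omega>. cmod (cdot (\<mu> x *v G x) (vcnj (G' x))) \<le> K * (norm (G x) * norm (G' x))"
  using bound
proof eventually_elim
  fix x assume "\<forall>\<xi>. norm (\<mu> x *v \<xi>) \<le> K * norm \<xi>"
  then have "norm (\<mu> x *v G x) * norm (G' x) \<le> K * norm (G x) * norm (G' x)"
    by (intro mult_right_mono) auto
  then show "cmod (cdot (\<mu> x *v G x) (vcnj (G' x))) \<le> K * (norm (G x) * norm (G' x))"
    using cdot_vcnj_norm[of "\<mu> x *v G x" "G' x"] by simp
qed

lemma norm_product_integrable:
  assumes "u \<in> elems (W12 \<Omega>)" "v \<in> elems (W12 \<Omega>)"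
  shows "integrable (lebesgue_on \<Omega>) (\<lambda>x. norm (grad \<Omega> u x) * norm (grad \<Omega> v x))"
  using grad_square_integrable[OF assms(1)] grad_square_integrable[OF assms(2)]
  unfolding square_integrable_def by (intro integrable_norm_mult) auto

lemma integrand_integrable:
  assumes "u \<in> elems (W12 \<Omega>)" "v \<in> elems (W12 \<Omega>)"
  shows "integrable (lebesgue_on \<Omega>) (\<lambda>x. cdot (\<mu> x *v grad \<Omega> u x) (vcnj (grad \<Omega> v x)))"
proof (rule Bochner_Integration.integrable_bound)
  show "integrable (lebesgue_on \<Omega>) (\<lambda>x. K * (norm (grad \<Omega> u x) * norm (grad \<Omega> v x)))"
    using norm_product_integrable[OF assms] by simp
  show "(\<lambda>x. cdot (\<mu> x *v grad \<Omega> u x) (vcnj (grad \<Omega> v x))) \<in> borel_measurable (lebesgue_on \<Omega>)"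
    using assms by (intro elliptic_integrand_measurable meas square_integrable_meas grad_square_integrable)
  show "AE x in lebesgue_on \<Omega>. norm (cdot (\<mu> x *v grad \<Omega> u x) (vcnj (grad \<Omega> v x)))
      \<le> norm (K * (norm (grad \<Omega> u x) * norm (grad \<Omega> v x)))"
    using integrand_bound[of "grad \<Omega> u" "grad \<Omega> v"] by eventually_elim (use K in \<open>simp add: abs_mult\<close>)
qed

lemma form_sesq:
  "sesq_ops.sesq (add (L2 \<Omega>)) (scale (L2 \<Omega>)) (elems (W12 \<Omega>)) (elliptic_form \<Omega> \<mu>)"
  unfolding elliptic_form_def[abs_def]
  using W12_add(2)[OF open_domain] W12_scale(2)[OF open_domain] integrand_integrable
  by (intro sesq_integral[OF W12_lin_closed[OF open_domain], where s = "(*s)"])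
    (auto simp: cdot_sesquilinear)

lemma form_bound:
  assumes u: "u \<in> elems (W12 \<Omega>)" and v: "v \<in> elems (W12 \<Omega>)"
  shows "cmod (elliptic_form \<Omega> \<mu> u v)
    \<le> K * sqrt ((\<integral>x. (norm (grad \<Omega> u x))\<^sup>2 \<partial>lebesgue_on \<Omega>) * (\<integral>x. (norm (grad \<Omega> v x))\<^sup>2 \<partial>lebesgue_on \<Omega>))"
proof -
  have "cmod (elliptic_form \<Omega> \<mu> u v) \<le> (\<integral>x. cmod (cdot (\<mu> x *v grad \<Omega> u x) (vcnj (grad \<Omega> v x))) \<partial>lebesgue_on \<Omega>)"
    unfolding elliptic_form_def by (rule integral_norm_bound)
  also have "\<dots> \<le> (\<integral>x. K * (norm (grad \<Omega> u x) * norm (grad \<Omega> v x)) \<partial>lebesgue_on \<Omega>)"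
    using integrand_integrable[OF u v] norm_product_integrable[OF u v]
    by (intro integral_mono_AE integrand_bound) auto
  also have "\<dots> = K * (\<integral>x. norm (grad \<Omega> u x) * norm (grad \<Omega> v x) \<partial>lebesgue_on \<Omega>)" by simp
  also have "\<dots> \<le> K * sqrt ((\<integral>x. (norm (grad \<Omega> u x))\<^sup>2 \<partial>lebesgue_on \<Omega>) * (\<integral>x. (norm (grad \<Omega> v x))\<^sup>2 \<partial>lebesgue_on \<Omega>))"
    using grad_square_integrable[OF u] grad_square_integrable[OF v] K
    by (intro mult_left_mono real_le_rsqrt[OF integral_cauchy_schwarz]) (auto simp: square_integrable_def)
  finally show ?thesis .
qed

lemma form_coercive:
  assumes u: "u \<in> elems (W12 \<Omega>)"
    and m: "\<And>x \<xi>. x \<in> \<Omega> \<Longrightarrow> Re (cdot (\<mu> x *v \<xi>) (vcnj \<xi>)) \<ge> m * (norm \<xi>)\<^sup>2"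
  shows "m * (\<integral>x. (norm (grad \<Omega> u x))\<^sup>2 \<partial>lebesgue_on \<Omega>) \<le> Re (elliptic_form \<Omega> \<mu> u u)"
proof -
  note int = integrand_integrable[OF u u]
  have "m * (\<integral>x. (norm (grad \<Omega> u x))\<^sup>2 \<partial>lebesgue_on \<Omega>) = (\<integral>x. m * (norm (grad \<Omega> u x))\<^sup>2 \<partial>lebesgue_on \<Omega>)" by simp
  also have "\<dots> \<le> (\<integral>x. Re (cdot (\<mu> x *v grad \<Omega> u x) (vcnj (grad \<Omega> u x))) \<partial>lebesgue_on \<Omega>)"
    using square_integrable_int[OF grad_square_integrable[OF u]] m
    by (intro integral_mono integrable_Re int) auto
  also have "\<dots> = Re (elliptic_form \<Omega> \<mu> u u)"
    unfolding elliptic_form_def by (rule integral_Re[OF int])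
  finally show ?thesis .
qed

end

lemma bounded_coefficient_identity: "open \<Omega> \<Longrightarrow> bounded_coefficient \<Omega> (\<lambda>_. mat 1) 1"
  by unfold_locales auto

section \<open>Inner product and completeness of \<open>W12\<close>\<close>

lemma dirichlet_diag:
  "elliptic_form \<Omega> (\<lambda>_. mat 1) u u = of_real (\<integral>x. (norm (grad \<Omega> u x))\<^sup>2 \<partial>lebesgue_on \<Omega>)"
  unfolding elliptic_form_def matrix_vector_mul_lid cdot_vcnj_self by (rule integral_complex_of_real)

lemma W12_ip_diag:
  "Re (ip (W12 \<Omega>) u u) = (\<integral>x. (cmod (rep u x))\<^sup>2 \<partial>lebesgue_on \<Omega>) + (\<integral>x. (norm (grad \<Omega> u x))\<^sup>2 \<partial>lebesgue_on \<Omega>)"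
  unfolding W12_simps plus_complex.sel L2_ip_diag dirichlet_diag by simp

lemma W12_herm_pos:
  fixes \<Omega> :: "(real ^ 'n::finite) set"
  assumes \<Omega>: "open \<Omega>"
  shows "sesq_ops.herm_pos (add (L2 \<Omega>)) (scale (L2 \<Omega>)) (elems (W12 \<Omega>)) (ip (W12 \<Omega>))"
proof -
  interpret sesq_ops "add (L2 \<Omega>)" "scale (L2 \<Omega>)" .
  have sub: "elems (W12 \<Omega>) \<subseteq> elems (L2 \<Omega>)" using W12_simps(1) by blast
  note L = herm_pos_subset[OF L2_herm_pos sub]
  note D = bounded_coefficient.form_sesq[OF bounded_coefficient_identity[OF \<Omega>]]
  have S: "sesq (elems (W12 \<Omega>)) (ip (W12 \<Omega>))"
    unfolding W12_simps(4)[abs_def]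
    by (rule sesqI) (simp_all add: sesqD[OF herm_posD(1)[OF L]] sesqD[OF D] algebra_simps)
  have D_herm: "elliptic_form \<Omega> (\<lambda>_. mat 1) v u = cnj (elliptic_form \<Omega> (\<lambda>_. mat 1) u v)" for u v
    unfolding elliptic_form_def Bochner_Integration.integral_cnj[symmetric]
    by (intro Bochner_Integration.integral_cong) (auto simp: cdot_def vcnj_def mult.commute)
  have "ip (W12 \<Omega>) v u = cnj (ip (W12 \<Omega>) u v)" if "u \<in> elems (W12 \<Omega>)" "v \<in> elems (W12 \<Omega>)" for u v
    unfolding W12_simps(4) complex_cnj_add
    by (rule arg_cong2[where f = "(+)", OF herm_posD(2)[OF L that] D_herm])
  moreover have "0 \<le> Re (ip (W12 \<Omega>) u u)" for u
    unfolding W12_ip_diag by simp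
  ultimately show ?thesis unfolding herm_pos_def using S by blast
qed

lemma W12_diff:
  assumes \<Omega>: "open \<Omega>" and uv: "u \<in> elems (W12 \<Omega>)" "v \<in> elems (W12 \<Omega>)"
  shows "Re (ip (W12 \<Omega>) (add (L2 \<Omega>) u (scale (L2 \<Omega>) (-1) v)) (add (L2 \<Omega>) u (scale (L2 \<Omega>) (-1) v)))
    = (\<integral>x. (norm (rep u x - rep v x))\<^sup>2 \<partial>lebesgue_on \<Omega>) + (\<integral>x. (norm (grad \<Omega> u x - grad \<Omega> v x))\<^sup>2 \<partial>lebesgue_on \<Omega>)"
proof -
  let ?v = "scale (L2 \<Omega>) (-1) v"
  let ?w = "add (L2 \<Omega>) u ?v"
  have L: "u \<in> elems (L2 \<Omega>)" "v \<in> elems (L2 \<Omega>)" using uv W12_simps(1) by blast+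
  have vW: "?v \<in> elems (W12 \<Omega>)" using W12_scale[OF \<Omega>] uv by blast
  have wW: "?w \<in> elems (W12 \<Omega>)" using W12_add[OF \<Omega>] uv vW by blast
  have vL: "?v \<in> elems (L2 \<Omega>)" "?w \<in> elems (L2 \<Omega>)" using vW wW W12_simps(1) by blast+
  have 1: "(\<integral>x. (norm (rep ?w x))\<^sup>2 \<partial>lebesgue_on \<Omega>) = (\<integral>x. (norm (rep u x - rep v x))\<^sup>2 \<partial>lebesgue_on \<Omega>)"
  proof (rule integral_cong_AE)
    show "AE x in lebesgue_on \<Omega>. (norm (rep ?w x))\<^sup>2 = (norm (rep u x - rep v x))\<^sup>2"
      using L2_add(2)[OF L(1) vL(1)] L2_scale(2)[OF L(2), of "-1"] by eventually_elim simp
    have "rep z \<in> borel_measurable (lebesgue_on \<Omega>)" if "z \<in> elems (L2 \<Omega>)" for z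
      using that rep_square_integrable square_integrable_meas by blast
    then show "(\<lambda>x. (norm (rep ?w x))\<^sup>2) \<in> borel_measurable (lebesgue_on \<Omega>)"
      "(\<lambda>x. (norm (rep u x - rep v x))\<^sup>2) \<in> borel_measurable (lebesgue_on \<Omega>)"
      using L vL by simp_all
  qed
  have 2: "(\<integral>x. (norm (grad \<Omega> ?w x))\<^sup>2 \<partial>lebesgue_on \<Omega>) = (\<integral>x. (norm (grad \<Omega> u x - grad \<Omega> v x))\<^sup>2 \<partial>lebesgue_on \<Omega>)"
  proof (rule integral_cong_AE)
    show "AE x in lebesgue_on \<Omega>. (norm (grad \<Omega> ?w x))\<^sup>2 = (norm (grad \<Omega> u x - grad \<Omega> v x))\<^sup>2"
      using W12_add(2)[OF \<Omega> uv(1) vW] W12_scale(2)[OF \<Omega> uv(2), of "-1"]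
      by eventually_elim (simp add: vector_sneg_minus1[symmetric])
    have "grad \<Omega> z \<in> borel_measurable (lebesgue_on \<Omega>)" if "z \<in> elems (W12 \<Omega>)" for z
      using that grad_square_integrable square_integrable_meas by blast
    then show "(\<lambda>x. (norm (grad \<Omega> ?w x))\<^sup>2) \<in> borel_measurable (lebesgue_on \<Omega>)"
      "(\<lambda>x. (norm (grad \<Omega> u x - grad \<Omega> v x))\<^sup>2) \<in> borel_measurable (lebesgue_on \<Omega>)"
      using uv wW by simp_all
  qed
  show ?thesis unfolding W12_ip_diag 1 2 ..
qed

text \<open>Functions and gradients are separately Cauchy in mean square, and closedness of the weak
  gradient identifies the limit of the gradients.\<close>

lemma W12_complete:
  fixes \<Omega> :: "(real ^ 'n::finite) set"
  assumes \<Omega>: "open \<Omega>"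
  shows "sesq_ops.complete_wrt (add (L2 \<Omega>)) (scale (L2 \<Omega>)) (ip (W12 \<Omega>)) (elems (W12 \<Omega>))"
  unfolding sesq_ops.complete_wrt_def
proof (intro allI impI, elim conjE)
  let ?d = "\<lambda>u v. Re (ip (W12 \<Omega>) (add (L2 \<Omega>) u (scale (L2 \<Omega>) (-1) v)) (add (L2 \<Omega>) u (scale (L2 \<Omega>) (-1) v)))"
  let ?df = "\<lambda>f g. \<integral>x. (norm (f x - g x :: complex))\<^sup>2 \<partial>lebesgue_on \<Omega>"
    and ?dG = "\<lambda>f g. \<integral>x. (norm (f x - g x :: complex ^ 'n))\<^sup>2 \<partial>lebesgue_on \<Omega>"
  fix X :: "nat \<Rightarrow> 'n cfun set"
  assume X: "\<forall>n. X n \<in> elems (W12 \<Omega>)" and cauchy: "\<forall>e>0. \<exists>N. \<forall>m\<ge>N. \<forall>n\<ge>N. ?d (X m) (X n) < e"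
  have XL: "X n \<in> elems (L2 \<Omega>)" for n using X W12_simps(1) by blast
  have d: "?d (X m) (X n) = ?df (rep (X m)) (rep (X n)) + ?dG (grad \<Omega> (X m)) (grad \<Omega> (X n))" for m n
    using X by (intro W12_diff[OF \<Omega>]) auto
  have pos: "0 \<le> ?df f g" "0 \<le> ?dG F G" for f g F G by simp_all
  have cauchy_f: "\<exists>N. \<forall>m\<ge>N. \<forall>n\<ge>N. ?df (rep (X m)) (rep (X n)) < e" if "0 < e" for e
    using cauchy that pos(2) unfolding d by (meson add_increasing2 le_less_trans order_refl)
  have cauchy_G: "\<exists>N. \<forall>m\<ge>N. \<forall>n\<ge>N. ?dG (grad \<Omega> (X m)) (grad \<Omega> (X n)) < e" if "0 < e" for e
    using cauchy that pos(1) unfolding d by (meson add_increasing le_less_trans order_refl)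
  have sq: "square_integrable \<Omega> (rep (X n))" "square_integrable \<Omega> (grad \<Omega> (X n))" for n
    using X XL rep_square_integrable grad_square_integrable by blast+
  obtain f where f: "f \<in> borel_measurable (lebesgue_on \<Omega>)" "integrable (lebesgue_on \<Omega>) (\<lambda>x. (norm (f x))\<^sup>2)"
    and lim_f: "(\<lambda>n. ?df (rep (X n)) f) \<longlonglongrightarrow> 0"
    using L2_complete[OF square_integrable_meas[OF sq(1)] square_integrable_int[OF sq(1)] cauchy_f] by blast
  obtain G where G: "G \<in> borel_measurable (lebesgue_on \<Omega>)" "integrable (lebesgue_on \<Omega>) (\<lambda>x. (norm (G x))\<^sup>2)"
    and lim_G: "(\<lambda>n. ?dG (grad \<Omega> (X n)) G) \<longlonglongrightarrow> 0"
    using L2_complete[OF square_integrable_meas[OF sq(2)] square_integrable_int[OF sq(2)] cauchy_G] by blast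
  have sqf: "square_integrable \<Omega> f" and sqG: "square_integrable \<Omega> G"
    using f G by (auto simp: square_integrable_def)
  have wg: "weak_gradient \<Omega> f G"
    by (rule weak_gradient_closed[OF \<Omega> sq(1) sqf _ sqG lim_f lim_G]) (use X grad_weak_gradient in blast)
  define u where "u = L2_class \<Omega> f"
  have uf: "AE x in lebesgue_on \<Omega>. rep u x = f x" unfolding u_def by (rule rep_L2_class(2)[OF sqf])
  have uL: "u \<in> elems (L2 \<Omega>)" unfolding u_def by (rule L2_class_mem[OF sqf])
  note u = W12_memI[OF \<Omega> uL sqf wg uf]
  have "?d (X n) u = ?df (rep (X n)) f + ?dG (grad \<Omega> (X n)) G" for n
  proof -
    note meas = square_integrable_meas[OF sq(1)] square_integrable_meas[OF sq(2)] f(1) G(1)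
      square_integrable_meas[OF rep_square_integrable[OF uL]] square_integrable_meas[OF grad_square_integrable[OF u(1)]]
    have "?df (rep (X n)) (rep u) = ?df (rep (X n)) f"
      by (rule integral_cong_AE) (use meas uf in auto)
    moreover have "?dG (grad \<Omega> (X n)) (grad \<Omega> u) = ?dG (grad \<Omega> (X n)) G"
      by (rule integral_cong_AE) (use meas u(2) in auto)
    ultimately show ?thesis using W12_diff[OF \<Omega> _ u(1), of "X n"] X by simp
  qed
  then have "(\<lambda>n. ?d (X n) u) \<longlonglongrightarrow> 0 + 0"
    using tendsto_add[OF lim_f lim_G] by simp
  then show "\<exists>u\<in>elems (W12 \<Omega>). (\<lambda>n. ?d (X n) u) \<longlonglongrightarrow> 0" using u(1) by auto
qed

lemma closed_subspace_complete:
  assumes \<Omega>: "open \<Omega>" and V: "closed_subspace (W12 \<Omega>) V"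
  shows "sesq_ops.complete_wrt (add (L2 \<Omega>)) (scale (L2 \<Omega>)) (ip (W12 \<Omega>)) V"
  unfolding sesq_ops.complete_wrt_def
proof (intro allI impI, elim conjE)
  let ?d = "\<lambda>u v. Re (ip (W12 \<Omega>) (add (L2 \<Omega>) u (scale (L2 \<Omega>) (-1) v)) (add (L2 \<Omega>) u (scale (L2 \<Omega>) (-1) v)))"
  fix X :: "nat \<Rightarrow> 'a cfun set"
  assume X: "\<forall>n. X n \<in> V" and cauchy: "\<forall>e>0. \<exists>N. \<forall>m\<ge>N. \<forall>n\<ge>N. ?d (X m) (X n) < e"
  have "\<forall>n. X n \<in> elems (W12 \<Omega>)" using X V unfolding closed_subspace_def by blast
  then obtain u where u: "u \<in> elems (W12 \<Omega>)" and lim: "(\<lambda>n. ?d (X n) u) \<longlonglongrightarrow> 0"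
    using W12_complete[OF \<Omega>] cauchy unfolding sesq_ops.complete_wrt_def by blast
  have "(\<lambda>n. hdist (W12 \<Omega>) (X n) u) \<longlonglongrightarrow> sqrt 0"
    unfolding hdist_def hnorm_def W12_simps(2,3) by (intro tendsto_real_sqrt lim)
  then have "u \<in> V" using V X u unfolding closed_subspace_def real_sqrt_zero by blast
  then show "\<exists>u\<in>V. (\<lambda>n. ?d (X n) u) \<longlonglongrightarrow> 0" using lim by blast
qed

section \<open>Sectors\<close>

text \<open>With its converse \<open>Re_ge_sector\<close> this describes the sector by an inequality
  between continuous functions, which shows closedness and matches the form estimates.\<close>

lemma mem_sectorI:
  assumes "0 \<le> \<kappa>" "\<kappa> < pi / 2" and w: "cmod w * cos \<kappa> \<le> Re w"
  shows "w \<in> sector \<kappa>"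
proof (cases "w = 0")
  case True
  then show ?thesis using assms unfolding sector_def by (intro CollectI exI[of _ 0]) auto
next
  case False
  then have pos: "0 < cmod w" by simp
  have "0 < cos \<kappa>" using assms by (intro cos_gt_zero_pi) auto
  define t where "t = Arg w"
  have t: "w = of_real (cmod w) * cis t" "-pi < t" "t \<le> pi"
    using False rcis_cmod_Arg[of w] Arg_bounded[of w] by (auto simp: t_def rcis_def)
  have "Re w = cmod w * cos t" by (subst t(1)) simp
  then have "cos \<kappa> \<le> cos \<bar>t\<bar>" using w pos by simp
  then have "\<bar>t\<bar> \<le> \<kappa>"
    using cos_mono_le_eq[of \<kappa> "\<bar>t\<bar>"] t(2,3) assms by auto
  then show ?thesis
    unfolding sector_def using t(1) by (intro CollectI exI[of _ "cmod w"] exI[of _ t]) auto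
qed

lemma Re_ge_sector:
  assumes "w \<in> sector \<kappa>" "0 \<le> \<kappa>" "\<kappa> \<le> pi"
  shows "cmod w * cos \<kappa> \<le> Re w"
proof -
  obtain r t where w: "w = of_real r * cis t" and r: "0 \<le> r" and t: "- \<kappa> \<le> t" "t \<le> \<kappa>"
    using assms(1) by (auto simp: sector_def)
  have "cos \<kappa> \<le> cos \<bar>t\<bar>" using t assms by (intro cos_monotone_0_pi_le) auto
  then show ?thesis using r by (simp add: w norm_mult mult_left_mono)
qed

lemma sector_closed:
  assumes "0 \<le> \<kappa>" "\<kappa> < pi / 2"
  shows "closed (sector \<kappa>)"
proof -
  have "sector \<kappa> = {w. cmod w * cos \<kappa> \<le> Re w}"
    using mem_sectorI Re_ge_sector assms by fastforce
  moreover have "closed {w. cmod w * cos \<kappa> \<le> Re w}"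
    by (intro closed_Collect_le continuous_intros)
  ultimately show ?thesis by simp
qed

text \<open>The directions of \<open>w\<close> and \<open>- z\<close> differ by at least
  \<open>\<theta> - \<kappa>\<close>, and a point at distance \<open>cmod z\<close> from 0 has
  distance at least \<open>cmod z * sin (\<theta> - \<kappa>)\<close> to rays that far off.\<close>

lemma sector_distance:
  assumes \<kappa>: "0 \<le> \<kappa>" "\<kappa> < \<theta>" "\<theta> < pi / 2" and w: "w \<in> sector \<kappa>" and z: "z \<in> sector (pi - \<theta>)"
  shows "cmod z * sin (\<theta> - \<kappa>) \<le> cmod (w + z)"
proof -
  obtain r t where r: "w = of_real r * cis t" "0 \<le> r" "- \<kappa> \<le> t" "t \<le> \<kappa>"
    using w by (auto simp: sector_def)
  obtain s t' where s: "z = of_real s * cis t'" "0 \<le> s" "- (pi - \<theta>) \<le> t'" "t' \<le> pi - \<theta>"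
    using z by (auto simp: sector_def)
  let ?c = "cos (\<theta> - \<kappa>)" and ?s = "sin (\<theta> - \<kappa>)"
  have "cos (pi - (\<theta> - \<kappa>)) \<le> cos \<bar>t - t'\<bar>"
    using r s \<kappa> by (intro cos_monotone_0_pi_le) auto
  then have "- ?c \<le> cos (t - t')" by simp
  then have "- (2 * r * s * ?c) \<le> 2 * r * s * cos (t - t')"
    using mult_left_mono[of "- ?c" "cos (t - t')" "2 * r * s"] r(2) s(2) by simp
  moreover have "(cmod (w + z))\<^sup>2 = r\<^sup>2 + s\<^sup>2 + 2 * r * s * cos (t - t')"
  proof -
    have expand: "(r * a + s * c)\<^sup>2 + (r * b + s * d)\<^sup>2
        = r\<^sup>2 * (a\<^sup>2 + b\<^sup>2) + s\<^sup>2 * (c\<^sup>2 + d\<^sup>2) + 2 * r * s * (a * c + b * d)" for a b c d :: real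
      by (simp add: power2_eq_square algebra_simps)
    have "(cmod (w + z))\<^sup>2 = (r * cos t + s * cos t')\<^sup>2 + (r * sin t + s * sin t')\<^sup>2"
      unfolding cmod_power2 r(1) s(1) by simp
    then show ?thesis unfolding expand cos_diff by simp
  qed
  moreover have "s\<^sup>2 * ?s\<^sup>2 + s\<^sup>2 * ?c\<^sup>2 = s\<^sup>2"
    by (simp flip: distrib_left)
  \<comment> \<open>Completing the square in \<open>r\<close> leaves the part of \<open>s\<close>
    perpendicular to the ray.\<close>
  moreover have "(r - s * ?c)\<^sup>2 = r\<^sup>2 - 2 * r * s * ?c + s\<^sup>2 * ?c\<^sup>2"
    by (simp add: power2_eq_square algebra_simps)
  ultimately have "(s * ?s)\<^sup>2 \<le> (cmod (w + z))\<^sup>2"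
    using zero_le_power2[of "r - s * ?c"] by (simp add: power_mult_distrib)
  then have "s * ?s \<le> cmod (w + z)" by (rule power2_le_imp_le) simp
  then show ?thesis using s by (simp add: norm_mult)
qed

section \<open>The ellipticity constants\<close>

lemma matrix_vector_mult_bounded_linear: "bounded_linear ((*v) (A :: complex ^ 'n::finite ^ 'm::finite))"
proof -
  have "linear ((*v) A)"
  proof (rule linearI)
    show "A *v (r *\<^sub>R x) = r *\<^sub>R (A *v x)" for r x
      by (simp add: matrix_vector_mult_def vec_eq_iff scaleR_sum_right)
  qed (rule matrix_vector_right_distrib)
  then show ?thesis by (simp add: linear_conv_bounded_linear)
qed

text \<open>Sending a matrix to its operator is linear in finite dimension, hence continuous, so the
  operator norm is Borel. The constant \<open>K\<close> later makes the essential supremum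
  finite.\<close>

lemma matrix_onorm:
  obtains K where "0 \<le> K" "\<And>A :: complex ^ 'n::finite ^ 'n. onorm ((*v) A) \<le> K * norm A"
    "(\<lambda>A :: complex ^ 'n ^ 'n. onorm ((*v) A)) \<in> borel_measurable borel"
proof -
  define L where "L = (\<lambda>A :: complex ^ 'n ^ 'n. Blinfun ((*v) A))"
  have appl: "blinfun_apply (L A) = (*v) A" for A
    unfolding L_def by (rule bounded_linear_Blinfun_apply[OF matrix_vector_mult_bounded_linear])
  have "linear L"
  proof (rule linearI; rule blinfun_eqI)
    show "blinfun_apply (L (A + B)) v = blinfun_apply (L A + L B) v" for A B v
      by (simp add: appl blinfun.add_left matrix_vector_mult_add_rdistrib)
    show "blinfun_apply (L (r *\<^sub>R A)) v = blinfun_apply (r *\<^sub>R L A) v" for r A v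
      by (simp add: appl blinfun.scaleR_left matrix_vector_mult_def vec_eq_iff scaleR_sum_right)
  qed
  then have L: "bounded_linear L" by (simp add: linear_conv_bounded_linear)
  have norm: "onorm ((*v) A) = norm (L A)" for A by (simp add: norm_blinfun.rep_eq appl)
  obtain K where K: "0 \<le> K" "\<And>A. norm (L A) \<le> norm A * K"
    using bounded_linear.nonneg_bounded[OF L] by blast
  have "continuous_on UNIV (\<lambda>A. norm (L A))"
    by (intro continuous_intros linear_continuous_on L)
  then show ?thesis
    using K by (intro that[of K]) (auto simp: norm mult.commute intro: borel_measurable_continuous_onI)
qed

text \<open>\<open>real_of_ereal\<close> sends infinite values to 0, so the extended essential
  supremum is first trapped between \<open>m\<close> and a finite bound.\<close>

lemma ess_sup_norm_bounds:
  fixes \<Omega> :: "(real ^ 'n::finite) set" and \<mu> :: "real ^ 'n \<Rightarrow> complex ^ 'n ^ 'n"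
  assumes \<Omega>: "open \<Omega>" "\<Omega> \<noteq> {}" and bdd: "bounded (\<mu> ` \<Omega>)"
    and meas: "\<mu> \<in> borel_measurable (lebesgue_on \<Omega>)"
    and coercive: "\<And>x \<xi>. x \<in> \<Omega> \<Longrightarrow> Re (cdot (\<mu> x *v \<xi>) (vcnj \<xi>)) \<ge> m * (norm \<xi>)\<^sup>2"
  shows "m \<le> ess_sup_norm \<Omega> \<mu>"
    "AE x in lebesgue_on \<Omega>. \<forall>\<xi>. norm (\<mu> x *v \<xi>) \<le> ess_sup_norm \<Omega> \<mu> * norm \<xi>"
proof -
  define n where "n = (\<lambda>x. onorm ((*v) (\<mu> x)))"
  define E where "E = esssup (lebesgue_on \<Omega>) (\<lambda>x. ereal (n x))"
  have M: "ess_sup_norm \<Omega> \<mu> = real_of_ereal E" by (simp add: ess_sup_norm_def E_def n_def)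
  obtain K where K: "0 \<le> K" "\<And>A :: complex ^ 'n ^ 'n. onorm ((*v) A) \<le> K * norm A"
    and onorm_meas: "(\<lambda>A :: complex ^ 'n ^ 'n. onorm ((*v) A)) \<in> borel_measurable borel"
    using matrix_onorm by blast
  obtain B where B: "\<And>x. x \<in> \<Omega> \<Longrightarrow> norm (\<mu> x) \<le> B" using bdd unfolding bounded_iff by blast
  have n_meas: "n \<in> borel_measurable (lebesgue_on \<Omega>)"
    unfolding n_def using measurable_compose[OF meas onorm_meas] .
  have "AE x in lebesgue_on \<Omega>. ereal (n x) \<le> ereal (K * B)"
  proof (rule AE_I2)
    fix x assume "x \<in> space (lebesgue_on \<Omega>)"
    then have "norm (\<mu> x) \<le> B" using B by (simp add: space_restrict_space)
    then show "ereal (n x) \<le> ereal (K * B)"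
      using K(2)[of "\<mu> x"] mult_left_mono[OF _ K(1)] unfolding n_def by fastforce
  qed
  then have upper: "E \<le> ereal (K * B)"
    unfolding E_def using n_meas by (intro esssup_I) auto
  have ae: "AE x in lebesgue_on \<Omega>. ereal (n x) \<le> E" unfolding E_def by (rule esssup_AE)
  have m_le: "m \<le> n x" if "x \<in> \<Omega>" for x
  proof -
    \<comment> \<open>Any unit vector serves to compare ellipticity with the operator norm; this one
      uses an arbitrary index.\<close>
    define \<xi> :: "complex ^ 'n" where "\<xi> = axis undefined 1"
    have 1: "norm \<xi> = 1" by (simp add: \<xi>_def norm_vec_def L2_set_def axis_def if_distrib[of cmod] if_distrib[of "\<lambda>x. x\<^sup>2"] cong: if_cong)
    have "m * (norm \<xi>)\<^sup>2 \<le> cmod (cdot (\<mu> x *v \<xi>) (vcnj \<xi>))"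
      using coercive[OF that] complex_Re_le_cmod order_trans by blast
    also have "\<dots> \<le> norm (\<mu> x *v \<xi>)" using cdot_vcnj_norm[of "\<mu> x *v \<xi>" \<xi>] 1 by simp
    also have "\<dots> \<le> n x" using onorm[OF matrix_vector_mult_bounded_linear, of "\<mu> x" \<xi>] 1 by (simp add: n_def)
    finally show ?thesis using 1 by simp
  qed
  \<comment> \<open>A constant statement valid almost everywhere is true only if the measure is not
    zero; a nonempty open set is not negligible.\<close>
  have "emeasure (lebesgue_on \<Omega>) (space (lebesgue_on \<Omega>)) \<noteq> 0"
  proof
    assume "emeasure (lebesgue_on \<Omega>) (space (lebesgue_on \<Omega>)) = 0"
    then have "emeasure lebesgue \<Omega> = 0"
      using \<Omega>(1) by (simp add: space_restrict_space emeasure_restrict_space)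
    then have "negligible \<Omega>" using \<Omega>(1) by (auto simp: negligible_iff_null_sets)
    then show False using open_not_negligible[OF \<Omega>] by blast
  qed
  then have nontrivial: "ae_filter (lebesgue_on \<Omega>) \<noteq> bot" by (simp add: ae_filter_eq_bot_iff)
  have "AE x in lebesgue_on \<Omega>. x \<in> \<Omega>" by (rule AE_I2) (simp add: space_restrict_space)
  with ae have "AE x in lebesgue_on \<Omega>. ereal m \<le> E"
    by eventually_elim (metis m_le ereal_less_eq(3) order_trans)
  then have lower: "ereal m \<le> E" using eventually_const[OF nontrivial] by blast
  have E: "E = ereal (ess_sup_norm \<Omega> \<mu>)"
    using upper lower unfolding M by (cases E) auto
  show "m \<le> ess_sup_norm \<Omega> \<mu>" using lower unfolding E by simp
  show "AE x in lebesgue_on \<Omega>. \<forall>\<xi>. norm (\<mu> x *v \<xi>) \<le> ess_sup_norm \<Omega> \<mu> * norm \<xi>"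
    using ae
  proof eventually_elim
    fix x assume "ereal (n x) \<le> E"
    then have le: "n x \<le> ess_sup_norm \<Omega> \<mu>" by (simp add: E)
    show "\<forall>\<xi>. norm (\<mu> x *v \<xi>) \<le> ess_sup_norm \<Omega> \<mu> * norm \<xi>"
    proof
      fix \<xi>
      have "norm (\<mu> x *v \<xi>) \<le> n x * norm \<xi>"
        unfolding n_def by (rule onorm[OF matrix_vector_mult_bounded_linear])
      also have "\<dots> \<le> ess_sup_norm \<Omega> \<mu> * norm \<xi>" using le by (rule mult_right_mono) simp
      finally show "norm (\<mu> x *v \<xi>) \<le> ess_sup_norm \<Omega> \<mu> * norm \<xi>" .
    qed
  qed
qed

section \<open>Spectrum and resolvent of elliptic operators\<close>

locale elliptic_problem =
  bounded_coefficient \<Omega> \<mu> M for \<Omega> :: "(real ^ 'n::finite) set" and \<mu> and M :: real +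
  fixes V :: "'n cfun set set" and m :: real
  assumes m: "0 < m"
    and coercive: "\<And>x \<xi>. x \<in> \<Omega> \<Longrightarrow> Re (cdot (\<mu> x *v \<xi>) (vcnj \<xi>)) \<ge> m * (norm \<xi>)\<^sup>2"
    and V: "closed_subspace (W12 \<Omega>) V"
begin

abbreviation op :: "'n cfun set operator" where
  "op \<equiv> form_operator (L2 \<Omega>) V (elliptic_form \<Omega> \<mu>)"

abbreviation energy :: "'n cfun set \<Rightarrow> real" where
  "energy u \<equiv> \<integral>x. (norm (grad \<Omega> u x))\<^sup>2 \<partial>lebesgue_on \<Omega>"

lemma V_subset: "V \<subseteq> elems (W12 \<Omega>)" "V \<subseteq> elems (L2 \<Omega>)"
  using V W12_simps(1) unfolding closed_subspace_def by blast+

sublocale form_setting "add (L2 \<Omega>)" "scale (L2 \<Omega>)" "elems (L2 \<Omega>)" V "ip (L2 \<Omega>)" "ip (W12 \<Omega>)"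
  "elliptic_form \<Omega> \<mu>" "M\<^sup>2" m
proof -
  interpret sesq_ops "add (L2 \<Omega>)" "scale (L2 \<Omega>)" .
  note W = W12_herm_pos[OF open_domain] and L = L2_herm_pos[of \<Omega>]
  have energy: "Re (ip (W12 \<Omega>) u u) = Re (ip (L2 \<Omega>) u u) + energy u" for u
    unfolding W12_ip_diag L2_ip_diag ..
  have pos: "0 \<le> energy u" "0 \<le> Re (ip (L2 \<Omega>) u u)" for u unfolding L2_ip_diag by simp_all
  show "form_setting (add (L2 \<Omega>)) (scale (L2 \<Omega>)) (elems (L2 \<Omega>)) V (ip (L2 \<Omega>)) (ip (W12 \<Omega>))
      (elliptic_form \<Omega> \<mu>) (M\<^sup>2) m"
  proof
    show "lin_closed (elems (L2 \<Omega>))" by (rule L2_lin_closed)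
    show "lin_closed V" using V unfolding closed_subspace_def lin_closed_def W12_simps by blast
    show "V \<subseteq> elems (L2 \<Omega>)" by (rule V_subset)
    show "herm_pos (elems (L2 \<Omega>)) (ip (L2 \<Omega>))" by (rule L)
    show "herm_pos V (ip (W12 \<Omega>))" by (rule herm_pos_subset[OF W V_subset(1)])
    show "complete_wrt (ip (W12 \<Omega>)) V" by (rule closed_subspace_complete[OF open_domain V])
    show "Re (ip (L2 \<Omega>) u u) \<le> Re (ip (W12 \<Omega>) u u)" for u using energy pos by simp
    show "Re (ip (W12 \<Omega>) u u) = 0" if u: "u \<in> V" "Re (ip (L2 \<Omega>) u u) = 0" for u
    proof -
      have uL: "u \<in> elems (L2 \<Omega>)" "scale (L2 \<Omega>) 0 u \<in> elems (L2 \<Omega>)"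
        using u V_subset L2_scale by blast+
      \<comment> \<open>The multiple \<open>scale (L2 \<Omega>) 0 u\<close> plays the zero vector:
        \<open>u\<close> equals it as a class, and homogeneity then makes its product in
        \<open>W12\<close> vanish.\<close>
      have "Re (ip (L2 \<Omega>) (diff u (scale (L2 \<Omega>) 0 u)) (diff u (scale (L2 \<Omega>) 0 u))) = 0"
        using uL u(2) by (simp add: sesqD[OF herm_posD(1)[OF L]] L2_scale L2_add)
      then have "u = scale (L2 \<Omega>) 0 u" by (rule L2_zero_imp_eq[OF uL])
      then have "ip (W12 \<Omega>) u u = 0 * ip (W12 \<Omega>) u u"
        using sesqD(3)[OF herm_posD(1)[OF W], of u u 0] u(1) V_subset(1) by auto
      then show ?thesis by simp
    qed
    show "sesq V (elliptic_form \<Omega> \<mu>)" by (rule sesq_subset[OF form_sesq V_subset(1)])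
    show "0 \<le> M\<^sup>2" by simp
    show "0 < m" by (rule m)
    show "(cmod (elliptic_form \<Omega> \<mu> u v))\<^sup>2 \<le> M\<^sup>2 * Re (ip (W12 \<Omega>) u u) * Re (ip (W12 \<Omega>) v v)"
      if "u \<in> V" "v \<in> V" for u v
    proof -
      have "(cmod (elliptic_form \<Omega> \<mu> u v))\<^sup>2 \<le> (M * sqrt (energy u * energy v))\<^sup>2"
        using form_bound that V_subset(1) by (intro power_mono) auto
      also have "\<dots> = M\<^sup>2 * (energy u * energy v)"
        using pos by (simp add: power_mult_distrib)
      also have "\<dots> \<le> M\<^sup>2 * (Re (ip (W12 \<Omega>) u u) * Re (ip (W12 \<Omega>) v v))"
        using pos energy by (intro mult_left_mono mult_mono) auto
      finally show ?thesis by (simp add: mult.assoc)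
    qed
    show "m * (Re (ip (W12 \<Omega>) u u) - Re (ip (L2 \<Omega>) u u)) \<le> Re (elliptic_form \<Omega> \<mu> u u)" if "u \<in> V" for u
      using form_coercive[OF _ coercive] that V_subset(1) energy by auto
  qed
qed

lemma op_eq_graph: "op = graph"
  by (simp add: form_operator_def graph_def)

lemma numerical_range_eq: "numerical_range (L2 \<Omega>) op = num_range"
  by (simp add: numerical_range_def num_range_def op_eq_graph hnorm_def)

lemma numerical_range_sector:
  assumes "w \<in> num_range" "0 \<le> \<kappa>" "\<kappa> < pi / 2" "M * cos \<kappa> \<le> m"
  shows "w \<in> sector \<kappa>"
proof (rule mem_sectorI[OF assms(2,3)])
  obtain u g where g: "(u, g) \<in> graph" and w: "w = ip (L2 \<Omega>) g u"
    using assms(1) by (auto simp: num_range_def)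
  have u: "u \<in> V" "u \<in> elems (W12 \<Omega>)" using graphD[OF g] V_subset by blast+
  have w: "w = elliptic_form \<Omega> \<mu> u u" using graphD(3)[OF g u(1)] w by simp
  have pos: "0 \<le> energy u" by simp
  then have "cmod w \<le> M * energy u" using form_bound[OF u(2) u(2)] by (simp add: w)
  then have "cmod w * cos \<kappa> \<le> M * energy u * cos \<kappa>"
    using assms by (intro mult_right_mono cos_ge_zero) auto
  also have "\<dots> = M * cos \<kappa> * energy u" by simp
  also have "\<dots> \<le> m * energy u" using assms(4) pos by (rule mult_right_mono)
  also have "\<dots> \<le> Re w" unfolding w by (rule form_coercive[OF u(2) coercive])
  finally show "cmod w * cos \<kappa> \<le> Re w" .
qed

lemma shift_iff:
  "(u, f) \<in> op_shift (L2 \<Omega>) op \<zeta> \<longleftrightarrow> (\<exists>g. (u, g) \<in> graph \<and> f = add (L2 \<Omega>) g (scale (L2 \<Omega>) \<zeta> u))"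
  by (auto simp: op_shift_def op_eq_graph)

lemma shift_bound:
  assumes \<delta>: "0 < \<delta>" "\<And>w. w \<in> num_range \<Longrightarrow> \<delta> \<le> cmod (w - z)"
    and "(u, f) \<in> op_shift (L2 \<Omega>) op (- z)"
  shows "hnorm (L2 \<Omega>) u \<le> 1 / \<delta> * hnorm (L2 \<Omega>) f"
proof -
  obtain g where g: "(u, g) \<in> graph" "f = add (L2 \<Omega>) g (scale (L2 \<Omega>) (- z) u)"
    using assms(3) shift_iff by blast
  have "sqrt (\<delta>\<^sup>2 * Re (ip (L2 \<Omega>) u u)) \<le> sqrt (Re (ip (L2 \<Omega>) f f))"
    unfolding g(2) using \<delta> by (intro real_sqrt_le_mono resolvent_bound[OF _ _ g(1)]) auto
  then have "\<delta> * hnorm (L2 \<Omega>) u \<le> hnorm (L2 \<Omega>) f"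
    using \<delta>(1) by (simp add: hnorm_def real_sqrt_mult)
  then show ?thesis using \<delta>(1) by (simp add: field_simps)
qed

text \<open>Positive distance puts \<open>z\<close> outside the closed numerical range, so a
  solution exists; \<open>resolvent_bound\<close> for the difference of two solutions gives
  uniqueness.\<close>

lemma shift_boundedly_invertible:
  assumes \<delta>: "0 < \<delta>" "\<And>w. w \<in> num_range \<Longrightarrow> \<delta> \<le> cmod (w - z)"
  shows "boundedly_invertible (L2 \<Omega>) (op_shift (L2 \<Omega>) op (- z))"
  unfolding boundedly_invertible_def
proof (intro conjI ballI)
  note ps = sesqD[OF herm_posD(1)[OF p]] and L = L2_add(1) L2_scale(1)
  show "\<exists>C. \<forall>u f. (u, f) \<in> op_shift (L2 \<Omega>) op (- z) \<longrightarrow> hnorm (L2 \<Omega>) u \<le> C * hnorm (L2 \<Omega>) f"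
    using shift_bound[OF \<delta>] by blast
  fix f assume f: "f \<in> elems (L2 \<Omega>)"
  have "z \<notin> closure num_range"
    unfolding closure_approachable using \<delta> by (auto simp: dist_norm not_less)
  then obtain u where u: "u \<in> V"
    and sol: "\<And>v. v \<in> V \<Longrightarrow> elliptic_form \<Omega> \<mu> u v - z * ip (L2 \<Omega>) u v = ip (L2 \<Omega>) f v"
    using resolvent_surjective[OF _ f] by blast
  define g where "g = add (L2 \<Omega>) f (scale (L2 \<Omega>) z u)"
  have uL: "u \<in> elems (L2 \<Omega>)" using u V_subset by blast
  have gL: "g \<in> elems (L2 \<Omega>)" unfolding g_def using f uL by (simp add: L)
  have "elliptic_form \<Omega> \<mu> u v = ip (L2 \<Omega>) g v" if "v \<in> V" for v
  proof -
    have "v \<in> elems (L2 \<Omega>)" using that V_subset by blast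
    then have "ip (L2 \<Omega>) g v = ip (L2 \<Omega>) f v + z * ip (L2 \<Omega>) u v"
      unfolding g_def using f uL by (simp add: ps L)
    then show ?thesis using sol[OF that] by (simp add: algebra_simps)
  qed
  then have g: "(u, g) \<in> graph" using u gL by (simp add: graph_def)
  \<comment> \<open>The difference of both sides pairs to zero with everything, so definiteness
    gives equality of classes.\<close>
  have "add (L2 \<Omega>) g (scale (L2 \<Omega>) (- z) u) = f"
  proof (rule L2_zero_imp_eq)
    show "Re (ip (L2 \<Omega>) (diff (add (L2 \<Omega>) g (scale (L2 \<Omega>) (- z) u)) f)
        (diff (add (L2 \<Omega>) g (scale (L2 \<Omega>) (- z) u)) f)) = 0"
    proof -
      let ?w = "diff (add (L2 \<Omega>) g (scale (L2 \<Omega>) (- z) u)) f"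
      have "ip (L2 \<Omega>) ?w y = 0" if "y \<in> elems (L2 \<Omega>)" for y
        unfolding g_def using f uL that by (simp add: ps L)
      moreover have "?w \<in> elems (L2 \<Omega>)" using f uL gL by (simp add: L)
      ultimately show ?thesis by simp
    qed
  qed (use f uL gL in \<open>simp_all add: L\<close>)
  then have ex: "(u, f) \<in> op_shift (L2 \<Omega>) op (- z)" using shift_iff g by blast
  show "\<exists>!u. (u, f) \<in> op_shift (L2 \<Omega>) op (- z)"
  proof (intro ex1I, rule ex)
    fix u' assume "(u', f) \<in> op_shift (L2 \<Omega>) op (- z)"
    then obtain g' where g': "(u', g') \<in> graph" "f = add (L2 \<Omega>) g' (scale (L2 \<Omega>) (- z) u')"
      using shift_iff by blast
    obtain g where g: "(u, g) \<in> graph" "f = add (L2 \<Omega>) g (scale (L2 \<Omega>) (- z) u)"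
      using ex shift_iff by blast
    have mem: "u \<in> elems (L2 \<Omega>)" "u' \<in> elems (L2 \<Omega>)" "g \<in> elems (L2 \<Omega>)" "g' \<in> elems (L2 \<Omega>)"
      using graphD(1,2)[OF g(1)] graphD(1,2)[OF g'(1)] V_subset(2) by blast+
    let ?x = "diff u' u" and ?k = "diff g' g"
    let ?e = "add (L2 \<Omega>) ?k (scale (L2 \<Omega>) (- z) ?x)"
    \<comment> \<open>\<open>?e\<close> is the image of \<open>u' - u\<close> under the shifted
      operator, and both images are \<open>f\<close>.\<close>
    have "ip (L2 \<Omega>) ?e y = 0" if y: "y \<in> elems (L2 \<Omega>)" for y
    proof -
      have "ip (L2 \<Omega>) ?e y = ip (L2 \<Omega>) (add (L2 \<Omega>) g' (scale (L2 \<Omega>) (- z) u')) y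
          - ip (L2 \<Omega>) (add (L2 \<Omega>) g (scale (L2 \<Omega>) (- z) u)) y"
        using mem y by (simp add: ps L algebra_simps)
      then show ?thesis by (simp flip: g(2) g'(2))
    qed
    moreover have "?e \<in> elems (L2 \<Omega>)" using mem by (simp add: L)
    moreover have "\<delta>\<^sup>2 * Re (ip (L2 \<Omega>) ?x ?x) \<le> Re (ip (L2 \<Omega>) ?e ?e)"
      using \<delta> by (intro resolvent_bound graph_add graph_scale g g') auto
    ultimately have "\<delta>\<^sup>2 * Re (ip (L2 \<Omega>) ?x ?x) \<le> 0" by simp
    moreover have "0 \<le> Re (ip (L2 \<Omega>) ?x ?x)" unfolding L2_ip_diag by simp
    ultimately have "Re (ip (L2 \<Omega>) ?x ?x) = 0" using \<delta>(1) by (simp add: mult_le_0_iff)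
    then show "u' = u" by (rule L2_zero_imp_eq[OF mem(2,1)])
  qed
qed

lemma spectrum_subset: "spectrum (L2 \<Omega>) op \<subseteq> closure num_range"
proof
  fix z assume z: "z \<in> spectrum (L2 \<Omega>) op"
  show "z \<in> closure num_range"
  proof (rule ccontr)
    assume "z \<notin> closure num_range"
    then obtain \<delta> where "0 < \<delta>" "\<And>w. w \<in> num_range \<Longrightarrow> \<delta> \<le> cmod (w - z)"
      unfolding closure_approachable dist_norm by (meson not_less)
    then have "z \<in> resolvent_set (L2 \<Omega>) op"
      unfolding resolvent_set_def using shift_boundedly_invertible by blast
    then show False using z by (simp add: spectrum_def)
  qed
qed

lemma resolvent_op_norm:
  assumes \<delta>: "0 < \<delta>" "\<And>w. w \<in> num_range \<Longrightarrow> \<delta> \<le> cmod (w - z)"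
  shows "op_norm (L2 \<Omega>) ((op_shift (L2 \<Omega>) op (- z))\<inverse>) \<le> 1 / \<delta>"
  unfolding op_norm_def
proof (rule cSup_least)
  \<comment> \<open>The supremum needs a nonempty set; the zero vector, again of the form
    \<open>scale (L2 \<Omega>) 0 f\<close>, supplies an element.\<close>
  obtain f where f: "f \<in> elems (L2 \<Omega>)" using linH(1) by blast
  have f0: "scale (L2 \<Omega>) 0 f \<in> elems (L2 \<Omega>)" using f by (rule L2_scale)
  then have "ip (L2 \<Omega>) (scale (L2 \<Omega>) 0 f) (scale (L2 \<Omega>) 0 f) = 0"
    using f by (simp add: sesqD[OF herm_posD(1)[OF p]])
  then have "hnorm (L2 \<Omega>) (scale (L2 \<Omega>) 0 f) \<le> 1" by (simp add: hnorm_def)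
  moreover obtain u where "(u, scale (L2 \<Omega>) 0 f) \<in> op_shift (L2 \<Omega>) op (- z)"
    using shift_boundedly_invertible[OF \<delta>] f0 unfolding boundedly_invertible_def by blast
  ultimately show "{hnorm (L2 \<Omega>) v |u v. (u, v) \<in> (op_shift (L2 \<Omega>) op (- z))\<inverse> \<and> hnorm (L2 \<Omega>) u \<le> 1} \<noteq> {}"
    by blast
  fix r assume "r \<in> {hnorm (L2 \<Omega>) v |u v. (u, v) \<in> (op_shift (L2 \<Omega>) op (- z))\<inverse> \<and> hnorm (L2 \<Omega>) u \<le> 1}"
  then obtain u v where uv: "r = hnorm (L2 \<Omega>) v" "(v, u) \<in> op_shift (L2 \<Omega>) op (- z)" "hnorm (L2 \<Omega>) u \<le> 1"
    by blast
  have "r \<le> 1 / \<delta> * hnorm (L2 \<Omega>) u" unfolding uv(1) by (rule shift_bound[OF \<delta> uv(2)])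
  also have "\<dots> \<le> 1 / \<delta> * 1" using uv(3) \<delta>(1) by (intro mult_left_mono) auto
  finally show "r \<le> 1 / \<delta>" by simp
qed

end

section \<open>Spectral inclusion and resolvent estimate\<close>

theorem corollary2p4:
  fixes \<Omega> :: "(real ^ 'n) set"
    and \<mu> :: "real ^ 'n \<Rightarrow> complex ^ 'n ^ 'n"
    and m M \<kappa> :: real
    and V :: "'n cfun set set"
    and A :: "'n cfun set operator"
  assumes "open \<Omega>" and "\<Omega> \<noteq> {}"
    and "bounded (\<mu> ` \<Omega>)" and "\<mu> \<in> borel_measurable (lebesgue_on \<Omega>)"
    and "m > 0"
    and "\<And>x \<xi>. x \<in> \<Omega> \<Longrightarrow> Re (cdot (\<mu> x *v \<xi>) (vcnj \<xi>)) \<ge> m * (norm \<xi>)\<^sup>2"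
    and "M = ess_sup_norm \<Omega> \<mu>"
    and "\<kappa> = arctan (sqrt ((M / m)\<^sup>2 - 1))"
    and "closed_subspace (W12 \<Omega>) V"
    and "L2_class \<Omega> ` test_functions \<Omega> \<subseteq> V"
    and "A = form_operator (L2 \<Omega>) V (elliptic_form \<Omega> \<mu>)"
  shows "spectrum (L2 \<Omega>) A \<subseteq> closure (numerical_range (L2 \<Omega>) A)
    \<and> closure (numerical_range (L2 \<Omega>) A) \<subseteq> sector \<kappa>
    \<and> (\<forall>\<theta>\<in>{\<kappa><..<pi / 2}. \<forall>z\<in>sector (pi - \<theta>) - {0}.
          - z \<in> resolvent_set (L2 \<Omega>) A
        \<and> op_norm (L2 \<Omega>) ((op_shift (L2 \<Omega>) A z)\<inverse>)
            \<le> M / (m * sin \<theta> - sqrt (M\<^sup>2 - m\<^sup>2) * cos \<theta>) * (1 / cmod z))"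
proof -
  note bounds = ess_sup_norm_bounds[OF assms(1-4,6), folded assms(7)]
  have mM: "0 < m" "m \<le> M" "0 < M" using assms(5) bounds(1) by linarith+
  interpret elliptic_problem \<Omega> \<mu> M V m
    by unfold_locales (use assms bounds(2) mM in auto)
  \<comment> \<open>Since \<open>m \<le> M\<close> the radicand is nonnegative, and
    \<open>cos (arctan x) = 1 / sqrt (1 + x^2)\<close> then evaluates to
    \<open>m / M\<close>.\<close>
  have sq: "1 + (sqrt ((M / m)\<^sup>2 - 1))\<^sup>2 = (M / m)\<^sup>2"
    using mM by (subst real_sqrt_pow2) (auto simp: field_simps intro: power_mono)
  have root: "sqrt (1 + (sqrt ((M / m)\<^sup>2 - 1))\<^sup>2) = M / m" unfolding sq using mM by simp
  have cos: "cos \<kappa> = m / M" unfolding assms(8) cos_arctan root by simp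
  have "(M / m)\<^sup>2 - 1 = (M\<^sup>2 - m\<^sup>2) / m\<^sup>2" using mM by (simp add: power_divide diff_divide_distrib)
  then have "sqrt ((M / m)\<^sup>2 - 1) = sqrt (M\<^sup>2 - m\<^sup>2) / m" using mM by (simp add: real_sqrt_divide)
  then have sin: "sin \<kappa> = sqrt (M\<^sup>2 - m\<^sup>2) / M" unfolding assms(8) sin_arctan root using mM by simp
  have "(1::real)\<^sup>2 \<le> (M / m)\<^sup>2" using mM by (intro power_mono) auto
  then have "0 \<le> \<kappa>" unfolding assms(8) by simp
  moreover have "\<kappa> < pi / 2" unfolding assms(8) by (rule arctan_ubound)
  ultimately have \<kappa>: "0 \<le> \<kappa>" "\<kappa> < pi / 2" .
  have range: "w \<in> sector \<kappa>" if "w \<in> num_range" for w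
    using that \<kappa> mM by (intro numerical_range_sector) (auto simp: cos)
  have resolvent: "- z \<in> resolvent_set (L2 \<Omega>) op \<and> op_norm (L2 \<Omega>) ((op_shift (L2 \<Omega>) op z)\<inverse>)
      \<le> M / (m * sin \<theta> - sqrt (M\<^sup>2 - m\<^sup>2) * cos \<theta>) * (1 / cmod z)"
    if \<theta>: "\<kappa> < \<theta>" "\<theta> < pi / 2" and z: "z \<in> sector (pi - \<theta>)" "z \<noteq> 0" for \<theta> z
  proof -
    define \<delta> where "\<delta> = cmod z * sin (\<theta> - \<kappa>)"
    have "0 < sin (\<theta> - \<kappa>)" using \<theta> \<kappa> by (intro sin_gt_zero) auto
    then have \<delta>: "0 < \<delta>" using z by (simp add: \<delta>_def)
    have dist: "\<delta> \<le> cmod (w - (- z))" if "w \<in> num_range" for w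
      using sector_distance[OF \<kappa>(1) \<theta> range[OF that] z(1)] by (simp add: \<delta>_def)
    \<comment> \<open>This identifies the denominator of the claim with
      \<open>M * sin (\<theta> - \<kappa>)\<close>.\<close>
    have "sin (\<theta> - \<kappa>) = (m * sin \<theta> - sqrt (M\<^sup>2 - m\<^sup>2) * cos \<theta>) / M"
      unfolding sin_diff sin cos by (simp add: diff_divide_distrib mult.commute)
    then have "1 / \<delta> = M / (m * sin \<theta> - sqrt (M\<^sup>2 - m\<^sup>2) * cos \<theta>) * (1 / cmod z)"
      by (simp add: \<delta>_def)
    then show ?thesis
      using resolvent_op_norm[OF \<delta> dist] shift_boundedly_invertible[OF \<delta> dist]
      by (simp add: resolvent_set_def)
  qed
  have "closure num_range \<subseteq> sector \<kappa>"
    using range \<kappa> by (intro closure_minimal sector_closed) auto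
  then show ?thesis
    unfolding assms(11) numerical_range_eq by (intro conjI spectrum_subset ballI resolvent) auto
qed

end
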